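(* Let $M$ be an irreducible $D$-module and let $t\ge 1$ be an integer such that $M\downarrow^{1}_{t}$ is reducible. Then $M\cong N\uparrow^{1}_{s}$ (as $D$-modules) for some divisor $s>1$ of $\gcd(t,\dim_F M)$ and some irreducible $D_{s}$-module $N$.
   Context: $(F,\phi)$ is a difference field, i.e. a field $F$ with a field automorphism $\phi$, such that $C=\{f\in F:\phi(f)=f\}$ is an algebraically closed field of characteristic zero. $D=F[\Phi,\Phi^{-1}]$ is the noncommutative ring with multiplication $\Phi\circ f=\phi(f)\circ\Phi$ for $f\in F$, and for $t\ge1$, $D_t=F[\Phi^t,\Phi^{-t}]\subseteq D$ (so $D_1=D$). A $D_t$-module is a left $D_t$-module that is finite-dimensional as an $F$-vector space. For a $D$-module $M$, the restriction $M\downarrow^1_t$ is $M$ regarded as a $D_t$-module. For a $D_s$-module $N$, the induced module is the $D$-module $N\uparrow^1_s=D\otimes_{D_s}N$. *)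

theory Defs
  imports
    "HOL-Algebra.Algebra"
    "Jordan_Normal_Form.Missing_VectorSpace"
begin

section \<open>Left modules over a not necessarily commutative ring\<close>

text \<open>The locale \<^locale>\<open>module\<close> of the library asks for a commutative ring of scalars; this is
  the same list of axioms over an arbitrary ring.\<close>

locale left_module = R?: ring R + M?: abelian_group M
    for R :: "('r, 'b) ring_scheme" (structure) and M :: "('r, 'm, 'c) module_scheme" (structure) +
  assumes smult_closed:
      "\<lbrakk>a \<in> carrier R; x \<in> carrier M\<rbrakk> \<Longrightarrow> a \<odot>\<^bsub>M\<^esub> x \<in> carrier M"
    and smult_l_distr:
      "\<lbrakk>a \<in> carrier R; b \<in> carrier R; x \<in> carrier M\<rbrakk> \<Longrightarrow>
        (a \<oplus>\<^bsub>R\<^esub> b) \<odot>\<^bsub>M\<^esub> x = a \<odot>\<^bsub>M\<^esub> x \<oplus>\<^bsub>M\<^esub> b \<odot>\<^bsub>M\<^esub> x"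
    and smult_r_distr:
      "\<lbrakk>a \<in> carrier R; x \<in> carrier M; y \<in> carrier M\<rbrakk> \<Longrightarrow>
        a \<odot>\<^bsub>M\<^esub> (x \<oplus>\<^bsub>M\<^esub> y) = a \<odot>\<^bsub>M\<^esub> x \<oplus>\<^bsub>M\<^esub> a \<odot>\<^bsub>M\<^esub> y"
    and smult_assoc:
      "\<lbrakk>a \<in> carrier R; b \<in> carrier R; x \<in> carrier M\<rbrakk> \<Longrightarrow>
        (a \<otimes>\<^bsub>R\<^esub> b) \<odot>\<^bsub>M\<^esub> x = a \<odot>\<^bsub>M\<^esub> (b \<odot>\<^bsub>M\<^esub> x)"
    and smult_one:
      "x \<in> carrier M \<Longrightarrow> \<one>\<^bsub>R\<^esub> \<odot>\<^bsub>M\<^esub> x = x"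

text \<open>\<open>Module.submodule\<close> is the notion of HOL-Algebra, which does not require commutative scalars;
  the unqualified name refers to the one of the AFP entry VectorSpace, which does.\<close>

definition irreducible_module ::
    "('r, 'b) ring_scheme \<Rightarrow> ('r, 'm, 'c) module_scheme \<Rightarrow> bool" where
  "irreducible_module R M \<longleftrightarrow>
     left_module R M \<and> carrier M \<noteq> {\<zero>\<^bsub>M\<^esub>} \<and>
     (\<forall>U. Module.submodule U R M \<longrightarrow> U = {\<zero>\<^bsub>M\<^esub>} \<or> U = carrier M)"

definition reducible_module ::
    "('r, 'b) ring_scheme \<Rightarrow> ('r, 'm, 'c) module_scheme \<Rightarrow> bool" where
  "reducible_module R M \<longleftrightarrow>
     left_module R M \<and>
     (\<exists>U. Module.submodule U R M \<and> U \<noteq> {\<zero>\<^bsub>M\<^esub>} \<and> U \<noteq> carrier M)"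

text \<open>The set \<^const>\<open>module_hom\<close> from VectorSpace makes no commutativity assumption.\<close>

definition isomorphic_modules ::
    "('r, 'b) ring_scheme \<Rightarrow> ('r, 'm, 'c) module_scheme \<Rightarrow> ('r, 'n, 'd) module_scheme \<Rightarrow> bool" where
  "isomorphic_modules R M N \<longleftrightarrow>
     (\<exists>h \<in> module_hom R M N. bij_betw h (carrier M) (carrier N))"


section \<open>Extension of scalars\<close>

text \<open>\<open>R \<otimes>\<^sub>S N\<close> for a subring \<open>S\<close> of \<open>R\<close> (a ring record with the operations of \<open>R\<close>) and a left
  \<open>S\<close>-module \<open>N\<close>: the free abelian group on \<open>R \<times> N\<close> modulo the subgroup generated by the relations
  of the tensor product.  The elements are cosets.\<close>

definition tensor_relations ::
    "('r, 'b) ring_scheme \<Rightarrow> ('r, 'c) ring_scheme \<Rightarrow> ('r, 'n, 'd) module_scheme \<Rightarrow>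
      ('r \<times> 'n \<Rightarrow>\<^sub>0 int) set" where
  "tensor_relations R S N =
     {frag_of (r \<oplus>\<^bsub>R\<^esub> r', x) - frag_of (r, x) - frag_of (r', x) | r r' x.
        r \<in> carrier R \<and> r' \<in> carrier R \<and> x \<in> carrier N} \<union>
     {frag_of (r, x \<oplus>\<^bsub>N\<^esub> x') - frag_of (r, x) - frag_of (r, x') | r x x'.
        r \<in> carrier R \<and> x \<in> carrier N \<and> x' \<in> carrier N} \<union>
     {frag_of (r \<otimes>\<^bsub>R\<^esub> a, x) - frag_of (r, a \<odot>\<^bsub>N\<^esub> x) | r a x.
        r \<in> carrier R \<and> a \<in> carrier S \<and> x \<in> carrier N}"

text \<open>In \<open>smult\<close> the cosets in the union all coincide: this is the map induced on the quotient by
  \<open>(d, x) \<mapsto> (r d, x)\<close>.  The fields \<open>mult\<close> and \<open>one\<close> of a module record carry no meaning.\<close>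

definition induced_module ::
    "('r, 'b) ring_scheme \<Rightarrow> ('r, 'c) ring_scheme \<Rightarrow> ('r, 'n, 'd) module_scheme \<Rightarrow>
      ('r, ('r \<times> 'n \<Rightarrow>\<^sub>0 int) set) module" where
  "induced_module R S N =
     (let G = free_Abelian_group (carrier R \<times> carrier N);
          K = generate G (tensor_relations R S N)
      in \<lparr>carrier = carrier (G Mod K),
          monoid.mult = undefined,
          monoid.one = undefined,
          ring.zero = \<one>\<^bsub>G Mod K\<^esub>,
          ring.add = monoid.mult (G Mod K),
          smult = (\<lambda>r A. \<Union>c\<in>A. K #>\<^bsub>G\<^esub> frag_extend (\<lambda>(d, x). frag_of (r \<otimes>\<^bsub>R\<^esub> d, x)) c)\<rparr>)"


section \<open>Difference fields and difference modules\<close>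

locale difference_field = field F for F (structure) +
  fixes \<phi> :: "'a \<Rightarrow> 'a"
  assumes automorphism: "\<phi> \<in> ring_iso F F"

definition constant_field :: "('a, 'b) ring_scheme \<Rightarrow> ('a \<Rightarrow> 'a) \<Rightarrow> ('a, 'b) ring_scheme" where
  "constant_field F \<phi> = F\<lparr>carrier := {f \<in> carrier F. \<phi> f = f}\<rparr>"

definition characteristic_zero :: "('a, 'b) ring_scheme \<Rightarrow> bool" where
  "characteristic_zero R \<longleftrightarrow> (\<forall>n::nat. n > 0 \<longrightarrow> [n] \<cdot>\<^bsub>R\<^esub> \<one>\<^bsub>R\<^esub> \<noteq> \<zero>\<^bsub>R\<^esub>)"

definition aut_power :: "('a, 'b) ring_scheme \<Rightarrow> ('a \<Rightarrow> 'a) \<Rightarrow> int \<Rightarrow> 'a \<Rightarrow> 'a" where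
  "aut_power F \<phi> i =
     (if 0 \<le> i then \<phi> ^^ nat i else inv_into (carrier F) \<phi> ^^ nat (- i))"

text \<open>\<open>D = F[\<Phi>, \<Phi>\<^sup>-\<^sup>1]\<close>: the finitely supported \<open>p\<close> stands for the sum of the \<open>p i \<Phi>\<^sup>i\<close>, and
  \<open>\<Phi>\<^sup>i f = \<phi>\<^sup>i(f) \<Phi>\<^sup>i\<close> gives the product.\<close>

definition skew_laurent :: "('a, 'b) ring_scheme \<Rightarrow> ('a \<Rightarrow> 'a) \<Rightarrow> (int \<Rightarrow> 'a) ring" where
  "skew_laurent F \<phi> =
     \<lparr>carrier = {p. (\<forall>i. p i \<in> carrier F) \<and> finite {i. p i \<noteq> \<zero>\<^bsub>F\<^esub>}},
      monoid.mult = (\<lambda>p q k. \<Oplus>\<^bsub>F\<^esub>i\<in>{i. p i \<noteq> \<zero>\<^bsub>F\<^esub>}. p i \<otimes>\<^bsub>F\<^esub> aut_power F \<phi> i (q (k - i))),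
      monoid.one = (\<lambda>i. if i = 0 then \<one>\<^bsub>F\<^esub> else \<zero>\<^bsub>F\<^esub>),
      ring.zero = (\<lambda>i. \<zero>\<^bsub>F\<^esub>),
      ring.add = (\<lambda>p q i. p i \<oplus>\<^bsub>F\<^esub> q i)\<rparr>"

text \<open>\<open>D\<^sub>t = F[\<Phi>\<^sup>t, \<Phi>\<^sup>-\<^sup>t]\<close> as a subring of \<open>D\<close>: only powers of \<open>\<Phi>\<^sup>t\<close> occur.\<close>

definition skew_laurent_sub ::
    "('a, 'b) ring_scheme \<Rightarrow> ('a \<Rightarrow> 'a) \<Rightarrow> nat \<Rightarrow> (int \<Rightarrow> 'a) ring" where
  "skew_laurent_sub F \<phi> t =
     (skew_laurent F \<phi>)
       \<lparr>carrier := {p \<in> carrier (skew_laurent F \<phi>). \<forall>i. p i \<noteq> \<zero>\<^bsub>F\<^esub> \<longrightarrow> int t dvd i}\<rparr>"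

definition laurent_const :: "('a, 'b) ring_scheme \<Rightarrow> 'a \<Rightarrow> int \<Rightarrow> 'a" where
  "laurent_const F f = (\<lambda>i. if i = 0 then f else \<zero>\<^bsub>F\<^esub>)"

definition underlying_space ::
    "('a, 'b) ring_scheme \<Rightarrow> (int \<Rightarrow> 'a, 'm, 'c) module_scheme \<Rightarrow> ('a, 'm) module" where
  "underlying_space F M =
     \<lparr>carrier = carrier M, monoid.mult = monoid.mult M, monoid.one = \<one>\<^bsub>M\<^esub>,
      ring.zero = \<zero>\<^bsub>M\<^esub>, ring.add = ring.add M,
      smult = (\<lambda>f x. laurent_const F f \<odot>\<^bsub>M\<^esub> x)\<rparr>"

text \<open>\<open>R\<close> is \<open>D\<close> or one of the subrings \<open>D\<^sub>t\<close>.  A module record does not contain its ring of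
  scalars, so the restriction of a \<open>D\<close>-module \<open>M\<close> to \<open>D\<^sub>t\<close> is the same record \<open>M\<close>, considered over
  \<^term>\<open>skew_laurent_sub F \<phi> t\<close>.\<close>

definition difference_module ::
    "('a, 'b) ring_scheme \<Rightarrow> (int \<Rightarrow> 'a, 'd) ring_scheme \<Rightarrow>
      (int \<Rightarrow> 'a, 'm, 'c) module_scheme \<Rightarrow> bool" where
  "difference_module F R M \<longleftrightarrow>
     left_module R M \<and> vectorspace.fin_dim F (underlying_space F M)"

end

theory Submission
  imports Defs
begin

text \<open>
  Write \<open>\<Phi>\<close> for the action of the variable of \<open>D\<close> on \<open>M\<close>. The proof is Clifford theory for the
  subring \<open>D\<^sub>t\<close>, carried out with the \<open>D\<^sub>t\<close>-linear endomorphisms of \<open>M\<close>.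

  Since \<open>M\<close> is irreducible over \<open>D\<close>, it is the sum of the translates \<open>\<Phi>\<^sup>i U\<close>, \<open>i < t\<close>, of a minimal
  \<open>D\<^sub>t\<close>-submodule \<open>U\<close>; hence \<open>M\<close> is semisimple over \<open>D\<^sub>t\<close>, and when \<open>M\<close> is reducible over \<open>D\<^sub>t\<close> there is
  a \<open>D\<^sub>t\<close>-linear projection \<open>\<pi>\<close> whose kernel \<open>W\<close> is neither \<open>0\<close> nor \<open>M\<close>
  (\<open>stable_complement\<close>). Conjugation \<open>\<gamma>(e) = \<Phi>\<^sup>-\<^sup>1 e \<Phi>\<close> is an operator, linear over the field \<open>C\<close> of constants,
  on the space of \<open>D\<^sub>t\<close>-endomorphisms, and \<open>\<gamma>\<^sup>t = 1\<close>. It moves \<open>\<pi>\<close>, because otherwise \<open>W\<close> would be a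
  \<open>D\<close>-submodule. As \<open>1 + \<gamma> + \<dots> + \<gamma>\<^sup>t\<^sup>-\<^sup>1\<close> kills the nonzero vector \<open>\<pi> - \<gamma>(\<pi>)\<close> and \<open>C\<close> is algebraically
  closed, \<open>\<gamma>\<close> has an eigenvector \<open>e\<close> whose eigenvalue \<open>c\<close> is a root of \<open>1 + X + \<dots> + X\<^sup>t\<^sup>-\<^sup>1\<close>; in
  characteristic zero this forces \<open>c \<noteq> 1\<close> (\<open>twisted_endo\<close>). So \<open>e \<Phi> = c \<Phi> e\<close> with \<open>c\<^sup>t = 1\<close> and \<open>c \<noteq> 1\<close>.

  The kernel of \<open>e\<close> is a \<open>D\<close>-submodule, so \<open>e\<close> is injective. Its power \<open>e\<^sup>t\<close> commutes with \<open>\<Phi>\<close>, and the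
  minimal polynomial over \<open>F\<close> of such an operator is fixed by \<open>\<phi>\<close> because it is unique; its
  coefficients therefore lie in \<open>C\<close> (\<open>invariant_annihilator\<close>). This gives an eigenvalue of \<open>e\<^sup>t\<close> in \<open>C\<close>,
  and then an eigenvalue \<open>a \<noteq> 0\<close> of \<open>e\<close> in \<open>C\<close> (\<open>twisted_eigenvector\<close>). Let \<open>N\<close> be the eigenspace of \<open>a\<close>
  and \<open>s > 1\<close> the order of \<open>c\<close>, a divisor of \<open>t\<close>. Now \<open>\<Phi>\<^sup>i N\<close> consists of eigenvectors for \<open>c\<^sup>i a\<close>, so \<open>N\<close>
  is a \<open>D\<^sub>s\<close>-module, the \<open>\<Phi>\<^sup>i N\<close> with \<open>i < s\<close> are independent, and their sum is a nonzero \<open>D\<close>-submodule,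
  that is, all of \<open>M\<close>. From \<open>M = N \<oplus> \<Phi> N \<oplus> \<dots> \<oplus> \<Phi>\<^sup>s\<^sup>-\<^sup>1 N\<close> everything follows (\<open>cyclic_decomposition\<close>):
  \<open>s\<close> divides \<open>dim M\<close>; a proper nonzero \<open>D\<^sub>s\<close>-submodule of \<open>N\<close> would generate a proper nonzero
  \<open>D\<close>-submodule of \<open>M\<close>; and \<open>r \<otimes> x \<mapsto> r x\<close> is an isomorphism from the induced module to \<open>M\<close>, because
  every tensor can be rewritten as a sum of tensors \<open>\<Phi>\<^sup>i \<otimes> u\<^sub>i\<close> with \<open>i < s\<close>
  (\<open>isomorphic_induced\<close>).

  All of this except the last point uses the ring \<open>D\<close> only through the semilinear operators \<open>\<Phi>\<^sup>i\<close>. It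
  is developed for an arbitrary action of the integers by semilinear operators on a vector space.
\<close>

section \<open>Comparing subspaces by rank\<close>

text \<open>Subspaces of one fixed space are compared below by a number. This one is computed inside the ambient
  space, so it needs no vector space structure on the subspace.\<close>

definition (in vectorspace) rank :: "'c set \<Rightarrow> nat" where
  "rank U = Max (card ` {A. A \<subseteq> U \<and> lin_indpt A})"

context vectorspace
begin

lemma subspaceI:
  assumes "W \<subseteq> carrier V" "\<zero>\<^bsub>V\<^esub> \<in> W" "\<And>v w. v \<in> W \<Longrightarrow> w \<in> W \<Longrightarrow> v \<oplus>\<^bsub>V\<^esub> w \<in> W"
    "\<And>a v. a \<in> carrier K \<Longrightarrow> v \<in> W \<Longrightarrow> a \<odot>\<^bsub>V\<^esub> v \<in> W"
  shows "subspace K W V"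
  using assms vectorspace_axioms module_axioms
  by (auto simp: subspace_def LinearCombinations.submodule_def)

lemma subspaceD:
  assumes "subspace K W V"
  shows "W \<subseteq> carrier V" "\<zero>\<^bsub>V\<^esub> \<in> W" "\<And>v w. v \<in> W \<Longrightarrow> w \<in> W \<Longrightarrow> v \<oplus>\<^bsub>V\<^esub> w \<in> W"
    "\<And>a v. a \<in> carrier K \<Longrightarrow> v \<in> W \<Longrightarrow> a \<odot>\<^bsub>V\<^esub> v \<in> W"
  using assms by (auto simp: subspace_def LinearCombinations.submodule_def)

lemma finite_cards_indpt:
  assumes "fin_dim" "U \<subseteq> carrier V"
  shows "finite (card ` {A. A \<subseteq> U \<and> lin_indpt A})" "card ` {A. A \<subseteq> U \<and> lin_indpt A} \<noteq> {}"
proof -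
  have "card ` {A. A \<subseteq> U \<and> lin_indpt A} \<subseteq> {..dim}"
    using li_le_dim[OF assms(1)] assms(2) by (auto dest: subset_trans)
  then show "finite (card ` {A. A \<subseteq> U \<and> lin_indpt A})"
    using finite_subset by blast
  have "lin_indpt {}" by (auto simp: lin_dep_def)
  then show "card ` {A. A \<subseteq> U \<and> lin_indpt A} \<noteq> {}" by blast
qed

lemma rank_attained:
  assumes "fin_dim" "U \<subseteq> carrier V"
  obtains A where "A \<subseteq> U" "lin_indpt A" "finite A" "card A = rank U"
proof -
  have "rank U \<in> card ` {A. A \<subseteq> U \<and> lin_indpt A}"
    unfolding rank_def using finite_cards_indpt[OF assms] by (rule Max_in)
  then obtain A where "A \<subseteq> U" "lin_indpt A" "card A = rank U" by auto
  moreover from this have "finite A" using fin_dim_li_fin[OF assms(1)] assms(2) by auto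
  ultimately show ?thesis using that by blast
qed

lemma card_le_rank:
  assumes "fin_dim" "U \<subseteq> carrier V" "A \<subseteq> U" "lin_indpt A"
  shows "card A \<le> rank U"
  unfolding rank_def using finite_cards_indpt(1)[OF assms(1,2)] assms(3,4) by (intro Max_ge) auto

lemma rank_le_dim: "fin_dim \<Longrightarrow> U \<subseteq> carrier V \<Longrightarrow> rank U \<le> dim"
  by (metis rank_attained li_le_dim(2) subset_trans)

lemma span_subset_subspace:
  assumes "subspace K U V" "A \<subseteq> U"
  shows "span A \<subseteq> U"
  using assms span_is_subset by (simp add: subspace_def)

lemma max_indpt_spans:
  assumes "fin_dim" "W \<subseteq> carrier V" "A \<subseteq> W" "lin_indpt A" "rank W \<le> card A"
  shows "W \<subseteq> span A"
proof
  fix w assume w: "w \<in> W"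
  show "w \<in> span A"
  proof (rule ccontr)
    assume n: "w \<notin> span A"
    have AV: "A \<subseteq> carrier V" using assms by auto
    then have wA: "w \<notin> A" using n in_own_span by blast
    have "lin_indpt (A \<union> {w})"
      using lin_dep_iff_in_span[OF AV assms(4) _ wA] n w assms(2) by blast
    then have "card (A \<union> {w}) \<le> rank W"
      using card_le_rank[OF assms(1,2)] assms(3) w by auto
    moreover have "finite A" using fin_dim_li_fin assms(1,4) AV by blast
    ultimately show False using assms(5) wA by auto
  qed
qed

text \<open>A maximal independent subset of \<open>U\<close> spans a subspace contained in \<open>U\<close>; if it has as many elements as
  an independent set in \<open>W\<close> can have, it spans \<open>W\<close> too. All chain conditions below come from this.\<close>

lemma subspace_eq_of_rank_le:
  assumes "fin_dim" "subspace K U V" "U \<subseteq> W" "W \<subseteq> carrier V" "rank W \<le> rank U"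
  shows "U = W"
proof -
  obtain A where A: "A \<subseteq> U" "lin_indpt A" "card A = rank U"
    using rank_attained[OF assms(1)] assms(3,4) by (metis subset_trans)
  then have "W \<subseteq> span A" using max_indpt_spans[OF assms(1,4)] assms(3,5) by auto
  then show ?thesis using span_subset_subspace[OF assms(2) A(1)] assms(3) by auto
qed

lemma subspace_basis:
  assumes "fin_dim" "subspace K U V"
  obtains A where "finite A" "A \<subseteq> U" "lin_indpt A" "span A = U"
proof -
  have UV: "U \<subseteq> carrier V" using subspaceD assms by blast
  obtain A where A: "A \<subseteq> U" "lin_indpt A" "finite A" "card A = rank U"
    using rank_attained[OF assms(1) UV] .
  then show ?thesis
    using that max_indpt_spans[OF assms(1) UV] span_subset_subspace[OF assms(2)]
    by (metis order_refl subset_antisym)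
qed

lemma subspace_fin_dim:
  assumes "fin_dim" "subspace K U V"
  shows "vectorspace.fin_dim K (vs U)"
proof -
  interpret U: vectorspace K "vs U" using subspace_is_vs assms by blast
  obtain A where A: "finite A" "A \<subseteq> U" "lin_indpt A" "span A = U"
    using subspace_basis[OF assms] .
  then have "U.span A = U"
    using span_li_not_depend(1)[OF A(2)] assms(2) by (simp add: subspace_def)
  then show ?thesis unfolding U.fin_dim_def using A by auto
qed

lemma ascending_chain_stabilizes:
  assumes "fin_dim" "\<And>k::nat. subspace K (S k) V" "\<And>k. S k \<subseteq> S (Suc k)"
  shows "\<exists>k. S (Suc k) = S k"
proof (rule ccontr)
  assume "\<nexists>k. S (Suc k) = S k"
  then have "rank (S k) < rank (S (Suc k))" for k
    using subspace_eq_of_rank_le[OF assms(1,2,3)] subspaceD(1)[OF assms(2)] by (metis not_le)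
  then have "k \<le> rank (S k)" for k
    by (induction k) (auto simp: Suc_le_eq intro: le_less_trans)
  then have "Suc dim \<le> rank (S (Suc dim))" .
  then show False using rank_le_dim[OF assms(1) subspaceD(1)[OF assms(2)]] 
    by (meson not_less_eq_eq)
qed

end

section \<open>Polynomials in a linear operator\<close>

locale linear_operator = vectorspace K V for K V +
  fixes T :: "'c \<Rightarrow> 'c"
  assumes T_closed [simp, intro]: "v \<in> carrier V \<Longrightarrow> T v \<in> carrier V"
    and T_add: "v \<in> carrier V \<Longrightarrow> w \<in> carrier V \<Longrightarrow> T (v \<oplus>\<^bsub>V\<^esub> w) = T v \<oplus>\<^bsub>V\<^esub> T w"
    and T_smult: "a \<in> carrier K \<Longrightarrow> v \<in> carrier V \<Longrightarrow> T (a \<odot>\<^bsub>V\<^esub> v) = a \<odot>\<^bsub>V\<^esub> T v"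
begin

text \<open>A list holds the coefficients of a polynomial with the constant term first, so that the recursions are
  Horner's scheme. For \<open>f\<close> with these coefficients, \<open>poly_op\<close> is \<open>f(T)\<close>, and \<open>div_root c\<close> is the quotient
  of \<open>f\<close> by \<open>X - c\<close>.\<close>

primrec poly_op :: "'a list \<Rightarrow> 'c \<Rightarrow> 'c" where
  "poly_op [] v = \<zero>\<^bsub>V\<^esub>"
| "poly_op (a # p) v = a \<odot>\<^bsub>V\<^esub> v \<oplus>\<^bsub>V\<^esub> T (poly_op p v)"

primrec horner :: "'a list \<Rightarrow> 'a \<Rightarrow> 'a" where
  "horner [] x = \<zero>\<^bsub>K\<^esub>"
| "horner (a # p) x = a \<oplus>\<^bsub>K\<^esub> x \<otimes>\<^bsub>K\<^esub> horner p x"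

primrec div_root :: "'a \<Rightarrow> 'a list \<Rightarrow> 'a list" where
  "div_root c [] = []"
| "div_root c (a # p) = (if p = [] then [] else horner p c # div_root c p)"

lemma T_zero [simp]: "T \<zero>\<^bsub>V\<^esub> = \<zero>\<^bsub>V\<^esub>"
  by (metis M.zero_closed R.zero_closed T_closed T_smult smult_l_null)

lemma poly_op_closed [simp, intro]:
  "set p \<subseteq> carrier K \<Longrightarrow> v \<in> carrier V \<Longrightarrow> poly_op p v \<in> carrier V"
  by (induction p) auto

lemma horner_closed [simp, intro]:
  "set p \<subseteq> carrier K \<Longrightarrow> x \<in> carrier K \<Longrightarrow> horner p x \<in> carrier K"
  by (induction p) auto

lemma div_root_carrier:
  "set p \<subseteq> carrier K \<Longrightarrow> c \<in> carrier K \<Longrightarrow> set (div_root c p) \<subseteq> carrier K"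
  by (induction p) auto

lemma length_div_root: "length (div_root c p) = length p - 1"
  by (induction p) auto

lemma last_div_root:
  "set p \<subseteq> carrier K \<Longrightarrow> c \<in> carrier K \<Longrightarrow> 2 \<le> length p \<Longrightarrow> last (div_root c p) = last p"
proof (induction p)
  case (Cons a p)
  show ?case
  proof (cases "2 \<le> length p")
    case True
    then have "div_root c p \<noteq> []" using length_div_root[of c p] by auto
    then show ?thesis using Cons True by auto
  next
    case False
    then obtain b where "p = [b]" using Cons(4) by (cases p; cases "tl p") auto
    then show ?thesis using Cons by auto
  qed
qed auto

text \<open>This is \<open>f = (X - c) q + f(c)\<close> at \<open>T\<close>, with the subtracted term moved to the other side. The next
  lemma is the same identity at a scalar.\<close>

lemma poly_op_div_root:
  assumes "set p \<subseteq> carrier K" "c \<in> carrier K" "v \<in> carrier V"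
  shows "poly_op p v \<oplus>\<^bsub>V\<^esub> c \<odot>\<^bsub>V\<^esub> poly_op (div_root c p) v =
    horner p c \<odot>\<^bsub>V\<^esub> v \<oplus>\<^bsub>V\<^esub> T (poly_op (div_root c p) v)"
  using assms(1)
proof (induction p)
  case Nil
  then show ?case using assms by simp
next
  case (Cons a p)
  show ?case
  proof (cases "p = []")
    case True
    then show ?thesis using Cons assms by simp
  next
    case False
    define q where "q = poly_op (div_root c p) v"
    have p: "set p \<subseteq> carrier K" "a \<in> carrier K" using Cons by auto
    have car: "q \<in> carrier V" "poly_op p v \<in> carrier V" "horner p c \<in> carrier K"
      using p assms div_root_carrier unfolding q_def by auto
    have IH: "poly_op p v \<oplus>\<^bsub>V\<^esub> c \<odot>\<^bsub>V\<^esub> q = horner p c \<odot>\<^bsub>V\<^esub> v \<oplus>\<^bsub>V\<^esub> T q"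
      using Cons unfolding q_def by simp
    have "(a \<odot>\<^bsub>V\<^esub> v \<oplus>\<^bsub>V\<^esub> T (poly_op p v)) \<oplus>\<^bsub>V\<^esub> c \<odot>\<^bsub>V\<^esub> (horner p c \<odot>\<^bsub>V\<^esub> v \<oplus>\<^bsub>V\<^esub> T q)
      = a \<odot>\<^bsub>V\<^esub> v \<oplus>\<^bsub>V\<^esub> (c \<otimes>\<^bsub>K\<^esub> horner p c) \<odot>\<^bsub>V\<^esub> v \<oplus>\<^bsub>V\<^esub> (T (poly_op p v) \<oplus>\<^bsub>V\<^esub> c \<odot>\<^bsub>V\<^esub> T q)"
      using p assms car by (simp add: smult_r_distr smult_assoc1 M.a_ac)
    also have "T (poly_op p v) \<oplus>\<^bsub>V\<^esub> c \<odot>\<^bsub>V\<^esub> T q = T (horner p c \<odot>\<^bsub>V\<^esub> v \<oplus>\<^bsub>V\<^esub> T q)"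
      using IH p assms car by (metis T_add T_smult smult_closed)
    also have "a \<odot>\<^bsub>V\<^esub> v \<oplus>\<^bsub>V\<^esub> (c \<otimes>\<^bsub>K\<^esub> horner p c) \<odot>\<^bsub>V\<^esub> v = (a \<oplus>\<^bsub>K\<^esub> c \<otimes>\<^bsub>K\<^esub> horner p c) \<odot>\<^bsub>V\<^esub> v"
      using p assms car by (simp add: smult_l_distr)
    finally show ?thesis using False unfolding q_def by simp
  qed
qed

lemma horner_div_root:
  assumes "set p \<subseteq> carrier K" "c \<in> carrier K" "x \<in> carrier K"
  shows "horner p x \<oplus>\<^bsub>K\<^esub> c \<otimes>\<^bsub>K\<^esub> horner (div_root c p) x =
    horner p c \<oplus>\<^bsub>K\<^esub> x \<otimes>\<^bsub>K\<^esub> horner (div_root c p) x"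
  using assms(1)
proof (induction p)
  case Nil
  then show ?case using assms by simp
next
  case (Cons a p)
  show ?case
  proof (cases "p = []")
    case True
    then show ?thesis using Cons assms by simp
  next
    case False
    define q where "q = horner (div_root c p) x"
    have p: "set p \<subseteq> carrier K" "a \<in> carrier K" using Cons by auto
    have car: "q \<in> carrier K" "horner p x \<in> carrier K" "horner p c \<in> carrier K"
      using p assms div_root_carrier unfolding q_def by auto
    have IH: "horner p x \<oplus>\<^bsub>K\<^esub> c \<otimes>\<^bsub>K\<^esub> q = horner p c \<oplus>\<^bsub>K\<^esub> x \<otimes>\<^bsub>K\<^esub> q"
      using Cons unfolding q_def by simp
    have "(a \<oplus>\<^bsub>K\<^esub> x \<otimes>\<^bsub>K\<^esub> horner p x) \<oplus>\<^bsub>K\<^esub> c \<otimes>\<^bsub>K\<^esub> (horner p c \<oplus>\<^bsub>K\<^esub> x \<otimes>\<^bsub>K\<^esub> q)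
      = (a \<oplus>\<^bsub>K\<^esub> c \<otimes>\<^bsub>K\<^esub> horner p c) \<oplus>\<^bsub>K\<^esub> x \<otimes>\<^bsub>K\<^esub> (horner p x \<oplus>\<^bsub>K\<^esub> c \<otimes>\<^bsub>K\<^esub> q)"
      using p assms car by (simp add: R.r_distr R.m_ac R.a_ac)
    then show ?thesis using False IH unfolding q_def by simp
  qed
qed

lemma eval_rev_eq_horner:
  "set p \<subseteq> carrier K \<Longrightarrow> x \<in> carrier K \<Longrightarrow> R.eval (rev p) x = horner p x"
proof (induction p)
  case (Cons a p)
  then show ?case
    using R.eval_append[of "rev p" "[a]" x] by (simp add: R.m_comm R.a_comm)
qed simp

end

lemma (in field) inv_nonzero_closed:
  "a \<in> carrier R \<Longrightarrow> a \<noteq> \<zero> \<Longrightarrow> inv a \<in> carrier R"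
  by (simp add: field_Units)

lemma (in algebraically_closed) root_exists:
  assumes "set p \<subseteq> carrier L" "p \<noteq> []" "hd p \<noteq> \<zero>" "2 \<le> length p"
  shows "\<exists>x\<in>carrier L. eval p x = \<zero>"
proof -
  have p: "p \<in> carrier (poly_ring L)"
    using assms by (simp add: sym[OF univ_poly_carrier] polynomial_def)
  then have "size (roots p) = degree p" using roots_over_carrier splitted_def by blast
  then have "roots p \<noteq> {#}" using assms by auto
  then obtain x where "x \<in># roots p" by blast
  then show ?thesis using roots_mem_iff_is_root[OF p] is_root_def by blast
qed

text \<open>Splitting off linear factors of \<open>f\<close> one at a time and applying the quotients to \<open>v\<close>, the vector
  must become zero at some step; the last nonzero vector is an eigenvector. The eigenvalue is
  remembered as a root of \<open>f\<close>, because this is what later separates it from \<open>1\<close>.\<close>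

lemma (in linear_operator) eigenvector_of_annihilator:
  assumes "algebraically_closed K"
    and "set p \<subseteq> carrier K" "p \<noteq> []" "last p \<noteq> \<zero>\<^bsub>K\<^esub>"
    and "v \<in> carrier V" "v \<noteq> \<zero>\<^bsub>V\<^esub>" "poly_op p v = \<zero>\<^bsub>V\<^esub>"
  shows "\<exists>c\<in>carrier K. \<exists>w\<in>carrier V. w \<noteq> \<zero>\<^bsub>V\<^esub> \<and> T w = c \<odot>\<^bsub>V\<^esub> w \<and> horner p c = \<zero>\<^bsub>K\<^esub>"
  using assms(2-)
proof (induction "length p" arbitrary: p rule: less_induct)
  case less
  interpret algebraically_closed K by fact
  show ?case
  proof (cases "2 \<le> length p")
    case False
    then obtain a where "p = [a]" using less(3) by (cases p; cases "tl p") auto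
    then have a: "a \<in> carrier K" "a \<noteq> \<zero>\<^bsub>K\<^esub>" "a \<odot>\<^bsub>V\<^esub> v = \<zero>\<^bsub>V\<^esub>" using less by auto
    then have "v = \<zero>\<^bsub>V\<^esub>"
      using mult_inverse[of a v] less(5) inv_nonzero_closed by (metis smult_r_null)
    then show ?thesis using less by simp
  next
    case True
    then obtain c where c: "c \<in> carrier K" "horner p c = \<zero>\<^bsub>K\<^esub>"
      using root_exists[of "rev p"] less(2-4) eval_rev_eq_horner by (auto simp: hd_rev)
    define q where "q = poly_op (div_root c p) v"
    have qV: "q \<in> carrier V" using c less div_root_carrier unfolding q_def by auto
    have eig: "T q = c \<odot>\<^bsub>V\<^esub> q"
      using poly_op_div_root[of p c v] c less qV unfolding q_def[symmetric] by simp
    show ?thesis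
    proof (cases "q = \<zero>\<^bsub>V\<^esub>")
      case False
      then show ?thesis using c qV eig by blast
    next
      case q0: True
      have len: "length (div_root c p) < length p" "div_root c p \<noteq> []"
        using length_div_root[of c p] True by auto
      obtain c' w where w: "c' \<in> carrier K" "w \<in> carrier V" "w \<noteq> \<zero>\<^bsub>V\<^esub>" "T w = c' \<odot>\<^bsub>V\<^esub> w"
          and hc: "horner (div_root c p) c' = \<zero>\<^bsub>K\<^esub>"
        using less(1)[OF len(1) div_root_carrier len(2)] last_div_root[OF _ c(1) True]
          less(2-) c q0 unfolding q_def by auto
      have "horner p c' = \<zero>\<^bsub>K\<^esub>"
        using horner_div_root[OF less(2) c(1) w(1)] hc c w less(2) by simp
      then show ?thesis using w by blast
    qed
  qed
qed

context linear_operator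
begin

lemma poly_op_add:
  "set p \<subseteq> carrier K \<Longrightarrow> v \<in> carrier V \<Longrightarrow> w \<in> carrier V \<Longrightarrow>
    poly_op p (v \<oplus>\<^bsub>V\<^esub> w) = poly_op p v \<oplus>\<^bsub>V\<^esub> poly_op p w"
  by (induction p) (auto simp: smult_r_distr T_add M.a_ac)

text \<open>The operator \<open>A\<close> need only be semilinear; the coefficients are then transported by \<open>\<psi>\<close>.\<close>

lemma poly_op_commute:
  assumes "set p \<subseteq> carrier K" "v \<in> carrier V"
    and "\<And>v. v \<in> carrier V \<Longrightarrow> A v \<in> carrier V"
    and "\<And>v w. v \<in> carrier V \<Longrightarrow> w \<in> carrier V \<Longrightarrow> A (v \<oplus>\<^bsub>V\<^esub> w) = A v \<oplus>\<^bsub>V\<^esub> A w"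
    and "\<And>a v. a \<in> carrier K \<Longrightarrow> v \<in> carrier V \<Longrightarrow> A (a \<odot>\<^bsub>V\<^esub> v) = \<psi> a \<odot>\<^bsub>V\<^esub> A v"
    and "\<And>v. v \<in> carrier V \<Longrightarrow> A (T v) = T (A v)"
    and "A \<zero>\<^bsub>V\<^esub> = \<zero>\<^bsub>V\<^esub>"
  shows "A (poly_op p v) = poly_op (map \<psi> p) (A v)"
  using assms(1)
  by (induction p) (use assms(2-) in auto)

lemma poly_op_smult:
  "set p \<subseteq> carrier K \<Longrightarrow> a \<in> carrier K \<Longrightarrow> v \<in> carrier V \<Longrightarrow>
    poly_op p (a \<odot>\<^bsub>V\<^esub> v) = a \<odot>\<^bsub>V\<^esub> poly_op p v"
  using poly_op_commute[of p v "\<lambda>v. a \<odot>\<^bsub>V\<^esub> v" "\<lambda>a. a"]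
  by (simp add: smult_r_distr T_smult smult_assoc1[symmetric] R.m_comm)

lemma poly_op_map2_add:
  "length p = length q \<Longrightarrow> set p \<subseteq> carrier K \<Longrightarrow> set q \<subseteq> carrier K \<Longrightarrow> v \<in> carrier V \<Longrightarrow>
    poly_op (map2 (\<oplus>\<^bsub>K\<^esub>) p q) v = poly_op p v \<oplus>\<^bsub>V\<^esub> poly_op q v"
proof (induction p q rule: list_induct2)
  case (Cons a p b q)
  then have "a \<in> carrier K" "b \<in> carrier K" "poly_op p v \<in> carrier V" "poly_op q v \<in> carrier V"
    by auto
  then show ?case using Cons by (simp add: smult_l_distr T_add M.a_ac)
qed simp

lemma set_map2_add:
  assumes "set p \<subseteq> carrier K" "set q \<subseteq> carrier K"
  shows "set (map2 (\<oplus>\<^bsub>K\<^esub>) p q) \<subseteq> carrier K"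
proof
  fix x assume "x \<in> set (map2 (\<oplus>\<^bsub>K\<^esub>) p q)"
  then obtain a b where ab: "(a, b) \<in> set (zip p q)" "x = a \<oplus>\<^bsub>K\<^esub> b" by auto
  then show "x \<in> carrier K"
    using assms set_zip_leftD[OF ab(1)] set_zip_rightD[OF ab(1)] by auto
qed

lemma poly_op_map_mult:
  "set p \<subseteq> carrier K \<Longrightarrow> a \<in> carrier K \<Longrightarrow> v \<in> carrier V \<Longrightarrow>
    poly_op (map (\<lambda>b. a \<otimes>\<^bsub>K\<^esub> b) p) v = a \<odot>\<^bsub>V\<^esub> poly_op p v"
  by (induction p) (auto simp: smult_r_distr smult_assoc1 T_smult)

lemma funpow_T_closed [simp, intro]: "v \<in> carrier V \<Longrightarrow> (T ^^ n) v \<in> carrier V"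
  by (induction n) auto

lemma poly_op_append:
  "set p \<subseteq> carrier K \<Longrightarrow> a \<in> carrier K \<Longrightarrow> v \<in> carrier V \<Longrightarrow>
    poly_op (p @ [a]) v = poly_op p v \<oplus>\<^bsub>V\<^esub> a \<odot>\<^bsub>V\<^esub> (T ^^ length p) v"
  by (induction p) (auto simp: T_add T_smult M.a_assoc)

text \<open>Operators that are polynomials in \<open>T\<close> of degree below \<open>n\<close>. Keeping the operators instead of coefficient
  lists makes it possible to compose polynomials without defining their product.\<close>

definition poly_ops :: "nat \<Rightarrow> ('c \<Rightarrow> 'c) set" where
  "poly_ops n = {A. \<exists>p. length p = n \<and> set p \<subseteq> carrier K \<and> (\<forall>v\<in>carrier V. A v = poly_op p v)}"

lemma poly_opsI:
  "set p \<subseteq> carrier K \<Longrightarrow> length p = n \<Longrightarrow> (\<And>v. v \<in> carrier V \<Longrightarrow> A v = poly_op p v) \<Longrightarrow> A \<in> poly_ops n"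
  unfolding poly_ops_def by blast

lemma poly_opsE:
  assumes "A \<in> poly_ops n"
  obtains p where "set p \<subseteq> carrier K" "length p = n" "\<And>v. v \<in> carrier V \<Longrightarrow> A v = poly_op p v"
  using assms unfolding poly_ops_def by blast

lemma poly_ops_closed: "A \<in> poly_ops n \<Longrightarrow> v \<in> carrier V \<Longrightarrow> A v \<in> carrier V"
  by (elim poly_opsE) auto

lemma poly_ops_add:
  assumes "A \<in> poly_ops n" "B \<in> poly_ops n"
  shows "(\<lambda>v. A v \<oplus>\<^bsub>V\<^esub> B v) \<in> poly_ops n"
proof -
  obtain p where p: "set p \<subseteq> carrier K" "length p = n" "\<And>v. v \<in> carrier V \<Longrightarrow> A v = poly_op p v"
    using assms(1) unfolding poly_ops_def by blast
  obtain q where q: "set q \<subseteq> carrier K" "length q = n" "\<And>v. v \<in> carrier V \<Longrightarrow> B v = poly_op q v"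
    using assms(2) unfolding poly_ops_def by blast
  show ?thesis
    using p q set_map2_add[OF p(1) q(1)]
    by (intro poly_opsI[of "map2 (\<oplus>\<^bsub>K\<^esub>) p q"]) (simp_all add: poly_op_map2_add)
qed

lemma poly_ops_smult:
  assumes "A \<in> poly_ops n" "a \<in> carrier K"
  shows "(\<lambda>v. a \<odot>\<^bsub>V\<^esub> A v) \<in> poly_ops n"
proof -
  obtain p where p: "set p \<subseteq> carrier K" "length p = n" "\<And>v. v \<in> carrier V \<Longrightarrow> A v = poly_op p v"
    using assms(1) unfolding poly_ops_def by blast
  then show ?thesis using assms(2)
    by (intro poly_opsI[of "map (\<lambda>b. a \<otimes>\<^bsub>K\<^esub> b) p"]) (auto simp: poly_op_map_mult)
qed

lemma poly_ops_T: "A \<in> poly_ops n \<Longrightarrow> (\<lambda>v. T (A v)) \<in> poly_ops (Suc n)"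
  by (elim poly_opsE, rule_tac p = "\<zero>\<^bsub>K\<^esub> # p" in poly_opsI) auto

lemma poly_ops_Suc: "A \<in> poly_ops n \<Longrightarrow> A \<in> poly_ops (Suc n)"
  by (elim poly_opsE, rule_tac p = "p @ [\<zero>\<^bsub>K\<^esub>]" in poly_opsI) (auto simp: poly_op_append)

lemma poly_ops_mono: "A \<in> poly_ops n \<Longrightarrow> n \<le> m \<Longrightarrow> A \<in> poly_ops m"
  by (induction m) (auto simp: le_Suc_eq intro: poly_ops_Suc)

lemma zero_in_poly_ops: "(\<lambda>v. \<zero>\<^bsub>V\<^esub>) \<in> poly_ops n"
  using poly_opsI[of "[]" 0 "\<lambda>v. \<zero>\<^bsub>V\<^esub>"] poly_ops_mono[of _ 0 n] by auto

lemma funpow_in_poly_ops: "T ^^ n \<in> poly_ops (Suc n)"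
proof (induction n)
  case 0
  show ?case by (rule poly_opsI[of "[\<one>\<^bsub>K\<^esub>]"]) auto
next
  case (Suc n)
  then show ?case using poly_ops_T[of "T ^^ n"] by (simp add: comp_def)
qed

lemma poly_ops_comp:
  assumes "set q \<subseteq> carrier K" "A \<in> poly_ops (Suc n)"
  shows "(\<lambda>v. poly_op q (A v)) \<in> poly_ops (length q + n)"
  using assms(1)
proof (induction q)
  case (Cons a q)
  then show ?case
    using poly_ops_add[OF poly_ops_smult[of A "Suc (length q + n)" a] poly_ops_T]
      poly_ops_mono[OF assms(2), of "Suc (length q + n)"] by simp
qed (simp add: zero_in_poly_ops)

text \<open>The subspaces of all \<open>f(T) w\<close> with \<open>f\<close> of degree below \<open>k\<close> form a chain, which becomes stationary.\<close>

lemma cyclic_relation: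
  assumes "fin_dim" "w \<in> carrier V"
  obtains q where "set q \<subseteq> carrier K" "(T ^^ length q) w = poly_op q w"
proof -
  define S where "S k = (\<lambda>A. A w) ` poly_ops k" for k
  have "subspace K (S k) V" for k
  proof (rule subspaceI)
    show "S k \<subseteq> carrier V" using poly_ops_closed assms(2) unfolding S_def by auto
    show "\<zero>\<^bsub>V\<^esub> \<in> S k" using imageI[OF zero_in_poly_ops[of k]] unfolding S_def by simp
    show "v \<oplus>\<^bsub>V\<^esub> u \<in> S k" if "v \<in> S k" "u \<in> S k" for v u
      using that poly_ops_add unfolding S_def by force
    show "a \<odot>\<^bsub>V\<^esub> v \<in> S k" if "a \<in> carrier K" "v \<in> S k" for a v
      using that poly_ops_smult unfolding S_def by force
  qed
  moreover have "S k \<subseteq> S (Suc k)" for k unfolding S_def using poly_ops_Suc by blast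
  ultimately obtain k where "S (Suc k) = S k"
    using ascending_chain_stabilizes[OF assms(1)] by blast
  moreover have "(T ^^ k) w \<in> S (Suc k)" unfolding S_def using funpow_in_poly_ops by blast
  ultimately obtain A where "A \<in> poly_ops k" "(T ^^ k) w = A w" unfolding S_def by auto
  then show ?thesis using that assms(2) by (elim poly_opsE) auto
qed

text \<open>If a monic \<open>f\<close> annihilates \<open>B\<close> and a monic \<open>g\<close> annihilates \<open>f(T) b\<close>, then \<open>g f\<close> is monic and annihilates
  \<open>B\<close> and \<open>b\<close>. A monic relation is written with its leading power alone on the left.\<close>

lemma annihilator_on_finite:
  assumes "fin_dim" "finite B" "B \<subseteq> carrier V"
  shows "\<exists>p. set p \<subseteq> carrier K \<and> (\<forall>v\<in>B. (T ^^ length p) v = poly_op p v)"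
  using assms(2,3)
proof (induction B)
  case empty
  show ?case by (rule exI[of _ "[]"]) simp
next
  case (insert b B)
  then obtain p where p: "set p \<subseteq> carrier K" "\<forall>v\<in>B. (T ^^ length p) v = poly_op p v" by auto
  define n where "n = length p"
  \<comment> \<open>The operator \<open>f(T)\<close>; the difference is written with the scalar \<open>-1\<close> to stay among the operations of \<open>poly_ops\<close>.\<close>
  define R where "R v = (T ^^ n) v \<oplus>\<^bsub>V\<^esub> (\<ominus>\<^bsub>K\<^esub> \<one>\<^bsub>K\<^esub>) \<odot>\<^bsub>V\<^esub> poly_op p v" for v
  have pn: "poly_op p \<in> poly_ops n" using poly_opsI[OF p(1)] n_def by simp
  have Rn: "R \<in> poly_ops (Suc n)"
    unfolding R_def using poly_ops_add[OF funpow_in_poly_ops poly_ops_smult[OF poly_ops_Suc[OF pn]]]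
    by simp
  have bV: "b \<in> carrier V" using insert by auto
  have "R b \<in> carrier V" using poly_ops_closed[OF Rn bV] .
  then obtain q where q: "set q \<subseteq> carrier K" "(T ^^ length q) (R b) = poly_op q (R b)"
    using cyclic_relation[OF assms(1)] by blast
  define m where "m = length q"
  \<comment> \<open>With \<open>f = X\<^sup>n - p\<close>: \<open>T\<^sup>m\<^sup>+\<^sup>n = T\<^sup>m f(T) + T\<^sup>m p(T)\<close>, and \<open>T\<^sup>m\<close> agrees with \<open>q(T)\<close> on the vectors \<open>f(T) v\<close> in question.\<close>
  define A where "A v = poly_op q (R v) \<oplus>\<^bsub>V\<^esub> (T ^^ m) (poly_op p v)" for v
  have Tp: "(\<lambda>v. (T ^^ k) (poly_op p v)) \<in> poly_ops (k + n)" for k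
    by (induction k) (use pn poly_ops_T in auto)
  have "A \<in> poly_ops (m + n)"
    unfolding A_def using poly_ops_add[OF poly_ops_comp[OF q(1) Rn]] Tp m_def by blast
  then obtain r where r: "set r \<subseteq> carrier K" "length r = m + n" "\<And>v. v \<in> carrier V \<Longrightarrow> A v = poly_op r v"
    unfolding poly_ops_def by blast
  have Tadd: "(T ^^ k) (v \<oplus>\<^bsub>V\<^esub> w) = (T ^^ k) v \<oplus>\<^bsub>V\<^esub> (T ^^ k) w"
    if "v \<in> carrier V" "w \<in> carrier V" for k v w
    using that by (induction k) (auto simp: T_add)
  have split: "(T ^^ n) v = R v \<oplus>\<^bsub>V\<^esub> poly_op p v" if "v \<in> carrier V" for v
    using that p(1) by (simp add: R_def smult_l_minus M.a_assoc M.l_neg)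
  have main: "(T ^^ length r) v = poly_op r v"
    if v: "v \<in> carrier V" "(T ^^ m) (R v) = poly_op q (R v)" for v
  proof -
    have "(T ^^ length r) v = (T ^^ m) ((T ^^ n) v)" using r(2) by (simp add: funpow_add)
    also have "\<dots> = (T ^^ m) (R v) \<oplus>\<^bsub>V\<^esub> (T ^^ m) (poly_op p v)"
      using split[OF v(1)] Tadd poly_ops_closed[OF Rn v(1)] p(1) v(1) by simp
    also have "\<dots> = A v" using v(2) by (simp add: A_def)
    finally show ?thesis using r(3) v(1) by simp
  qed
  have Tz: "(T ^^ k) \<zero>\<^bsub>V\<^esub> = \<zero>\<^bsub>V\<^esub>" for k by (induction k) auto
  have pz: "poly_op q \<zero>\<^bsub>V\<^esub> = \<zero>\<^bsub>V\<^esub>" using q(1) by (induction q) auto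
  have "R v = \<zero>\<^bsub>V\<^esub>" if "v \<in> B" for v
    using that p insert(4) n_def by (auto simp: R_def smult_l_minus M.r_neg)
  then have "\<forall>v\<in>insert b B. (T ^^ length r) v = poly_op r v"
    using main q(2) bV insert(4) Tz pz m_def by auto
  then show ?case using r(1) by blast
qed

lemma equalizer_subspace:
  assumes "linear_operator K V A" "linear_operator K V B"
  shows "subspace K {v \<in> carrier V. A v = B v} V"
proof -
  interpret A: linear_operator K V A by fact
  interpret B: linear_operator K V B by fact
  show ?thesis
    by (rule subspaceI) (auto simp: A.T_add A.T_smult B.T_add B.T_smult)
qed

lemma linear_operator_poly_op: "set p \<subseteq> carrier K \<Longrightarrow> linear_operator K V (poly_op p)"
  by unfold_locales (auto simp: poly_op_add poly_op_smult)

lemma linear_operator_funpow: "linear_operator K V (T ^^ n)"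
proof -
  have "(T ^^ n) (v \<oplus>\<^bsub>V\<^esub> w) = (T ^^ n) v \<oplus>\<^bsub>V\<^esub> (T ^^ n) w" 
    if "v \<in> carrier V" "w \<in> carrier V" for v w
    using that by (induction n) (auto simp: T_add)
  moreover have "(T ^^ n) (a \<odot>\<^bsub>V\<^esub> v) = a \<odot>\<^bsub>V\<^esub> (T ^^ n) v" if "a \<in> carrier K" "v \<in> carrier V" for a v
    using that by (induction n) (auto simp: T_smult)
  ultimately show ?thesis by unfold_locales auto
qed

lemma annihilator_exists:
  assumes "fin_dim"
  shows "\<exists>p. set p \<subseteq> carrier K \<and> (\<forall>v\<in>carrier V. (T ^^ length p) v = poly_op p v)"
proof -
  obtain B where B: "finite B" "B \<subseteq> carrier V" "span B = carrier V"
    using assms unfolding fin_dim_def by blast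
  obtain p where p: "set p \<subseteq> carrier K" "\<forall>v\<in>B. (T ^^ length p) v = poly_op p v"
    using annihilator_on_finite[OF assms B(1,2)] by blast
  have "span B \<subseteq> {v \<in> carrier V. (T ^^ length p) v = poly_op p v}"
    using p B by (intro span_subset_subspace equalizer_subspace linear_operator_funpow linear_operator_poly_op) auto
  then show ?thesis using B(3) p(1) by blast
qed

text \<open>The highest nonzero coefficient is divided out, which gives a monic relation of smaller degree than the
  length of the list.\<close>

lemma relation_shortens:
  assumes "set d \<subseteq> carrier K" "\<exists>a\<in>set d. a \<noteq> \<zero>\<^bsub>K\<^esub>" "\<And>v. v \<in> carrier V \<Longrightarrow> poly_op d v = \<zero>\<^bsub>V\<^esub>"
  shows "\<exists>p. length p < length d \<and> set p \<subseteq> carrier K \<and> (\<forall>v\<in>carrier V. (T ^^ length p) v = poly_op p v)"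
  using assms
proof (induction d rule: rev_induct)
  case (snoc a d)
  then have d: "set d \<subseteq> carrier K" "a \<in> carrier K" by auto
  have rel: "poly_op d v \<oplus>\<^bsub>V\<^esub> a \<odot>\<^bsub>V\<^esub> (T ^^ length d) v = \<zero>\<^bsub>V\<^esub>" if "v \<in> carrier V" for v
    using snoc(4)[OF that] poly_op_append[OF d that] by simp
  show ?case
  proof (cases "a = \<zero>\<^bsub>K\<^esub>")
    case True
    have "poly_op d v = \<zero>\<^bsub>V\<^esub>" if "v \<in> carrier V" for v
      using rel[OF that] that True d by simp
    moreover have "\<exists>a\<in>set d. a \<noteq> \<zero>\<^bsub>K\<^esub>" using snoc(3) True by auto
    ultimately obtain p where "length p < length d" "set p \<subseteq> carrier K"
        "\<forall>v\<in>carrier V. (T ^^ length p) v = poly_op p v"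
      using snoc(1)[OF d(1)] by blast
    then show ?thesis by (intro exI[of _ p]) simp
  next
    case False
    define b where "b = \<ominus>\<^bsub>K\<^esub> (inv\<^bsub>K\<^esub> a)"
    have ia: "inv\<^bsub>K\<^esub> a \<in> carrier K" "inv\<^bsub>K\<^esub> a \<otimes>\<^bsub>K\<^esub> a = \<one>\<^bsub>K\<^esub>"
      using False d(2) inv_nonzero_closed by (auto simp: field_Units)
    have b: "b \<in> carrier K" unfolding b_def using ia by simp
    have "(T ^^ length d) v = poly_op (map (\<lambda>x. b \<otimes>\<^bsub>K\<^esub> x) d) v" if v: "v \<in> carrier V" for v
    proof -
      have "\<ominus>\<^bsub>V\<^esub> poly_op d v = a \<odot>\<^bsub>V\<^esub> (T ^^ length d) v"
        using rel[OF v] d v by (intro M.minus_equality) (auto simp: M.a_comm)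
      then have "inv\<^bsub>K\<^esub> a \<odot>\<^bsub>V\<^esub> (\<ominus>\<^bsub>V\<^esub> poly_op d v) = (T ^^ length d) v"
        using ia d v smult_assoc1[of "inv\<^bsub>K\<^esub> a" a "(T ^^ length d) v"] by simp
      then show ?thesis
        using poly_op_map_mult[OF d(1) b v] ia d v by (simp add: b_def smult_l_minus smult_r_minus)
    qed
    moreover have "set (map (\<lambda>x. b \<otimes>\<^bsub>K\<^esub> x) d) \<subseteq> carrier K" using b d by auto
    ultimately show ?thesis by (intro exI[of _ "map (\<lambda>x. b \<otimes>\<^bsub>K\<^esub> x) d"]) auto
  qed
qed simp

text \<open>Take a monic annihilating polynomial of least degree. Conjugation by \<open>A\<close> turns it into the one whose
  coefficients are transported by \<open>\<psi>\<close>; that polynomial also annihilates, so the difference, which has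
  smaller degree, must be zero.\<close>

lemma invariant_annihilator:
  assumes "fin_dim" "\<psi> \<in> ring_hom K K"
    and A: "A ` carrier V = carrier V"
      "\<And>v w. v \<in> carrier V \<Longrightarrow> w \<in> carrier V \<Longrightarrow> A (v \<oplus>\<^bsub>V\<^esub> w) = A v \<oplus>\<^bsub>V\<^esub> A w"
      "\<And>a v. a \<in> carrier K \<Longrightarrow> v \<in> carrier V \<Longrightarrow> A (a \<odot>\<^bsub>V\<^esub> v) = \<psi> a \<odot>\<^bsub>V\<^esub> A v"
      "\<And>v. v \<in> carrier V \<Longrightarrow> A (T v) = T (A v)"
  obtains p where "set p \<subseteq> {a \<in> carrier K. \<psi> a = a}"
    "\<And>v. v \<in> carrier V \<Longrightarrow> (T ^^ length p) v = poly_op p v"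
proof -
  let ?P = "\<lambda>p. set p \<subseteq> carrier K \<and> (\<forall>v\<in>carrier V. (T ^^ length p) v = poly_op p v)"
  obtain p where p: "set p \<subseteq> carrier K" "\<And>v. v \<in> carrier V \<Longrightarrow> (T ^^ length p) v = poly_op p v"
    and min: "\<And>q. ?P q \<Longrightarrow> length p \<le> length q"
  proof -
    obtain p0 where "?P p0" using annihilator_exists[OF assms(1)] by blast
    then obtain p where "?P p" "\<forall>q. ?P q \<longrightarrow> length p \<le> length q"
      using ex_has_least_nat[of ?P p0 length] by blast
    then show ?thesis by (intro that) auto
  qed
  have Acl: "A v \<in> carrier V" if "v \<in> carrier V" for v using A(1) that by blast
  have Az: "A \<zero>\<^bsub>V\<^esub> = \<zero>\<^bsub>V\<^esub>"
    using A(2)[of "\<zero>\<^bsub>V\<^esub>" "\<zero>\<^bsub>V\<^esub>"] Acl[of "\<zero>\<^bsub>V\<^esub>"] by (simp add: M.add.r_cancel_one')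
  have AT: "A ((T ^^ k) v) = (T ^^ k) (A v)" if "v \<in> carrier V" for k v
    by (induction k) (use that A(4) in auto)
  have psi: "\<psi> a \<in> carrier K" if "a \<in> carrier K" for a
    using ring_hom_closed[OF assms(2) that] .
  \<comment> \<open>The coefficients of the difference \<open>p - \<psi>(p)\<close> are formed as \<open>p + m\<close>.\<close>
  define m where "m = map (\<lambda>a. (\<ominus>\<^bsub>K\<^esub> \<one>\<^bsub>K\<^esub>) \<otimes>\<^bsub>K\<^esub> a) (map \<psi> p)"
  define d where "d = map2 (\<oplus>\<^bsub>K\<^esub>) p m"
  have mp: "set (map \<psi> p) \<subseteq> carrier K" using p(1) psi by auto
  then have mK: "set m \<subseteq> carrier K" "length m = length p" unfolding m_def by auto
  have dK: "set d \<subseteq> carrier K" "length d = length p"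
    using mK set_map2_add[OF p(1) mK(1)] unfolding d_def by auto
  have "poly_op d v = \<zero>\<^bsub>V\<^esub>" if v: "v \<in> carrier V" for v
  proof -
    obtain u where u: "u \<in> carrier V" "v = A u" using A(1) v by blast
    have "poly_op (map \<psi> p) v = A (poly_op p u)"
      using poly_op_commute[OF p(1) u(1) Acl A(2-4) Az] u(2) by simp
    also have "\<dots> = (T ^^ length p) v" by (simp only: p(2)[OF u(1), symmetric] AT[OF u(1)] u(2))
    finally have "poly_op (map \<psi> p) v = poly_op p v" using p(2)[OF v] by simp
    then have "poly_op m v = \<ominus>\<^bsub>V\<^esub> poly_op p v"
      unfolding m_def using poly_op_map_mult[OF mp _ v] p(1) v by (simp add: smult_l_minus)
    then show ?thesis
      unfolding d_def using poly_op_map2_add[OF _ p(1) mK(1) v] mK(2) p(1) v by (simp add: M.r_neg)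
  qed
  then have d0: "\<forall>a\<in>set d. a = \<zero>\<^bsub>K\<^esub>"
  proof (rule_tac ccontr)
    assume *: "\<And>v. v \<in> carrier V \<Longrightarrow> poly_op d v = \<zero>\<^bsub>V\<^esub>" "\<not> (\<forall>a\<in>set d. a = \<zero>\<^bsub>K\<^esub>)"
    then obtain q where "length q < length d" "?P q"
      using relation_shortens[OF dK(1) _ *(1)] by blast
    then show False using min[of q] dK(2) by simp
  qed
  then have "\<psi> (p ! i) = p ! i" if "i < length p" for i
  proof -
    have i: "p ! i \<in> carrier K" "d ! i = \<zero>\<^bsub>K\<^esub>"
      using subsetD[OF p(1) nth_mem[OF that]] bspec[OF d0 nth_mem[of i d]] that dK(2) by auto
    have "d ! i = p ! i \<oplus>\<^bsub>K\<^esub> (\<ominus>\<^bsub>K\<^esub> \<psi> (p ! i))"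
      using that i(1) psi[OF i(1)] unfolding d_def m_def by (simp add: R.l_minus)
    then have "p ! i \<ominus>\<^bsub>K\<^esub> \<psi> (p ! i) = \<zero>\<^bsub>K\<^esub>" using i(2) by (simp add: R.minus_eq)
    then show ?thesis using i(1) psi[OF i(1)] by (simp add: R.r_right_minus_eq)
  qed
  then have fixed: "\<psi> a = a" if "a \<in> set p" for a
    using that unfolding in_set_conv_nth by blast
  have "set p \<subseteq> {a \<in> carrier K. \<psi> a = a}"
    using p(1) fixed by blast
  then show ?thesis using p(2) by (rule that)
qed

end

context linear_operator
begin

text \<open>The identity \<open>(1 + X + \<dots> + X\<^sup>n\<^sup>-\<^sup>1)(1 - X) = 1 - X\<^sup>n\<close>.\<close>

lemma poly_op_replicate_one:
  assumes "v \<in> carrier V"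
  shows "poly_op (replicate n \<one>\<^bsub>K\<^esub>) (v \<ominus>\<^bsub>V\<^esub> T v) = v \<ominus>\<^bsub>V\<^esub> (T ^^ n) v"
proof (induction n)
  case 0
  then show ?case using assms by (simp add: M.r_neg M.minus_eq)
next
  case (Suc n)
  have neg: "T (\<ominus>\<^bsub>V\<^esub> x) = \<ominus>\<^bsub>V\<^esub> T x" if "x \<in> carrier V" for x
    using T_add[of x "\<ominus>\<^bsub>V\<^esub> x"] that by (metis M.add.inv_closed M.minus_equality M.r_neg M.a_comm T_closed T_zero)
  have "poly_op (replicate (Suc n) \<one>\<^bsub>K\<^esub>) (v \<ominus>\<^bsub>V\<^esub> T v) = (v \<ominus>\<^bsub>V\<^esub> T v) \<oplus>\<^bsub>V\<^esub> T (v \<ominus>\<^bsub>V\<^esub> (T ^^ n) v)"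
    using Suc assms by simp
  also have "\<dots> = v \<oplus>\<^bsub>V\<^esub> (\<ominus>\<^bsub>V\<^esub> T v \<oplus>\<^bsub>V\<^esub> (T v \<oplus>\<^bsub>V\<^esub> \<ominus>\<^bsub>V\<^esub> T ((T ^^ n) v)))"
    using assms by (simp add: T_add neg M.minus_eq M.a_assoc)
  also have "\<dots> = v \<ominus>\<^bsub>V\<^esub> (T ^^ Suc n) v"
    using assms by (simp add: M.r_neg2 M.minus_eq M.r_neg1)
  finally show ?case .
qed

lemma poly_op_monom:
  assumes "v \<in> carrier V"
  shows "poly_op (replicate n \<zero>\<^bsub>K\<^esub> @ [\<one>\<^bsub>K\<^esub>]) v = (T ^^ n) v"
proof -
  have "poly_op (replicate n \<zero>\<^bsub>K\<^esub>) v = \<zero>\<^bsub>V\<^esub>"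
    by (induction n) (use assms in auto)
  moreover have "set (replicate n \<zero>\<^bsub>K\<^esub>) \<subseteq> carrier K" by auto
  ultimately show ?thesis using poly_op_append[of "replicate n \<zero>\<^bsub>K\<^esub>" "\<one>\<^bsub>K\<^esub>" v] assms by simp
qed

lemma horner_replicate_one:
  "horner (replicate n \<one>\<^bsub>K\<^esub>) \<one>\<^bsub>K\<^esub> = [n] \<cdot>\<^bsub>K\<^esub> \<one>\<^bsub>K\<^esub>"
proof (induction n)
  case (Suc n)
  then show ?case by (simp add: R.a_comm)
qed simp

lemma smult_left_cancel_zero:
  assumes "a \<in> carrier K" "a \<noteq> \<zero>\<^bsub>K\<^esub>" "v \<in> carrier V" "a \<odot>\<^bsub>V\<^esub> v = \<zero>\<^bsub>V\<^esub>"
  shows "v = \<zero>\<^bsub>V\<^esub>"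
  using mult_inverse[OF assms(1,3,4,2)] inv_nonzero_closed[OF assms(1,2)] by simp

text \<open>Applying \<open>T - lam n\<close> to the relation removes its last term and rescales the others by nonzero scalars.\<close>

lemma eigenvectors_independent:
  fixes n :: nat
  assumes "\<And>i. i < n \<Longrightarrow> x i \<in> carrier V" "\<And>i. i < n \<Longrightarrow> lam i \<in> carrier K"
    and "\<And>i. i < n \<Longrightarrow> T (x i) = lam i \<odot>\<^bsub>V\<^esub> x i" "inj_on lam {..<n}"
    and "(\<Oplus>\<^bsub>V\<^esub>i\<in>{..<n}. x i) = \<zero>\<^bsub>V\<^esub>" "i < n"
  shows "x i = \<zero>\<^bsub>V\<^esub>"
  using assms
proof (induction n arbitrary: x i)
  case (Suc n)
  have fs: "(\<Oplus>\<^bsub>V\<^esub>i\<in>{..<Suc n}. y i) = y n \<oplus>\<^bsub>V\<^esub> (\<Oplus>\<^bsub>V\<^esub>i\<in>{..<n}. y i)"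
    if "\<And>i. i < Suc n \<Longrightarrow> y i \<in> carrier V" for y
    using that by (simp add: lessThan_Suc M.finsum_insert Pi_iff)
  define z where "z i = (lam i \<ominus>\<^bsub>K\<^esub> lam n) \<odot>\<^bsub>V\<^esub> x i" for i
  have z: "z i \<in> carrier V" if "i < Suc n" for i using Suc that unfolding z_def by simp
  have Tsum: "T (\<Oplus>\<^bsub>V\<^esub>i\<in>{..<m}. x i) = (\<Oplus>\<^bsub>V\<^esub>i\<in>{..<m}. T (x i))" if "m \<le> Suc n" for m
    using that Suc(2) by (induction m) (auto simp: lessThan_Suc M.finsum_insert Pi_iff T_add M.finsum_closed)
  have zsum: "(\<Oplus>\<^bsub>V\<^esub>i\<in>{..<Suc n}. z i) = \<zero>\<^bsub>V\<^esub>"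
  proof -
    have cl: "x \<in> {..<Suc n} \<rightarrow> carrier V" "(\<lambda>i. T (x i)) \<in> {..<Suc n} \<rightarrow> carrier V" using Suc by auto
    have "(\<Oplus>\<^bsub>V\<^esub>i\<in>{..<Suc n}. z i) = (\<Oplus>\<^bsub>V\<^esub>i\<in>{..<Suc n}. T (x i) \<oplus>\<^bsub>V\<^esub> (\<ominus>\<^bsub>K\<^esub> lam n) \<odot>\<^bsub>V\<^esub> x i)"
      using Suc(2-4) by (intro M.finsum_cong') (auto simp: z_def smult_l_distr R.minus_eq)
    also have "\<dots> = (\<Oplus>\<^bsub>V\<^esub>i\<in>{..<Suc n}. T (x i)) \<oplus>\<^bsub>V\<^esub> (\<Oplus>\<^bsub>V\<^esub>i\<in>{..<Suc n}. (\<ominus>\<^bsub>K\<^esub> lam n) \<odot>\<^bsub>V\<^esub> x i)"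
      using Suc by (intro M.finsum_addf) auto
    also have "(\<Oplus>\<^bsub>V\<^esub>i\<in>{..<Suc n}. (\<ominus>\<^bsub>K\<^esub> lam n) \<odot>\<^bsub>V\<^esub> x i) = (\<ominus>\<^bsub>K\<^esub> lam n) \<odot>\<^bsub>V\<^esub> (\<Oplus>\<^bsub>V\<^esub>i\<in>{..<Suc n}. x i)"
      using Suc(3) cl by (intro finsum_smult_ldistr[symmetric]) auto
    moreover have "(\<Oplus>\<^bsub>V\<^esub>i\<in>{..<Suc n}. T (x i)) = \<zero>\<^bsub>V\<^esub>"
      using Tsum[of "Suc n"] Suc(6) T_zero by (metis order_refl)
    ultimately show ?thesis using Suc(3)[of n] Suc(6) by simp
  qed
  have zn: "z n = \<zero>\<^bsub>V\<^esub>" using Suc unfolding z_def by (simp add: R.r_neg R.minus_eq)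
  then have zsum': "(\<Oplus>\<^bsub>V\<^esub>i\<in>{..<n}. z i) = \<zero>\<^bsub>V\<^esub>"
    using fs[of z] z zsum M.finsum_closed[of z "{..<n}"] by (simp add: Pi_iff)
  have x0: "x i = \<zero>\<^bsub>V\<^esub>" if i: "i < n" for i
  proof -
    have "z i = \<zero>\<^bsub>V\<^esub>"
    proof (rule Suc(1)[OF _ _ _ _ zsum' i])
      show "T (z j) = lam j \<odot>\<^bsub>V\<^esub> z j" if "j < n" for j
        using that Suc(2-4)[of j] Suc(3)[of n]
        by (simp add: z_def T_smult smult_assoc1[symmetric] R.m_comm)
      show "inj_on lam {..<n}" using Suc(5) by (auto intro: inj_on_subset)
    qed (use z Suc(3) in auto)
    moreover have "lam i \<ominus>\<^bsub>K\<^esub> lam n \<noteq> \<zero>\<^bsub>K\<^esub>"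
      using Suc(3)[of i] Suc(3)[of n] Suc(5) i by (auto simp: R.r_right_minus_eq inj_on_def)
    ultimately show ?thesis
      using smult_left_cancel_zero[of "lam i \<ominus>\<^bsub>K\<^esub> lam n" "x i"] i Suc(2,3) by (simp add: z_def)
  qed
  have "(\<Oplus>\<^bsub>V\<^esub>i\<in>{..<n}. x i) = \<zero>\<^bsub>V\<^esub>"
    by (rule M.add.finprod_one_eqI) (use x0 in auto)
  then have "x n = \<zero>\<^bsub>V\<^esub>" using fs[of x] Suc(2) Suc(6) by simp
  then show ?case using x0 Suc(7) less_Suc_eq by auto
qed simp

end

section \<open>Semilinear actions of the integers\<close>

text \<open>What a module over the skew Laurent polynomials amounts to: \<open>P i\<close> is the action of \<open>\<Phi>\<^sup>i\<close>, and \<open>\<sigma> i\<close> is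
  the power \<open>\<phi>\<^sup>i\<close> of the automorphism. A set \<open>stable t U\<close> corresponds to a submodule over \<open>D\<^sub>t\<close>.\<close>

locale semilinear_action = vectorspace F V for F V +
  fixes \<sigma> :: "int \<Rightarrow> 'a \<Rightarrow> 'a" and P :: "int \<Rightarrow> 'c \<Rightarrow> 'c"
  assumes sigma_hom: "\<sigma> i \<in> ring_hom F F"
    and sigma_0: "a \<in> carrier F \<Longrightarrow> \<sigma> 0 a = a"
    and sigma_sigma: "a \<in> carrier F \<Longrightarrow> \<sigma> i (\<sigma> j a) = \<sigma> (i + j) a"
    and P_closed [simp, intro]: "x \<in> carrier V \<Longrightarrow> P i x \<in> carrier V"
    and P_add: "x \<in> carrier V \<Longrightarrow> y \<in> carrier V \<Longrightarrow> P i (x \<oplus>\<^bsub>V\<^esub> y) = P i x \<oplus>\<^bsub>V\<^esub> P i y"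
    and P_smult: "a \<in> carrier F \<Longrightarrow> x \<in> carrier V \<Longrightarrow> P i (a \<odot>\<^bsub>V\<^esub> x) = \<sigma> i a \<odot>\<^bsub>V\<^esub> P i x"
    and P_0: "x \<in> carrier V \<Longrightarrow> P 0 x = x"
    and P_P: "x \<in> carrier V \<Longrightarrow> P i (P j x) = P (i + j) x"
begin

definition stable :: "nat \<Rightarrow> 'c set \<Rightarrow> bool" where
  "stable t U \<longleftrightarrow> subspace F U V \<and> (\<forall>k. \<forall>x\<in>U. P (int t * k) x \<in> U)"

definition orbit_sum :: "nat \<Rightarrow> 'c set \<Rightarrow> 'c set" where
  "orbit_sum s U = {\<Oplus>\<^bsub>V\<^esub>i\<in>{..<s}. P (int i) (u i) | u. u \<in> {..<s} \<rightarrow> U}"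

abbreviation constants :: "('a, 'b) ring_scheme" where
  "constants \<equiv> F\<lparr>carrier := {a \<in> carrier F. \<sigma> 1 a = a}\<rparr>"

lemma sigma_closed [simp, intro]: "a \<in> carrier F \<Longrightarrow> \<sigma> i a \<in> carrier F"
  using ring_hom_closed[OF sigma_hom] .

lemma P_neg [simp]: "x \<in> carrier V \<Longrightarrow> P i (P (- i) x) = x" "x \<in> carrier V \<Longrightarrow> P (- i) (P i x) = x"
  by (simp_all add: P_P P_0)

lemma sigma_neg [simp]: "a \<in> carrier F \<Longrightarrow> \<sigma> i (\<sigma> (- i) a) = a"
  by (simp add: sigma_sigma sigma_0)

lemma P_zero [simp]: "P i \<zero>\<^bsub>V\<^esub> = \<zero>\<^bsub>V\<^esub>"
  using P_add[of "\<zero>\<^bsub>V\<^esub>" "\<zero>\<^bsub>V\<^esub>" i] P_closed[of "\<zero>\<^bsub>V\<^esub>" i] by (simp add: M.add.r_cancel_one')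

lemma P_eq_zero: "x \<in> carrier V \<Longrightarrow> P i x = \<zero>\<^bsub>V\<^esub> \<Longrightarrow> x = \<zero>\<^bsub>V\<^esub>"
  by (metis P_neg(2) P_zero)

lemma smult_P: "a \<in> carrier F \<Longrightarrow> x \<in> carrier V \<Longrightarrow> a \<odot>\<^bsub>V\<^esub> P i x = P i (\<sigma> (- i) a \<odot>\<^bsub>V\<^esub> x)"
  by (simp add: P_smult)

lemma P_finsum:
  "finite A \<Longrightarrow> f \<in> A \<rightarrow> carrier V \<Longrightarrow> P k (\<Oplus>\<^bsub>V\<^esub>i\<in>A. f i) = (\<Oplus>\<^bsub>V\<^esub>i\<in>A. P k (f i))"
  by (induction A rule: finite_induct) (auto simp: M.finsum_insert P_add Pi_iff M.finsum_closed)

lemma finsum_in_subspace: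
  assumes "subspace F U V" "finite A" "f \<in> A \<rightarrow> U"
  shows "(\<Oplus>\<^bsub>V\<^esub>i\<in>A. f i) \<in> U"
  using assms(2,3)
proof (induction A rule: finite_induct)
  case (insert a A)
  then show ?case
    using subspaceD[OF assms(1)] by (subst M.finsum_insert) (auto simp: Pi_iff)
qed (use subspaceD[OF assms(1)] in simp)

lemma P_iterate_mem:
  assumes "\<And>x. x \<in> U \<Longrightarrow> P j x \<in> U" "U \<subseteq> carrier V" "x \<in> U"
  shows "P (j * int n) x \<in> U"
proof (induction n)
  case 0
  then show ?case using assms by (auto simp: P_0)
next
  case (Suc n)
  have "P (j * int (Suc n)) x = P j (P (j * int n) x)"
    using assms by (auto simp: P_P algebra_simps)
  then show ?case using Suc assms(1) by simp
qed

lemma stableI: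
  assumes "subspace F U V" "\<And>x. x \<in> U \<Longrightarrow> P (int t) x \<in> U" "\<And>x. x \<in> U \<Longrightarrow> P (- int t) x \<in> U"
  shows "stable t U"
  unfolding stable_def
proof (intro conjI assms(1) allI ballI)
  fix k x assume x: "x \<in> U"
  show "P (int t * k) x \<in> U"
  proof (cases "0 \<le> k")
    case True
    then show ?thesis
      using P_iterate_mem[OF assms(2) subspaceD(1)[OF assms(1)] x, of "nat k"] by simp
  next
    case False
    then show ?thesis
      using P_iterate_mem[OF assms(3) subspaceD(1)[OF assms(1)] x, of "nat (- k)"] by simp
  qed
qed

lemma stableD:
  assumes "stable t U"
  shows "subspace F U V" "x \<in> U \<Longrightarrow> P (int t * k) x \<in> U" "U \<subseteq> carrier V" "\<zero>\<^bsub>V\<^esub> \<in> U"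
    "x \<in> U \<Longrightarrow> y \<in> U \<Longrightarrow> x \<oplus>\<^bsub>V\<^esub> y \<in> U" "a \<in> carrier F \<Longrightarrow> x \<in> U \<Longrightarrow> a \<odot>\<^bsub>V\<^esub> x \<in> U"
    "x \<in> U \<Longrightarrow> \<ominus>\<^bsub>V\<^esub> x \<in> U"
proof -
  show "subspace F U V" using assms unfolding stable_def by blast
  note S = subspaceD[OF this]
  show "x \<in> U \<Longrightarrow> P (int t * k) x \<in> U" using assms unfolding stable_def by blast
  show "U \<subseteq> carrier V" "\<zero>\<^bsub>V\<^esub> \<in> U" "x \<in> U \<Longrightarrow> y \<in> U \<Longrightarrow> x \<oplus>\<^bsub>V\<^esub> y \<in> U"
    "a \<in> carrier F \<Longrightarrow> x \<in> U \<Longrightarrow> a \<odot>\<^bsub>V\<^esub> x \<in> U" using S by auto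
  show "\<ominus>\<^bsub>V\<^esub> x \<in> U" if "x \<in> U"
    using S(1) S(4)[of "\<ominus>\<^bsub>F\<^esub> \<one>\<^bsub>F\<^esub>" x] that by (auto simp: smult_l_minus)
qed

lemma stable_zero: "stable t {\<zero>\<^bsub>V\<^esub>}"
  by (intro stableI subspaceI) auto

lemma stable_inter:
  assumes "stable t U" "stable t W"
  shows "stable t (U \<inter> W)"
  using stableD[OF assms(1)] stableD[OF assms(2)] unfolding stable_def
  by (intro conjI subspaceI) auto

text \<open>Although \<open>P i\<close> is only semilinear, it commutes with \<open>P (int t * k)\<close> and permutes the stable subspaces.\<close>

lemma stable_image:
  assumes "stable t U"
  shows "stable t (P i ` U)"
  unfolding stable_def
proof (intro conjI subspaceI allI ballI)
  note S = stableD[OF assms]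
  have UV: "x \<in> carrier V" if "x \<in> U" for x using S(3) that by auto
  show "P i ` U \<subseteq> carrier V" using UV by auto
  show "\<zero>\<^bsub>V\<^esub> \<in> P i ` U" using S(4) by (metis P_zero imageI)
  show "v \<oplus>\<^bsub>V\<^esub> w \<in> P i ` U" if "v \<in> P i ` U" "w \<in> P i ` U" for v w
    using that S(5) UV by (force simp: P_add[symmetric])
  show "a \<odot>\<^bsub>V\<^esub> v \<in> P i ` U" if "a \<in> carrier F" "v \<in> P i ` U" for a v
    using that S(6) UV by (force simp: smult_P)
  show "P (int t * k) x \<in> P i ` U" if x: "x \<in> P i ` U" for k x
  proof -
    obtain u where u: "u \<in> U" "x = P i u" using x by auto
    have "P (int t * k) x = P i (P (int t * k) u)" using u UV by (simp add: P_P add.commute)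
    then show ?thesis using S(2) u by blast
  qed
qed

definition set_sum :: "'c set \<Rightarrow> 'c set \<Rightarrow> 'c set" where
  "set_sum U W = {u \<oplus>\<^bsub>V\<^esub> w | u w. u \<in> U \<and> w \<in> W}"

lemma stable_set_sum:
  assumes "stable t U" "stable t W"
  shows "stable t (set_sum U W)"
  unfolding stable_def
proof (intro conjI subspaceI allI ballI)
  note S = stableD[OF assms(1)] and S' = stableD[OF assms(2)]
  have UV: "x \<in> U \<Longrightarrow> x \<in> carrier V" "x \<in> W \<Longrightarrow> x \<in> carrier V" for x using S(3) S'(3) by auto
  show "set_sum U W \<subseteq> carrier V" using UV by (auto simp: set_sum_def)
  show "\<zero>\<^bsub>V\<^esub> \<in> set_sum U W" unfolding set_sum_def using S(4) S'(4) M.l_zero[OF M.zero_closed] by force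
  show "v \<oplus>\<^bsub>V\<^esub> w \<in> set_sum U W" if vw: "v \<in> set_sum U W" "w \<in> set_sum U W" for v w
  proof -
    obtain a b where ab: "v = a \<oplus>\<^bsub>V\<^esub> b" "a \<in> U" "b \<in> W" using vw(1) set_sum_def by auto
    obtain c d where cd: "w = c \<oplus>\<^bsub>V\<^esub> d" "c \<in> U" "d \<in> W" using vw(2) set_sum_def by auto
    have "v \<oplus>\<^bsub>V\<^esub> w = (a \<oplus>\<^bsub>V\<^esub> c) \<oplus>\<^bsub>V\<^esub> (b \<oplus>\<^bsub>V\<^esub> d)" using ab cd UV by (simp add: M.a_ac)
    then show ?thesis unfolding set_sum_def using S(5) S'(5) ab cd by blast
  qed
  show "a \<odot>\<^bsub>V\<^esub> v \<in> set_sum U W" if a: "a \<in> carrier F" "v \<in> set_sum U W" for a v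
  proof -
    obtain b c where bc: "v = b \<oplus>\<^bsub>V\<^esub> c" "b \<in> U" "c \<in> W" using a(2) set_sum_def by auto
    then have "a \<odot>\<^bsub>V\<^esub> v = a \<odot>\<^bsub>V\<^esub> b \<oplus>\<^bsub>V\<^esub> a \<odot>\<^bsub>V\<^esub> c" using UV a(1) by (simp add: smult_r_distr)
    then show ?thesis unfolding set_sum_def using S(6) S'(6) a bc by blast
  qed
  show "P (int t * k) x \<in> set_sum U W" if x: "x \<in> set_sum U W" for k x
  proof -
    obtain b c where bc: "x = b \<oplus>\<^bsub>V\<^esub> c" "b \<in> U" "c \<in> W" using x set_sum_def by auto
    then have "P (int t * k) x = P (int t * k) b \<oplus>\<^bsub>V\<^esub> P (int t * k) c" using UV by (simp add: P_add)
    then show ?thesis unfolding set_sum_def using S(2) S'(2) bc by blast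
  qed
qed

lemma set_sum_upper:
  assumes "stable t U" "stable t W"
  shows "U \<subseteq> set_sum U W" "W \<subseteq> set_sum U W"
proof -
  note S = stableD[OF assms(1)] and S' = stableD[OF assms(2)]
  show "U \<subseteq> set_sum U W"
  proof
    fix x assume x: "x \<in> U"
    then have "x = x \<oplus>\<^bsub>V\<^esub> \<zero>\<^bsub>V\<^esub>" using S(3) by auto
    then show "x \<in> set_sum U W" unfolding set_sum_def using x S'(4) by blast
  qed
  show "W \<subseteq> set_sum U W"
  proof
    fix x assume x: "x \<in> W"
    then have "x = \<zero>\<^bsub>V\<^esub> \<oplus>\<^bsub>V\<^esub> x" using S'(3) by auto
    then show "x \<in> set_sum U W" unfolding set_sum_def using x S(4) by blast
  qed
qed

lemma orbit_sumI: "u \<in> {..<s} \<rightarrow> U \<Longrightarrow> x = (\<Oplus>\<^bsub>V\<^esub>i\<in>{..<s}. P (int i) (u i)) \<Longrightarrow> x \<in> orbit_sum s U"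
  unfolding orbit_sum_def by blast

lemma orbit_sumE:
  assumes "x \<in> orbit_sum s U"
  obtains u where "u \<in> {..<s} \<rightarrow> U" "x = (\<Oplus>\<^bsub>V\<^esub>i\<in>{..<s}. P (int i) (u i))"
  using assms unfolding orbit_sum_def by blast

lemma P_as_orbit_sum:
  assumes "i < s" "x \<in> carrier V"
  shows "P (int i) x = (\<Oplus>\<^bsub>V\<^esub>j\<in>{..<s}. P (int j) (if i = j then x else \<zero>\<^bsub>V\<^esub>))"
proof -
  have "P (int i) x = (\<Oplus>\<^bsub>V\<^esub>j\<in>{..<s}. if i = j then P (int j) x else \<zero>\<^bsub>V\<^esub>)"
    using assms by (intro M.finsum_singleton[symmetric]) auto
  also have "\<dots> = (\<Oplus>\<^bsub>V\<^esub>j\<in>{..<s}. P (int j) (if i = j then x else \<zero>\<^bsub>V\<^esub>))"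
    using assms by (intro M.finsum_cong') auto
  finally show ?thesis .
qed

text \<open>Division with remainder, \<open>k = i + s q\<close> with \<open>i < s\<close>, and \<open>P (s q)\<close> preserves \<open>U\<close>.\<close>

lemma single_in_orbit_sum:
  assumes "stable s U" "0 < s" "x \<in> U"
  shows "P k x \<in> orbit_sum s U"
proof -
  note S = stableD[OF assms(1)]
  define i where "i = nat (k mod int s)"
  have i: "i < s" "k = int i + int s * (k div int s)" using assms(2) unfolding i_def
    by (auto simp: nat_less_iff)
  define y where "y = P (int s * (k div int s)) x"
  have y: "y \<in> U" "y \<in> carrier V" unfolding y_def using S(2,3) assms(3) by auto
  have "P k x = P (int i) y" 
    unfolding y_def using i(2) assms(3) S(3) by (metis P_P subsetD)
  also have "\<dots> = (\<Oplus>\<^bsub>V\<^esub>j\<in>{..<s}. P (int j) (if i = j then y else \<zero>\<^bsub>V\<^esub>))"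
    by (rule P_as_orbit_sum[OF i(1) y(2)])
  finally show ?thesis using y S(4) by (intro orbit_sumI[of "\<lambda>j. if i = j then y else \<zero>\<^bsub>V\<^esub>"]) auto
qed

text \<open>This is the submodule over \<open>D\<close> generated by a submodule \<open>U\<close> over \<open>D\<^sub>s\<close>.\<close>

lemma stable_orbit_sum:
  assumes "stable s U" "0 < s"
  shows "stable 1 (orbit_sum s U)"
proof -
  note S = stableD[OF assms(1)]
  have UV: "x \<in> carrier V" if "x \<in> U" for x using S(3) that by auto
  have sub: "subspace F (orbit_sum s U) V"
  proof (rule subspaceI)
    show "orbit_sum s U \<subseteq> carrier V"
      using UV by (auto elim!: orbit_sumE intro!: M.finsum_closed)
    show "\<zero>\<^bsub>V\<^esub> \<in> orbit_sum s U"
      using S(4) by (intro orbit_sumI[of "\<lambda>_. \<zero>\<^bsub>V\<^esub>"]) (auto simp: M.add.finprod_one_eqI)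
    show "v \<oplus>\<^bsub>V\<^esub> w \<in> orbit_sum s U" if vw: "v \<in> orbit_sum s U" "w \<in> orbit_sum s U" for v w
    proof -
      obtain u where u: "u \<in> {..<s} \<rightarrow> U" "v = (\<Oplus>\<^bsub>V\<^esub>i\<in>{..<s}. P (int i) (u i))"
        using vw(1) by (rule orbit_sumE)
      obtain u' where u': "u' \<in> {..<s} \<rightarrow> U" "w = (\<Oplus>\<^bsub>V\<^esub>i\<in>{..<s}. P (int i) (u' i))"
        using vw(2) by (rule orbit_sumE)
      have "v \<oplus>\<^bsub>V\<^esub> w = (\<Oplus>\<^bsub>V\<^esub>i\<in>{..<s}. P (int i) (u i) \<oplus>\<^bsub>V\<^esub> P (int i) (u' i))"
        unfolding u u' using u(1) u'(1) UV by (intro M.finsum_addf[symmetric]) (auto simp: Pi_iff)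
      also have "\<dots> = (\<Oplus>\<^bsub>V\<^esub>i\<in>{..<s}. P (int i) (u i \<oplus>\<^bsub>V\<^esub> u' i))"
        using u(1) u'(1) UV by (intro M.finsum_cong') (auto simp: Pi_iff P_add)
      finally show ?thesis using u(1) u'(1) S(5)
        by (intro orbit_sumI[of "\<lambda>i. u i \<oplus>\<^bsub>V\<^esub> u' i"]) (auto simp: Pi_iff)
    qed
    show "a \<odot>\<^bsub>V\<^esub> v \<in> orbit_sum s U" if a: "a \<in> carrier F" "v \<in> orbit_sum s U" for a v
    proof -
      obtain u where u: "u \<in> {..<s} \<rightarrow> U" "v = (\<Oplus>\<^bsub>V\<^esub>i\<in>{..<s}. P (int i) (u i))"
        using a(2) by (rule orbit_sumE)
      have "a \<odot>\<^bsub>V\<^esub> v = (\<Oplus>\<^bsub>V\<^esub>i\<in>{..<s}. a \<odot>\<^bsub>V\<^esub> P (int i) (u i))"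
        unfolding u using u(1) UV a(1) by (intro finsum_smult_ldistr) (auto simp: Pi_iff)
      also have "\<dots> = (\<Oplus>\<^bsub>V\<^esub>i\<in>{..<s}. P (int i) (\<sigma> (- int i) a \<odot>\<^bsub>V\<^esub> u i))"
        using u(1) UV a(1) by (intro M.finsum_cong') (auto simp: Pi_iff smult_P)
      finally show ?thesis using u(1) a(1) S(6)
        by (intro orbit_sumI[of "\<lambda>i. \<sigma> (- int i) a \<odot>\<^bsub>V\<^esub> u i"]) (auto simp: Pi_iff)
    qed
  qed
  have "P k v \<in> orbit_sum s U" if v: "v \<in> orbit_sum s U" for k v
  proof -
    obtain u where u: "u \<in> {..<s} \<rightarrow> U" "v = (\<Oplus>\<^bsub>V\<^esub>i\<in>{..<s}. P (int i) (u i))"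
      using v by (rule orbit_sumE)
    have "P k v = (\<Oplus>\<^bsub>V\<^esub>i\<in>{..<s}. P k (P (int i) (u i)))"
      unfolding u using u(1) UV by (intro P_finsum) (auto simp: Pi_iff)
    moreover have "P k (P (int i) (u i)) \<in> orbit_sum s U" if "i < s" for i
      using single_in_orbit_sum[OF assms, of "u i" "k + int i"] u(1) UV that by (auto simp: Pi_iff P_P)
    ultimately show ?thesis
      using finsum_in_subspace[OF sub, of "{..<s}" "\<lambda>i. P k (P (int i) (u i))"] by (simp add: Pi_iff)
  qed
  then show ?thesis using sub by (auto simp: stable_def)
qed

lemma subset_orbit_sum:
  assumes "stable s U" "0 < s"
  shows "U \<subseteq> orbit_sum s U"
proof
  fix x assume "x \<in> U"
  then show "x \<in> orbit_sum s U"
    using single_in_orbit_sum[OF assms, of x 0] stableD(3)[OF assms(1)] P_0[of x] by auto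
qed

end

section \<open>A complement that is not invariant\<close>

locale irreducible_action = semilinear_action F V \<sigma> P for F V \<sigma> P +
  assumes fin_dim: "fin_dim"
    and irreducible: "stable 1 U \<Longrightarrow> U = {\<zero>\<^bsub>V\<^esub>} \<or> U = carrier V"
begin

lemma orbit_sum_eq_carrier:
  assumes "stable s U" "0 < s" "U \<noteq> {\<zero>\<^bsub>V\<^esub>}"
  shows "orbit_sum s U = carrier V"
  using irreducible[OF stable_orbit_sum[OF assms(1,2)]] subset_orbit_sum[OF assms(1,2)] assms(3)
    stableD(4)[OF assms(1)] by auto

lemma minimal_stable:
  assumes "stable t U0" "U0 \<noteq> {\<zero>\<^bsub>V\<^esub>}"
  obtains U where "stable t U" "U \<noteq> {\<zero>\<^bsub>V\<^esub>}"
    "\<forall>U'. stable t U' \<longrightarrow> U' \<subseteq> U \<longrightarrow> U' = {\<zero>\<^bsub>V\<^esub>} \<or> U' = U"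
proof -
  let ?Q = "\<lambda>U. stable t U \<and> U \<noteq> {\<zero>\<^bsub>V\<^esub>}"
  obtain U where U: "?Q U" "\<forall>U'. ?Q U' \<longrightarrow> rank U \<le> rank U'"
    using ex_has_least_nat[of ?Q U0 rank] assms by auto
  then have "stable t U" "U \<noteq> {\<zero>\<^bsub>V\<^esub>}" by auto
  moreover have "U' = {\<zero>\<^bsub>V\<^esub>} \<or> U' = U" if U': "stable t U'" "U' \<subseteq> U" for U'
  proof (cases "U' = {\<zero>\<^bsub>V\<^esub>}")
    case False
    then have "rank U \<le> rank U'" using U(2) U'(1) by simp
    then show ?thesis
      using subspace_eq_of_rank_le[OF fin_dim stableD(1)[OF U'(1)] U'(2)] stableD(3)[OF \<open>stable t U\<close>] by simp
  qed simp
  ultimately show ?thesis using that by blast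
qed

text \<open>Let \<open>U\<close> be minimal and \<open>W\<close> of maximal rank among the stable subspaces that meet \<open>U\<close> trivially. A translate
  of \<open>U\<close> is again minimal. If it were not contained in \<open>U + W\<close>, it would meet \<open>U + W\<close> trivially and could be
  added to \<open>W\<close>. So \<open>U + W\<close> contains all translates of \<open>U\<close>, whose sum is the whole space.\<close>

lemma stable_complement:
  assumes "stable t U0" "U0 \<noteq> {\<zero>\<^bsub>V\<^esub>}" "U0 \<noteq> carrier V" "0 < t"
  obtains U W where "stable t U" "stable t W" "U \<inter> W = {\<zero>\<^bsub>V\<^esub>}" "set_sum U W = carrier V"
    "U \<noteq> {\<zero>\<^bsub>V\<^esub>}" "W \<noteq> {\<zero>\<^bsub>V\<^esub>}"
proof -
  obtain U where U: "stable t U" "U \<noteq> {\<zero>\<^bsub>V\<^esub>}"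
      and min: "\<And>U'. stable t U' \<Longrightarrow> U' \<subseteq> U \<Longrightarrow> U' = {\<zero>\<^bsub>V\<^esub>} \<or> U' = U"
    using minimal_stable[OF assms(1,2)] by blast
  note SU = stableD[OF U(1)]
  let ?Q = "\<lambda>W. stable t W \<and> U \<inter> W = {\<zero>\<^bsub>V\<^esub>}"
  have "\<forall>W. ?Q W \<longrightarrow> rank W < Suc dim"
    using rank_le_dim[OF fin_dim] stableD(3) by (auto simp: less_Suc_eq_le)
  moreover have "?Q {\<zero>\<^bsub>V\<^esub>}" using stable_zero SU(4) by auto
  ultimately obtain W where W: "stable t W" "U \<inter> W = {\<zero>\<^bsub>V\<^esub>}"
      and max: "\<And>W'. ?Q W' \<Longrightarrow> rank W' \<le> rank W"
    using ex_has_greatest_nat[of ?Q "{\<zero>\<^bsub>V\<^esub>}" rank "Suc dim"] by blast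
  note SW = stableD[OF W(1)]
  have UW: "stable t (set_sum U W)" using stable_set_sum U(1) W(1) by blast
  note SP = stableD[OF UW]
  have UV: "x \<in> U \<Longrightarrow> x \<in> carrier V" "x \<in> W \<Longrightarrow> x \<in> carrier V" for x using SU(3) SW(3) by auto
  have sub: "P i ` U \<subseteq> set_sum U W" for i
  proof -
    define J where "J = P i ` U"
    have J: "stable t J" unfolding J_def using stable_image U(1) by blast
    note SX = stableD[OF J]
    \<comment> \<open>Pulling the intersection back into \<open>U\<close> makes the minimality of \<open>U\<close> applicable.\<close>
    define Y where "Y = P (- i) ` (J \<inter> set_sum U W)"
    have "stable t Y" unfolding Y_def using stable_image stable_inter J UW by blast
    moreover have YU: "Y \<subseteq> U" unfolding Y_def J_def using UV by auto
    ultimately have "Y = {\<zero>\<^bsub>V\<^esub>} \<or> Y = U" using min by blast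
    then show ?thesis
    proof
      assume Y: "Y = U"
      have "P i u \<in> set_sum U W" if u: "u \<in> U" for u
      proof -
        obtain x where x: "x \<in> J \<inter> set_sum U W" "u = P (- i) x" using u Y unfolding Y_def by auto
        then show ?thesis using SX(3) by auto
      qed
      then show ?thesis by auto
    next
      assume Y: "Y = {\<zero>\<^bsub>V\<^esub>}"
      have X0: "x = \<zero>\<^bsub>V\<^esub>" if x: "x \<in> J" "x \<in> set_sum U W" for x
      proof -
        have "P (- i) x \<in> Y" unfolding Y_def using x by blast
        then show ?thesis using Y P_eq_zero[of x "- i"] x SX(3) by auto
      qed
      have "U \<inter> set_sum W J = {\<zero>\<^bsub>V\<^esub>}"
      proof -
        have "u = \<zero>\<^bsub>V\<^esub>" if u: "u \<in> U" "u \<in> set_sum W J" for u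
        proof -
          obtain w x where wx: "u = w \<oplus>\<^bsub>V\<^esub> x" "w \<in> W" "x \<in> J" using u(2) unfolding set_sum_def by auto
          have car: "u \<in> carrier V" "w \<in> carrier V" "x \<in> carrier V" using u wx UV SX(3) by auto
          have "x = u \<oplus>\<^bsub>V\<^esub> (\<ominus>\<^bsub>V\<^esub> w)" using wx(1) car by (simp add: M.a_comm M.r_neg1)
          then have "x \<in> set_sum U W" unfolding set_sum_def using u(1) SW(7)[OF wx(2)] by blast
          then have "x = \<zero>\<^bsub>V\<^esub>" using X0 wx(3) by blast
          then have "u = w" using wx car by simp
          then show ?thesis using W(2) u(1) wx(2) by blast
        qed
        moreover have "\<zero>\<^bsub>V\<^esub> \<in> set_sum W J" using stableD(4)[OF stable_set_sum[OF W(1) J]] .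
        ultimately show ?thesis using SU(4) by blast
      qed
      then have "rank (set_sum W J) \<le> rank W" using max stable_set_sum[OF W(1) J] by blast
      then have "W = set_sum W J"
        using subspace_eq_of_rank_le[OF fin_dim SW(1) set_sum_upper(1)[OF W(1) J]]
          stableD(3)[OF stable_set_sum[OF W(1) J]] by blast
      then have "J \<subseteq> W" using set_sum_upper(2)[OF W(1) J] by simp
      then show ?thesis using set_sum_upper(2)[OF U(1) W(1)] J_def by blast
    qed
  qed
  have "orbit_sum t U \<subseteq> set_sum U W"
  proof
    fix x assume "x \<in> orbit_sum t U"
    then obtain u where u: "u \<in> {..<t} \<rightarrow> U" "x = (\<Oplus>\<^bsub>V\<^esub>i\<in>{..<t}. P (int i) (u i))" by (rule orbit_sumE)
    have "(\<lambda>i. P (int i) (u i)) \<in> {..<t} \<rightarrow> set_sum U W" using u(1) sub by (auto simp: Pi_iff)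
    then show "x \<in> set_sum U W" unfolding u(2) by (intro finsum_in_subspace SP(1)) auto
  qed
  then have full: "set_sum U W = carrier V"
    using orbit_sum_eq_carrier[OF U(1) assms(4) U(2)] SP(3) by blast
  have "W \<noteq> {\<zero>\<^bsub>V\<^esub>}"
  proof
    assume "W = {\<zero>\<^bsub>V\<^esub>}"
    then have "set_sum U W \<subseteq> U" unfolding set_sum_def using UV by auto
    then have "U = carrier V" using full SU(3) by blast
    then show False using min[OF assms(1)] assms(2,3) stableD(3)[OF assms(1)] by blast
  qed
  then show ?thesis using that U W full by blast
qed

text \<open>The projection onto \<open>U\<close> along \<open>W\<close>. If it commuted with \<open>P 1\<close>, its kernel \<open>W\<close> would contradict
  irreducibility.\<close>

lemma noninvariant_endo:
  assumes "stable t U0" "U0 \<noteq> {\<zero>\<^bsub>V\<^esub>}" "U0 \<noteq> carrier V" "0 < t"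
  obtains e x where "linear_operator F V e"
    "\<forall>x\<in>carrier V. \<forall>k. e (P (int t * k) x) = P (int t * k) (e x)"
    "x \<in> carrier V" "P (- 1) (e (P 1 x)) \<noteq> e x"
proof -
  obtain U W where U: "stable t U" and W: "stable t W" and UW: "U \<inter> W = {\<zero>\<^bsub>V\<^esub>}" "set_sum U W = carrier V"
    and nz: "U \<noteq> {\<zero>\<^bsub>V\<^esub>}" "W \<noteq> {\<zero>\<^bsub>V\<^esub>}"
    using stable_complement[OF assms] by blast
  note SU = stableD[OF U] and SW = stableD[OF W]
  have UV: "x \<in> U \<Longrightarrow> x \<in> carrier V" "x \<in> W \<Longrightarrow> x \<in> carrier V" for x using SU(3) SW(3) by auto
  have uniq: "u = u'" if "u \<in> U" "u' \<in> U" "w \<in> W" "w' \<in> W" "u \<oplus>\<^bsub>V\<^esub> w = u' \<oplus>\<^bsub>V\<^esub> w'" for u u' w w'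
  proof -
    have car: "u \<in> carrier V" "u' \<in> carrier V" "w \<in> carrier V" "w' \<in> carrier V" using that UV by auto
    have "(\<ominus>\<^bsub>V\<^esub> u' \<oplus>\<^bsub>V\<^esub> u) \<oplus>\<^bsub>V\<^esub> w = w'"
      using that(5) car by (simp add: M.a_assoc M.r_neg1)
    then have "\<ominus>\<^bsub>V\<^esub> u' \<oplus>\<^bsub>V\<^esub> u = w' \<oplus>\<^bsub>V\<^esub> (\<ominus>\<^bsub>V\<^esub> w)"
      using car by (metis M.a_closed M.a_inv_closed M.add.inv_solve_right)
    then have "\<ominus>\<^bsub>V\<^esub> u' \<oplus>\<^bsub>V\<^esub> u \<in> U \<inter> W"
      using SU(5)[OF SU(7)[OF that(2)] that(1)] SW(5)[OF that(4) SW(7)[OF that(3)]] by simp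
    then have "\<ominus>\<^bsub>V\<^esub> u' \<oplus>\<^bsub>V\<^esub> u = \<zero>\<^bsub>V\<^esub>" using UW(1) by blast
    then show ?thesis using car by (metis M.a_comm M.a_inv_closed M.minus_equality M.minus_minus)
  qed
  define e where "e v = (THE u. u \<in> U \<and> (\<exists>w\<in>W. v = u \<oplus>\<^bsub>V\<^esub> w))" for v
  have e: "e (u \<oplus>\<^bsub>V\<^esub> w) = u" if "u \<in> U" "w \<in> W" for u w
    unfolding e_def using that uniq by (intro the_equality) blast+
  have ex: "\<exists>u\<in>U. \<exists>w\<in>W. v = u \<oplus>\<^bsub>V\<^esub> w" if "v \<in> carrier V" for v
    using that UW(2) unfolding set_sum_def by blast
  have lin: "linear_operator F V e"
  proof unfold_locales
    show "e v \<in> carrier V" if "v \<in> carrier V" for v using ex[OF that] e UV by auto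
    show "e (v \<oplus>\<^bsub>V\<^esub> w) = e v \<oplus>\<^bsub>V\<^esub> e w" if vw: "v \<in> carrier V" "w \<in> carrier V" for v w
    proof -
      obtain a b where ab: "a \<in> U" "b \<in> W" "v = a \<oplus>\<^bsub>V\<^esub> b" using ex vw(1) by blast
      obtain c d where cd: "c \<in> U" "d \<in> W" "w = c \<oplus>\<^bsub>V\<^esub> d" using ex vw(2) by blast
      have "v \<oplus>\<^bsub>V\<^esub> w = (a \<oplus>\<^bsub>V\<^esub> c) \<oplus>\<^bsub>V\<^esub> (b \<oplus>\<^bsub>V\<^esub> d)" using ab cd UV by (simp add: M.a_ac)
      then show ?thesis using ab cd e SU(5) SW(5) by simp
    qed
    show "e (a \<odot>\<^bsub>V\<^esub> v) = a \<odot>\<^bsub>V\<^esub> e v" if a: "a \<in> carrier F" "v \<in> carrier V" for a v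
    proof -
      obtain b c where bc: "b \<in> U" "c \<in> W" "v = b \<oplus>\<^bsub>V\<^esub> c" using ex a(2) by blast
      then have "a \<odot>\<^bsub>V\<^esub> v = a \<odot>\<^bsub>V\<^esub> b \<oplus>\<^bsub>V\<^esub> a \<odot>\<^bsub>V\<^esub> c" using UV a(1) by (simp add: smult_r_distr)
      then show ?thesis using bc e SU(6) SW(6) a(1) by simp
    qed
  qed
  have comm: "e (P (int t * k) v) = P (int t * k) (e v)" if v: "v \<in> carrier V" for k v
  proof -
    obtain b c where bc: "b \<in> U" "c \<in> W" "v = b \<oplus>\<^bsub>V\<^esub> c" using ex v by blast
    then have "P (int t * k) v = P (int t * k) b \<oplus>\<^bsub>V\<^esub> P (int t * k) c" using UV by (simp add: P_add)
    then show ?thesis using bc e SU(2) SW(2) by simp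
  qed
  have "\<exists>x\<in>carrier V. P (- 1) (e (P 1 x)) \<noteq> e x"
  proof (rule ccontr)
    assume "\<not> ?thesis"
    then have inv: "P (- 1) (e (P 1 x)) = e x" if "x \<in> carrier V" for x using that by blast
    have ecl: "e v \<in> carrier V" if "v \<in> carrier V" for v using ex[OF that] e UV by auto
    have ker: "w \<in> W \<longleftrightarrow> w \<in> carrier V \<and> e w = \<zero>\<^bsub>V\<^esub>" for w
    proof
      assume "w \<in> W"
      then show "w \<in> carrier V \<and> e w = \<zero>\<^bsub>V\<^esub>" using e[OF SU(4), of w] UV by simp
    next
      assume w: "w \<in> carrier V \<and> e w = \<zero>\<^bsub>V\<^esub>"
      then obtain b c where "b \<in> U" "c \<in> W" "w = b \<oplus>\<^bsub>V\<^esub> c" using ex by blast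
      then show "w \<in> W" using e w UV by simp
    qed
    have "stable 1 W"
    proof (rule stableI)
      show "subspace F W V" by (rule SW(1))
      fix x assume x: "x \<in> W"
      then have xV: "x \<in> carrier V" "e x = \<zero>\<^bsub>V\<^esub>" using ker by auto
      then have "e (P 1 x) = \<zero>\<^bsub>V\<^esub>" using inv[of x] P_eq_zero[of "e (P 1 x)" "-1"] ecl by simp
      then show "P (int 1) x \<in> W" using ker xV by simp
      have "P (- 1) (e x) = e (P (- 1) x)"
        using inv[of "P (- 1) x"] xV(1) P_neg(1)[of x 1] by simp
      then have "e (P (- 1) x) = \<zero>\<^bsub>V\<^esub>" using xV(2) by simp
      then show "P (- int 1) x \<in> W" using ker xV by simp
    qed
    then have "W = carrier V" using irreducible nz(2) by blast
    then show False using UW(1) SU(3,4) nz(1) by blast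
  qed
  then show ?thesis using that[OF lin] comm by blast
qed

end

section \<open>Conjugation on endomorphisms\<close>

lemma (in vectorspace) minus_eq_zero_iff:
  assumes "x \<in> carrier V" "y \<in> carrier V"
  shows "x \<ominus>\<^bsub>V\<^esub> y = \<zero>\<^bsub>V\<^esub> \<longleftrightarrow> x = y"
proof
  assume "x \<ominus>\<^bsub>V\<^esub> y = \<zero>\<^bsub>V\<^esub>"
  then have "(x \<oplus>\<^bsub>V\<^esub> \<ominus>\<^bsub>V\<^esub> y) \<oplus>\<^bsub>V\<^esub> y = y" using assms by (simp add: M.minus_eq)
  then show "x = y" using assms by (simp add: M.a_assoc M.l_neg)
qed (use assms in \<open>simp add: M.minus_eq M.r_neg\<close>)

context semilinear_action
begin

text \<open>Constants are fixed by every power of the automorphism, so each \<open>P i\<close> is linear over them.\<close>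

lemma constants_smult_P:
  "a \<in> carrier constants \<Longrightarrow> x \<in> carrier V \<Longrightarrow> P i (a \<odot>\<^bsub>V\<^esub> x) = a \<odot>\<^bsub>V\<^esub> P i x"
proof -
  assume a: "a \<in> carrier constants" and x: "x \<in> carrier V"
  have aF: "a \<in> carrier F" "\<sigma> 1 a = a" using a by auto
  have nat: "\<sigma> (int n) a = a" for n
  proof (induction n)
    case (Suc n)
    have "\<sigma> (int (Suc n)) a = \<sigma> 1 (\<sigma> (int n) a)" using aF by (simp add: sigma_sigma)
    then show ?case using Suc aF by simp
  qed (use aF in \<open>simp add: sigma_0\<close>)
  have "\<sigma> i a = a"
  proof (cases "0 \<le> i")
    case True
    then show ?thesis using nat[of "nat i"] by simp
  next
    case False
    then have "\<sigma> (- i) a = a" using nat[of "nat (- i)"] by simp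
    then show ?thesis using sigma_neg[OF aF(1), of i] by simp
  qed
  then show ?thesis using P_smult[OF aF(1) x, of i] by simp
qed

text \<open>The endomorphisms over \<open>D\<^sub>t\<close>. Functions are kept undefined outside the carrier so that two of them
  are equal when they agree on it.\<close>

definition endo_space :: "nat \<Rightarrow> ('a, 'c \<Rightarrow> 'c) module" where
  "endo_space t = \<lparr>carrier = {e \<in> carrier V \<rightarrow>\<^sub>E carrier V. linear_operator F V e \<and>
       (\<forall>x\<in>carrier V. \<forall>k. e (P (int t * k) x) = P (int t * k) (e x))},
     monoid.mult = undefined, monoid.one = undefined,
     ring.zero = (\<lambda>x\<in>carrier V. \<zero>\<^bsub>V\<^esub>),
     ring.add = (\<lambda>e f. \<lambda>x\<in>carrier V. e x \<oplus>\<^bsub>V\<^esub> f x),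
     smult = (\<lambda>a e. \<lambda>x\<in>carrier V. a \<odot>\<^bsub>V\<^esub> e x)\<rparr>"

lemma endo_space_simps [simp]:
  "\<zero>\<^bsub>endo_space t\<^esub> = (\<lambda>x\<in>carrier V. \<zero>\<^bsub>V\<^esub>)"
  "e \<oplus>\<^bsub>endo_space t\<^esub> f = (\<lambda>x\<in>carrier V. e x \<oplus>\<^bsub>V\<^esub> f x)"
  "a \<odot>\<^bsub>endo_space t\<^esub> e = (\<lambda>x\<in>carrier V. a \<odot>\<^bsub>V\<^esub> e x)"
  by (simp_all add: endo_space_def)

lemma endo_spaceI:
  assumes "e \<in> extensional (carrier V)" "\<And>x. x \<in> carrier V \<Longrightarrow> e x \<in> carrier V"
    "\<And>x y. x \<in> carrier V \<Longrightarrow> y \<in> carrier V \<Longrightarrow> e (x \<oplus>\<^bsub>V\<^esub> y) = e x \<oplus>\<^bsub>V\<^esub> e y"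
    "\<And>a x. a \<in> carrier F \<Longrightarrow> x \<in> carrier V \<Longrightarrow> e (a \<odot>\<^bsub>V\<^esub> x) = a \<odot>\<^bsub>V\<^esub> e x"
    "\<And>x k. x \<in> carrier V \<Longrightarrow> e (P (int t * k) x) = P (int t * k) (e x)"
  shows "e \<in> carrier (endo_space t)"
proof -
  have "linear_operator F V e" by unfold_locales (use assms in auto)
  then show ?thesis using assms by (auto simp: endo_space_def PiE_def)
qed

lemma endo_spaceD:
  assumes "e \<in> carrier (endo_space t)"
  shows "e \<in> extensional (carrier V)" "x \<in> carrier V \<Longrightarrow> e x \<in> carrier V"
    "x \<in> carrier V \<Longrightarrow> y \<in> carrier V \<Longrightarrow> e (x \<oplus>\<^bsub>V\<^esub> y) = e x \<oplus>\<^bsub>V\<^esub> e y"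
    "a \<in> carrier F \<Longrightarrow> x \<in> carrier V \<Longrightarrow> e (a \<odot>\<^bsub>V\<^esub> x) = a \<odot>\<^bsub>V\<^esub> e x"
    "x \<in> carrier V \<Longrightarrow> e (P (int t * k) x) = P (int t * k) (e x)"
    "linear_operator F V e"
proof -
  show lin: "linear_operator F V e" using assms by (simp add: endo_space_def)
  interpret linear_operator F V e by (rule lin)
  show "x \<in> carrier V \<Longrightarrow> e x \<in> carrier V"
    "x \<in> carrier V \<Longrightarrow> y \<in> carrier V \<Longrightarrow> e (x \<oplus>\<^bsub>V\<^esub> y) = e x \<oplus>\<^bsub>V\<^esub> e y"
    "a \<in> carrier F \<Longrightarrow> x \<in> carrier V \<Longrightarrow> e (a \<odot>\<^bsub>V\<^esub> x) = a \<odot>\<^bsub>V\<^esub> e x"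
    by (simp_all add: T_add T_smult)
  show "e \<in> extensional (carrier V)" using assms by (simp add: endo_space_def PiE_def)
  show "x \<in> carrier V \<Longrightarrow> e (P (int t * k) x) = P (int t * k) (e x)"
    using assms by (simp add: endo_space_def)
qed

lemma endo_space_vectorspace:
  assumes "field constants"
  shows "vectorspace constants (endo_space t)"
proof (rule vs_criteria[OF assms])
  let ?E = "endo_space t"
  note D = endo_spaceD
  show z: "\<zero>\<^bsub>?E\<^esub> \<in> carrier ?E"
    by (rule endo_spaceI) auto
  have add: "e \<oplus>\<^bsub>?E\<^esub> f \<in> carrier ?E" if "e \<in> carrier ?E" "f \<in> carrier ?E" for e f
    by (rule endo_spaceI)
      (use that in \<open>auto simp: D(2-5)[OF that(1)] D(2-5)[OF that(2)] M.a_ac smult_r_distr P_add\<close>)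
  then show "\<forall>v w. v \<in> carrier ?E \<and> w \<in> carrier ?E \<longrightarrow> v \<oplus>\<^bsub>?E\<^esub> w \<in> carrier ?E" by blast
  have smult: "c \<odot>\<^bsub>?E\<^esub> e \<in> carrier ?E" if c: "c \<in> carrier constants" and e: "e \<in> carrier ?E" for c e
    by (rule endo_spaceI)
      (use c constants_smult_P[OF c] in \<open>auto simp: D(2-5)[OF e] smult_r_distr smult_assoc1[symmetric] R.m_comm\<close>)
  then show "\<forall>c v. c \<in> carrier constants \<and> v \<in> carrier ?E \<longrightarrow> c \<odot>\<^bsub>?E\<^esub> v \<in> carrier ?E" by blast
  show "\<forall>v\<in>carrier ?E. \<exists>neg_v\<in>carrier ?E. v \<oplus>\<^bsub>?E\<^esub> neg_v = \<zero>\<^bsub>?E\<^esub>"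
  proof
    fix e assume e: "e \<in> carrier ?E"
    have m1: "\<ominus>\<^bsub>F\<^esub> \<one>\<^bsub>F\<^esub> \<in> carrier constants"
      using ring_hom_one[OF sigma_hom[of 1]] ring_hom_zero[OF sigma_hom R.ring_axioms R.ring_axioms, of 1]
        ring_hom_add[OF sigma_hom[of 1], of "\<one>\<^bsub>F\<^esub>" "\<ominus>\<^bsub>F\<^esub> \<one>\<^bsub>F\<^esub>"]
      by (auto simp: R.r_neg intro!: R.minus_equality[symmetric, of _ "\<one>\<^bsub>F\<^esub>"] simp: R.a_comm)
    have "e \<oplus>\<^bsub>?E\<^esub> ((\<ominus>\<^bsub>F\<^esub> \<one>\<^bsub>F\<^esub>) \<odot>\<^bsub>?E\<^esub> e) = \<zero>\<^bsub>?E\<^esub>"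
      by (rule ext) (simp add: D(2)[OF e] smult_l_minus M.r_neg)
    then show "\<exists>neg_v\<in>carrier ?E. e \<oplus>\<^bsub>?E\<^esub> neg_v = \<zero>\<^bsub>?E\<^esub>" using smult[OF m1 e] by blast
  qed
  show "\<forall>v w. v \<in> carrier ?E \<and> w \<in> carrier ?E \<longrightarrow> v \<oplus>\<^bsub>?E\<^esub> w = w \<oplus>\<^bsub>?E\<^esub> v"
    by (auto simp: D(2) M.a_comm intro!: restrict_ext)
  show "\<forall>v w x. v \<in> carrier ?E \<and> w \<in> carrier ?E \<and> x \<in> carrier ?E \<longrightarrow>
      (v \<oplus>\<^bsub>?E\<^esub> w) \<oplus>\<^bsub>?E\<^esub> x = v \<oplus>\<^bsub>?E\<^esub> (w \<oplus>\<^bsub>?E\<^esub> x)"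
    by (auto simp: D(2) M.a_assoc intro!: restrict_ext)
  show "\<forall>v\<in>carrier ?E. v \<oplus>\<^bsub>?E\<^esub> \<zero>\<^bsub>?E\<^esub> = v"
  proof
    fix e assume e: "e \<in> carrier ?E"
    show "e \<oplus>\<^bsub>?E\<^esub> \<zero>\<^bsub>?E\<^esub> = e"
      by (rule extensionalityI[of _ "carrier V"]) (auto simp: D(1,2)[OF e])
  qed
  show "\<forall>v\<in>carrier ?E. \<one>\<^bsub>constants\<^esub> \<odot>\<^bsub>?E\<^esub> v = v"
  proof
    fix e assume e: "e \<in> carrier ?E"
    show "\<one>\<^bsub>constants\<^esub> \<odot>\<^bsub>?E\<^esub> e = e"
      by (rule extensionalityI[of _ "carrier V"]) (auto simp: D(1,2)[OF e])
  qed
qed (auto simp: endo_spaceD(2) smult_l_distr smult_r_distr smult_assoc1 intro!: restrict_ext)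

text \<open>Conjugation with this orientation makes an eigenvector \<open>e\<close> with eigenvalue \<open>c\<close> satisfy \<open>e \<Phi> = c \<Phi> e\<close>, so
  \<open>\<Phi>\<close> multiplies eigenvalues of \<open>e\<close> by \<open>c\<close> itself and not by its inverse.\<close>

definition conj_op :: "('c \<Rightarrow> 'c) \<Rightarrow> 'c \<Rightarrow> 'c" where
  "conj_op e = (\<lambda>x\<in>carrier V. P (- 1) (e (P 1 x)))"

lemma conj_op_closed:
  assumes "e \<in> carrier (endo_space t)"
  shows "conj_op e \<in> carrier (endo_space t)"
proof (rule endo_spaceI)
  note D = endo_spaceD[OF assms]
  show "conj_op e (a \<odot>\<^bsub>V\<^esub> x) = a \<odot>\<^bsub>V\<^esub> conj_op e x" if "a \<in> carrier F" "x \<in> carrier V" for a x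
  proof -
    have "conj_op e (a \<odot>\<^bsub>V\<^esub> x) = \<sigma> (- 1) (\<sigma> 1 a) \<odot>\<^bsub>V\<^esub> P (- 1) (e (P 1 x))"
      using that by (simp add: conj_op_def P_smult D(2,4))
    then show ?thesis using that by (simp add: conj_op_def sigma_sigma sigma_0)
  qed
  show "conj_op e (P (int t * k) x) = P (int t * k) (conj_op e x)" if "x \<in> carrier V" for x k
  proof -
    have "P 1 (P (int t * k) x) = P (int t * k) (P 1 x)"
      using that by (simp add: P_P add.commute)
    then have "e (P 1 (P (int t * k) x)) = P (int t * k) (e (P 1 x))"
      using that D(5) by simp
    then have "conj_op e (P (int t * k) x) = P (- 1) (P (int t * k) (e (P 1 x)))"
      using that by (simp add: conj_op_def)
    also have "\<dots> = P (int t * k) (P (- 1) (e (P 1 x)))"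
      using that D(2) by (simp add: P_P add.commute)
    finally show ?thesis using that by (simp add: conj_op_def)
  qed
qed (auto simp: conj_op_def P_add endo_spaceD[OF assms])

lemma conj_op_linear:
  assumes "field constants"
  shows "linear_operator constants (endo_space t) conj_op"
proof -
  interpret E: vectorspace constants "endo_space t" using endo_space_vectorspace assms by blast
  show ?thesis
  proof unfold_locales
    fix a e f assume e: "e \<in> carrier (endo_space t)"
    note D = endo_spaceD(2)[OF e]
    show "conj_op e \<in> carrier (endo_space t)" using conj_op_closed e .
    show "conj_op (e \<oplus>\<^bsub>endo_space t\<^esub> f) = conj_op e \<oplus>\<^bsub>endo_space t\<^esub> conj_op f" if f: "f \<in> carrier (endo_space t)"
      by (rule ext) (simp add: conj_op_def P_add D endo_spaceD(2)[OF f])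
    show "conj_op (a \<odot>\<^bsub>endo_space t\<^esub> e) = a \<odot>\<^bsub>endo_space t\<^esub> conj_op e" if a: "a \<in> carrier constants"
      by (rule ext) (simp add: conj_op_def D constants_smult_P[OF a])
  qed
qed

lemma conj_op_funpow:
  assumes "e \<in> carrier (endo_space t)"
  shows "(conj_op ^^ n) e \<in> carrier (endo_space t)"
    "x \<in> carrier V \<Longrightarrow> (conj_op ^^ n) e x = P (- int n) (e (P (int n) x))"
proof -
  show cl: "(conj_op ^^ n) e \<in> carrier (endo_space t)" for n
    by (induction n) (use assms conj_op_closed in auto)
  show "x \<in> carrier V \<Longrightarrow> (conj_op ^^ n) e x = P (- int n) (e (P (int n) x))"
  proof (induction n arbitrary: x)
    case 0
    then show ?case using endo_spaceD(2)[OF assms] by (simp add: P_0)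
  next
    case (Suc n)
    then show ?case using endo_spaceD(2)[OF assms] by (simp add: conj_op_def P_P add.commute)
  qed
qed

lemma conj_op_periodic:
  assumes "e \<in> carrier (endo_space t)"
  shows "(conj_op ^^ t) e = e"
proof (rule extensionalityI)
  show "(conj_op ^^ t) e \<in> extensional (carrier V)" "e \<in> extensional (carrier V)"
    using endo_spaceD(1) conj_op_funpow(1) assms by blast+
  show "(conj_op ^^ t) e x = e x" if "x \<in> carrier V" for x
    using that conj_op_funpow(2)[OF assms that] endo_spaceD(2,5)[OF assms, of x] endo_spaceD(5)[OF assms that, of 1]
    by simp
qed

end

lemma (in semilinear_action) twist_power:
  assumes "field constants" "c \<in> carrier constants" "\<And>x. x \<in> carrier V \<Longrightarrow> e x \<in> carrier V"
    and "\<And>x. x \<in> carrier V \<Longrightarrow> e (P 1 x) = c \<odot>\<^bsub>V\<^esub> P 1 (e x)"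
    and x: "x \<in> carrier V"
  shows "e (P (int n) x) = (c [^]\<^bsub>F\<^esub> n) \<odot>\<^bsub>V\<^esub> P (int n) (e x)"
proof (induction n)
  case (Suc n)
  interpret C: field constants by fact
  have cF: "c \<in> carrier F" using assms(2) by simp
  have "e (P (int (Suc n)) x) = e (P 1 (P (int n) x))" using x by (simp add: P_P)
  also have "\<dots> = c \<odot>\<^bsub>V\<^esub> P 1 ((c [^]\<^bsub>F\<^esub> n) \<odot>\<^bsub>V\<^esub> P (int n) (e x))" using assms(4) Suc x by simp
  also have "P 1 ((c [^]\<^bsub>F\<^esub> n) \<odot>\<^bsub>V\<^esub> P (int n) (e x)) = (c [^]\<^bsub>F\<^esub> n) \<odot>\<^bsub>V\<^esub> P (int (Suc n)) (e x)"
  proof -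
    have "c [^]\<^bsub>F\<^esub> n \<in> carrier constants"
      using C.nat_pow_closed[OF assms(2), of n] nat_pow_consistent[of c n "carrier constants"] by simp
    then show ?thesis using constants_smult_P assms(3) x by (simp add: P_P)
  qed
  also have "c \<odot>\<^bsub>V\<^esub> \<dots> = (c [^]\<^bsub>F\<^esub> Suc n) \<odot>\<^bsub>V\<^esub> P (int (Suc n)) (e x)"
    using cF assms(3) x by (simp add: smult_assoc1[symmetric] R.m_comm)
  finally show ?case .
qed (use x assms(3) in \<open>simp add: P_0\<close>)

text \<open>Conjugation \<open>\<gamma>\<close> has \<open>\<gamma>\<^sup>t = 1\<close>, so \<open>f = \<pi> - \<gamma>(\<pi>)\<close> is killed by \<open>1 + \<gamma> + \<dots> + \<gamma>\<^sup>t\<^sup>-\<^sup>1\<close>, and it is nonzero if \<open>\<pi>\<close> is not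
  invariant. The resulting eigenvalue is a root of \<open>1 + X + \<dots> + X\<^sup>t\<^sup>-\<^sup>1\<close>. At \<open>1\<close> that polynomial has
  the value \<open>t\<close>, which is not zero in characteristic zero.\<close>

lemma (in irreducible_action) twisted_endo:
  assumes "algebraically_closed constants" "characteristic_zero constants"
    and "stable t U0" "U0 \<noteq> {\<zero>\<^bsub>V\<^esub>}" "U0 \<noteq> carrier V" "0 < t"
  obtains e c where "linear_operator F V e" "c \<in> carrier constants" "c \<noteq> \<one>\<^bsub>F\<^esub>" "c [^]\<^bsub>F\<^esub> t = \<one>\<^bsub>F\<^esub>"
    "\<exists>x\<in>carrier V. e x \<noteq> \<zero>\<^bsub>V\<^esub>"
    "\<forall>x\<in>carrier V. e (P 1 x) = c \<odot>\<^bsub>V\<^esub> P 1 (e x)"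
proof -
  interpret C: algebraically_closed constants by fact
  let ?E = "endo_space t"
  interpret E: linear_operator constants ?E conj_op
    using conj_op_linear C.field_axioms by blast
  obtain e0 x0 where lin0: "linear_operator F V e0"
    and comm0: "\<forall>x\<in>carrier V. \<forall>k. e0 (P (int t * k) x) = P (int t * k) (e0 x)"
    and e0: "x0 \<in> carrier V" "P (- 1) (e0 (P 1 x0)) \<noteq> e0 x0"
    using noninvariant_endo[OF assms(3-6)] by blast
  interpret e0: linear_operator F V e0 by (rule lin0)
  define e1 where "e1 = restrict e0 (carrier V)"
  have e1: "e1 \<in> carrier ?E"
    by (rule endo_spaceI) (use comm0 in \<open>auto simp: e1_def e0.T_add e0.T_smult\<close>)
  define f where "f = e1 \<ominus>\<^bsub>?E\<^esub> conj_op e1"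
  have ce1: "conj_op e1 \<in> carrier ?E" using conj_op_closed e1 .
  have fE: "f \<in> carrier ?E" unfolding f_def using e1 ce1 by simp
  have "conj_op e1 x0 \<noteq> e1 x0" using e0 by (simp add: conj_op_def e1_def)
  then have "conj_op e1 \<noteq> e1" by metis
  then have f0: "f \<noteq> \<zero>\<^bsub>?E\<^esub>" unfolding f_def E.minus_eq_zero_iff[OF e1 ce1] by (rule not_sym)
  have "E.poly_op (replicate t \<one>\<^bsub>constants\<^esub>) f = e1 \<ominus>\<^bsub>?E\<^esub> (conj_op ^^ t) e1"
    unfolding f_def using E.poly_op_replicate_one[OF e1] .
  then have ann: "E.poly_op (replicate t \<one>\<^bsub>constants\<^esub>) f = \<zero>\<^bsub>?E\<^esub>"
    using E.minus_eq_zero_iff[OF e1 e1] unfolding conj_op_periodic[OF e1] by (elim trans) simp_all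
  obtain c e where c: "c \<in> carrier constants" "E.horner (replicate t \<one>\<^bsub>constants\<^esub>) c = \<zero>\<^bsub>constants\<^esub>"
      and e: "e \<in> carrier ?E" "e \<noteq> \<zero>\<^bsub>?E\<^esub>" "conj_op e = c \<odot>\<^bsub>?E\<^esub> e"
  proof -
    have "set (replicate t \<one>\<^bsub>constants\<^esub>) \<subseteq> carrier constants"
      using C.one_closed by (simp add: set_replicate_conv_if)
    moreover have "replicate t \<one>\<^bsub>constants\<^esub> \<noteq> []" using assms(6) by simp
    moreover have "last (replicate t \<one>\<^bsub>constants\<^esub>) \<noteq> \<zero>\<^bsub>constants\<^esub>"
      using C.one_not_zero assms(6) by (simp add: last_replicate)
    ultimately have "\<exists>c\<in>carrier constants. \<exists>e\<in>carrier ?E. e \<noteq> \<zero>\<^bsub>?E\<^esub> \<and> conj_op e = c \<odot>\<^bsub>?E\<^esub> e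
        \<and> E.horner (replicate t \<one>\<^bsub>constants\<^esub>) c = \<zero>\<^bsub>constants\<^esub>"
      by (rule E.eigenvector_of_annihilator[OF assms(1) _ _ _ fE f0 ann])
    then show ?thesis by (elim bexE conjE) (rule that)
  qed
  note D = endo_spaceD[OF e(1)]
  have cF: "c \<in> carrier F" using c by simp
  have c1: "c \<noteq> \<one>\<^bsub>F\<^esub>"
  proof
    assume "c = \<one>\<^bsub>F\<^esub>"
    then have "[t] \<cdot>\<^bsub>constants\<^esub> \<one>\<^bsub>constants\<^esub> = \<zero>\<^bsub>constants\<^esub>"
      using c(2) E.horner_replicate_one[of t] by simp
    then show False using assms(2,6) by (auto simp: characteristic_zero_def)
  qed
  have tw: "e (P 1 x) = c \<odot>\<^bsub>V\<^esub> P 1 (e x)" if x: "x \<in> carrier V" for x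
  proof -
    have "P (- 1) (e (P 1 x)) = c \<odot>\<^bsub>V\<^esub> e x"
      using fun_cong[OF e(3), of x] x by (simp add: conj_op_def)
    then have "e (P 1 x) = P 1 (c \<odot>\<^bsub>V\<^esub> e x)"
      using P_neg(1)[of "e (P 1 x)" 1] x D(2) by simp
    then show ?thesis using constants_smult_P[OF c(1)] D(2) x by simp
  qed
  obtain x1 where x1: "x1 \<in> carrier V" "e x1 \<noteq> \<zero>\<^bsub>V\<^esub>"
  proof -
    have "\<exists>x\<in>carrier V. e x \<noteq> \<zero>\<^bsub>V\<^esub>"
    proof (rule ccontr)
      assume "\<not> ?thesis"
      then have "e = \<zero>\<^bsub>?E\<^esub>" using D(1) by (intro extensionalityI[of _ "carrier V"]) auto
      then show False using e(2) by blast
    qed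
    then show ?thesis using that by blast
  qed
  have pw: "e (P (int n) x) = (c [^]\<^bsub>F\<^esub> n) \<odot>\<^bsub>V\<^esub> P (int n) (e x)" if x: "x \<in> carrier V" for n x
    by (intro twist_power C.field_axioms c(1) D(2) tw x)
  have "c [^]\<^bsub>F\<^esub> t = \<one>\<^bsub>F\<^esub>"
  proof -
    define y where "y = P (int t) (e x1)"
    have y: "y \<in> carrier V" "y \<noteq> \<zero>\<^bsub>V\<^esub>" using x1 D(2) P_eq_zero[of "e x1" "int t"] unfolding y_def by auto
    have "y = (c [^]\<^bsub>F\<^esub> t) \<odot>\<^bsub>V\<^esub> y" using pw[OF x1(1), of t] D(5)[OF x1(1), of 1] unfolding y_def by simp
    then have "(c [^]\<^bsub>F\<^esub> t \<ominus>\<^bsub>F\<^esub> \<one>\<^bsub>F\<^esub>) \<odot>\<^bsub>V\<^esub> y = \<zero>\<^bsub>V\<^esub>"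
      using cF y by (simp add: R.minus_eq smult_l_distr smult_l_minus M.r_neg)
    then have "c [^]\<^bsub>F\<^esub> t \<ominus>\<^bsub>F\<^esub> \<one>\<^bsub>F\<^esub> = \<zero>\<^bsub>F\<^esub>"
      using e0.smult_left_cancel_zero[of "c [^]\<^bsub>F\<^esub> t \<ominus>\<^bsub>F\<^esub> \<one>\<^bsub>F\<^esub>" y] y cF by auto
    then show ?thesis using cF by (simp add: R.r_right_minus_eq)
  qed
  moreover have "\<exists>x\<in>carrier V. e x \<noteq> \<zero>\<^bsub>V\<^esub>" using x1 by blast
  ultimately show ?thesis using that[OF D(6) c(1) c1] tw by blast
qed

section \<open>Decomposition into eigenspaces\<close>

context semilinear_action
begin

lemma constants_vectorspace:
  assumes "field constants"
  shows "vectorspace constants V"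
  by (rule vs_criteria[OF assms])
    (auto simp: M.a_ac smult_l_distr smult_r_distr smult_assoc1 intro: M.r_neg bexI[of _ "\<ominus>\<^bsub>V\<^esub> v" for v])

lemma constants_linear_operator:
  assumes "field constants" "linear_operator F V T"
  shows "linear_operator constants V T"
proof -
  interpret C: vectorspace constants V using constants_vectorspace assms(1) .
  interpret T: linear_operator F V T by fact
  show ?thesis by unfold_locales (auto simp: T.T_add T.T_smult)
qed

text \<open>Schur's lemma in the form needed here: the annihilating polynomial of an operator that commutes with the
  action can be chosen with constant coefficients, and then it has a root among the constants.\<close>

lemma commuting_eigenvector:
  assumes "algebraically_closed constants" "fin_dim" "carrier V \<noteq> {\<zero>\<^bsub>V\<^esub>}"
    and "linear_operator F V h" "\<And>x. x \<in> carrier V \<Longrightarrow> P 1 (h x) = h (P 1 x)"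
  shows "\<exists>a\<in>carrier constants. \<exists>w\<in>carrier V. w \<noteq> \<zero>\<^bsub>V\<^esub> \<and> h w = a \<odot>\<^bsub>V\<^esub> w"
proof -
  interpret C: algebraically_closed constants by fact
  interpret h: linear_operator F V h by fact
  interpret hC: linear_operator constants V h
    using constants_linear_operator C.field_axioms assms(4) .
  have surj: "P 1 ` carrier V = carrier V"
  proof
    show "carrier V \<subseteq> P 1 ` carrier V"
      using P_neg(1)[of _ 1] by (metis P_closed imageI subsetI)
  qed auto
  obtain p where p: "set p \<subseteq> {a \<in> carrier F. \<sigma> 1 a = a}"
      "\<And>v. v \<in> carrier V \<Longrightarrow> (h ^^ length p) v = h.poly_op p v"
    using h.invariant_annihilator[OF assms(2) sigma_hom surj P_add P_smult assms(5)] by blast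
  have pC: "set p \<subseteq> carrier constants" using p(1) by simp
  define m where "m = map (\<lambda>b. (\<ominus>\<^bsub>constants\<^esub> \<one>\<^bsub>constants\<^esub>) \<otimes>\<^bsub>constants\<^esub> b) p"
  have mC: "set m \<subseteq> carrier constants" "length m = length p"
    unfolding m_def using pC C.m_closed[OF C.a_inv_closed[OF C.one_closed]] by auto
  have sum: "set (m @ [\<one>\<^bsub>constants\<^esub>]) \<subseteq> carrier constants" using mC(1) C.one_closed by simp
  obtain v where v: "v \<in> carrier V" "v \<noteq> \<zero>\<^bsub>V\<^esub>" using assms(3) by blast
  have "hC.poly_op m v = \<ominus>\<^bsub>V\<^esub> hC.poly_op p v"
    unfolding m_def hC.poly_op_map_mult[OF pC C.a_inv_closed[OF C.one_closed] v(1)]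
    using hC.smult_l_minus[OF C.one_closed] hC.smult_one hC.poly_op_closed[OF pC v(1)] by simp
  then have "hC.poly_op (m @ [\<one>\<^bsub>constants\<^esub>]) v = \<ominus>\<^bsub>V\<^esub> hC.poly_op p v \<oplus>\<^bsub>V\<^esub> (h ^^ length p) v"
    using hC.poly_op_append[OF mC(1) C.one_closed v(1)] v mC(2) by simp
  also have "\<dots> = \<zero>\<^bsub>V\<^esub>" using p(2)[OF v(1)] hC.poly_op_closed[OF pC v(1)] by (simp add: M.l_neg)
  finally have ann: "hC.poly_op (m @ [\<one>\<^bsub>constants\<^esub>]) v = \<zero>\<^bsub>V\<^esub>" .
  have "last (m @ [\<one>\<^bsub>constants\<^esub>]) \<noteq> \<zero>\<^bsub>constants\<^esub>" using C.one_not_zero by simp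
  then show ?thesis
    using hC.eigenvector_of_annihilator[OF assms(1) sum _ _ v ann] by blast
qed

text \<open>The power \<open>e\<^sup>t\<close> commutes with \<open>P 1\<close> because \<open>c\<^sup>t = 1\<close>. If \<open>b\<close> is an eigenvalue of \<open>e\<^sup>t\<close>, then \<open>X\<^sup>t - b\<close>
  evaluated at \<open>e\<close> kills a nonzero vector.\<close>

lemma twisted_eigenvector:
  fixes t :: nat
  assumes "algebraically_closed constants" "fin_dim" "carrier V \<noteq> {\<zero>\<^bsub>V\<^esub>}"
    and "linear_operator F V e" "c \<in> carrier constants" "c [^]\<^bsub>F\<^esub> t = \<one>\<^bsub>F\<^esub>" "0 < t"
    and tw: "\<And>x. x \<in> carrier V \<Longrightarrow> e (P 1 x) = c \<odot>\<^bsub>V\<^esub> P 1 (e x)"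
  shows "\<exists>a\<in>carrier constants. \<exists>w\<in>carrier V. w \<noteq> \<zero>\<^bsub>V\<^esub> \<and> e w = a \<odot>\<^bsub>V\<^esub> w"
proof -
  interpret C: algebraically_closed constants by fact
  interpret e: linear_operator F V e by fact
  interpret eC: linear_operator constants V e
    using constants_linear_operator C.field_axioms assms(4) .
  have cF: "c \<in> carrier F" using assms(5) by simp
  have it: "(e ^^ n) (P 1 x) = (c [^]\<^bsub>F\<^esub> n) \<odot>\<^bsub>V\<^esub> P 1 ((e ^^ n) x)" if x: "x \<in> carrier V" for n x
  proof (induction n)
    case (Suc n)
    then have "(e ^^ Suc n) (P 1 x) = (c [^]\<^bsub>F\<^esub> n) \<odot>\<^bsub>V\<^esub> e (P 1 ((e ^^ n) x))"
      using x cF by (simp add: e.T_smult)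
    also have "\<dots> = (c [^]\<^bsub>F\<^esub> Suc n) \<odot>\<^bsub>V\<^esub> P 1 ((e ^^ Suc n) x)"
      using tw[of "(e ^^ n) x"] x cF by (simp add: smult_assoc1)
    finally show ?case .
  qed (use x in simp)
  have "P 1 ((e ^^ t) x) = (e ^^ t) (P 1 x)" if "x \<in> carrier V" for x
    using it[OF that, of t] assms(6) that by simp
  then obtain b w where b: "b \<in> carrier constants" and w: "w \<in> carrier V" "w \<noteq> \<zero>\<^bsub>V\<^esub>" "(e ^^ t) w = b \<odot>\<^bsub>V\<^esub> w"
    using commuting_eigenvector[OF assms(1-3) e.linear_operator_funpow] by blast
  \<comment> \<open>The list \<open>- b # q\<close> represents \<open>X\<^sup>t - b\<close>.\<close>
  define q where "q = replicate (t - 1) \<zero>\<^bsub>constants\<^esub> @ [\<one>\<^bsub>constants\<^esub>]"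
  have mb: "\<ominus>\<^bsub>constants\<^esub> b \<in> carrier constants" using b C.a_inv_closed by blast
  have q: "set (\<ominus>\<^bsub>constants\<^esub> b # q) \<subseteq> carrier constants"
    unfolding q_def using mb C.one_closed C.zero_closed by (auto simp del: carrier_vs_is_self)
  have "e (eC.poly_op q w) = (e ^^ Suc (t - 1)) w"
    unfolding q_def eC.poly_op_monom[OF w(1)] by simp
  then have "eC.poly_op (\<ominus>\<^bsub>constants\<^esub> b # q) w = \<zero>\<^bsub>V\<^esub>"
    using w b assms(7) eC.smult_l_minus[OF b w(1)] by (simp add: M.l_neg)
  moreover have "last (\<ominus>\<^bsub>constants\<^esub> b # q) \<noteq> \<zero>\<^bsub>constants\<^esub>"
    unfolding q_def using C.one_not_zero by simp
  ultimately show ?thesis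
    using eC.eigenvector_of_annihilator[OF assms(1) q _ _ w(1,2)] by blast
qed

text \<open>The space is the direct sum of the first \<open>s\<close> translates of \<open>N\<close>. The summands are indexed by vectors of \<open>N\<close>
  itself, which is how the decomposition is used.\<close>

definition orbit_direct :: "nat \<Rightarrow> 'c set \<Rightarrow> bool" where
  "orbit_direct s N \<longleftrightarrow> orbit_sum s N = carrier V \<and>
    (\<forall>u \<in> {..<s} \<rightarrow> N. \<forall>u' \<in> {..<s} \<rightarrow> N.
      (\<Oplus>\<^bsub>V\<^esub>i\<in>{..<s}. P (int i) (u i)) = (\<Oplus>\<^bsub>V\<^esub>i\<in>{..<s}. P (int i) (u' i)) \<longrightarrow> (\<forall>i<s. u i = u' i))"

lemma orbit_directD:
  assumes "orbit_direct s N" "u \<in> {..<s} \<rightarrow> N" "u' \<in> {..<s} \<rightarrow> N"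
    "(\<Oplus>\<^bsub>V\<^esub>i\<in>{..<s}. P (int i) (u i)) = (\<Oplus>\<^bsub>V\<^esub>i\<in>{..<s}. P (int i) (u' i))" "i < s"
  shows "u i = u' i"
  using assms unfolding orbit_direct_def by blast

text \<open>The translates of a basis of \<open>N\<close> form a basis of the space: they are disjoint, and a linear relation
  between them splits into relations in \<open>N\<close>, with coefficients transported by the automorphism.\<close>

lemma orbit_direct_dim:
  assumes "fin_dim" "stable s N" "orbit_direct s N"
  shows "s dvd dim"
proof -
  note S = stableD[OF assms(2)]
  obtain A where A: "finite A" "A \<subseteq> N" "lin_indpt A" "span A = N"
    using subspace_basis[OF assms(1) S(1)] .
  have AV: "x \<in> carrier V" if "x \<in> A" for x using A(2) S(3) that by auto
  have A0: "x \<noteq> \<zero>\<^bsub>V\<^esub>" if "x \<in> A" for x using vs_zero_lin_dep[OF _ A(3)] AV that by blast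
  define B where "B = (\<Union>i\<in>{..<s}. P (int i) ` A)"
  have inj: "inj_on (P (int i)) A" for i
    by (rule inj_on_inverseI[of _ "P (- int i)"]) (use AV in simp)
  have disj: "P (int i) ` A \<inter> P (int j) ` A = {}" if ij: "i < s" "j < s" "i \<noteq> j" for i j
  proof (rule ccontr)
    assume "P (int i) ` A \<inter> P (int j) ` A \<noteq> {}"
    then obtain x y where xy: "x \<in> A" "y \<in> A" "P (int i) x = P (int j) y" by auto
    have "(if i = i then x else \<zero>\<^bsub>V\<^esub>) = (if j = i then y else \<zero>\<^bsub>V\<^esub>)"
    proof (rule orbit_directD[OF assms(3), of "\<lambda>k. if i = k then x else \<zero>\<^bsub>V\<^esub>" "\<lambda>k. if j = k then y else \<zero>\<^bsub>V\<^esub>" i])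
      show "(\<Oplus>\<^bsub>V\<^esub>k\<in>{..<s}. P (int k) (if i = k then x else \<zero>\<^bsub>V\<^esub>)) =
          (\<Oplus>\<^bsub>V\<^esub>k\<in>{..<s}. P (int k) (if j = k then y else \<zero>\<^bsub>V\<^esub>))"
        using P_as_orbit_sum[OF ij(1) AV[OF xy(1)]] P_as_orbit_sum[OF ij(2) AV[OF xy(2)]] xy(3) by simp
    qed (use xy A(2) S(4) ij in auto)
    then show False using ij(3) A0[OF xy(1)] by simp
  qed
  have finB: "finite B" unfolding B_def using A(1) by simp
  have BV: "B \<subseteq> carrier V" unfolding B_def using AV by auto
  have cardB: "card B = s * card A"
  proof -
    have "card B = (\<Sum>i\<in>{..<s}. card (P (int i) ` A))"
      unfolding B_def using A(1) disj by (intro card_UN_disjoint) auto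
    also have "\<dots> = s * card A" using card_image[OF inj] by simp
    finally show ?thesis .
  qed
  have "lin_indpt B"
  proof (rule finite_lin_indpt2[OF finB BV])
    fix a assume a: "a \<in> B \<rightarrow> carrier F" "lincomb a B = \<zero>\<^bsub>V\<^esub>"
    have aF: "a (P (int i) x) \<in> carrier F" if "i < s" "x \<in> A" for i x
      using a(1) that unfolding B_def by auto
    define u where "u i = lincomb (\<lambda>x. \<sigma> (- int i) (a (P (int i) x))) A" for i
    have coef: "(\<lambda>x. \<sigma> (- int i) (a (P (int i) x))) \<in> A \<rightarrow> carrier F" if "i < s" for i
      using aF that by auto
    have uN: "u i \<in> N" if "i < s" for i
      unfolding u_def A(4)[symmetric] span_def using coef[OF that] A(1) by blast
    have "lincomb a B = (\<Oplus>\<^bsub>V\<^esub>i\<in>{..<s}. \<Oplus>\<^bsub>V\<^esub>y\<in>P (int i) ` A. a y \<odot>\<^bsub>V\<^esub> y)"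
      unfolding lincomb_def B_def
      by (rule M.add.finprod_UN_disjoint) (use A(1) disj aF AV in \<open>auto simp: pairwise_def disjnt_def\<close>)
    also have "\<dots> = (\<Oplus>\<^bsub>V\<^esub>i\<in>{..<s}. P (int i) (u i))"
    proof (intro M.finsum_cong' refl)
      show "(\<lambda>i. P (int i) (u i)) \<in> {..<s} \<rightarrow> carrier V" using uN S(3) by auto
      fix i assume "i \<in> {..<s}"
      then have i: "i < s" by simp
      have "(\<Oplus>\<^bsub>V\<^esub>y\<in>P (int i) ` A. a y \<odot>\<^bsub>V\<^esub> y) = (\<Oplus>\<^bsub>V\<^esub>x\<in>A. a (P (int i) x) \<odot>\<^bsub>V\<^esub> P (int i) x)"
        using aF[OF i] AV by (intro M.finsum_reindex[OF _ inj]) auto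
      also have "\<dots> = (\<Oplus>\<^bsub>V\<^esub>x\<in>A. P (int i) (\<sigma> (- int i) (a (P (int i) x)) \<odot>\<^bsub>V\<^esub> x))"
        using aF[OF i] AV by (intro M.finsum_cong') (auto simp: smult_P)
      also have "\<dots> = P (int i) (u i)"
        unfolding u_def lincomb_def using aF[OF i] AV A(1) by (intro P_finsum[symmetric]) auto
      finally show "(\<Oplus>\<^bsub>V\<^esub>y\<in>P (int i) ` A. a y \<odot>\<^bsub>V\<^esub> y) = P (int i) (u i)" .
    qed
    finally have sum0: "(\<Oplus>\<^bsub>V\<^esub>i\<in>{..<s}. P (int i) (u i)) = \<zero>\<^bsub>V\<^esub>"
      unfolding a(2) by (rule sym)
    have "(\<Oplus>\<^bsub>V\<^esub>i\<in>{..<s}. P (int i) \<zero>\<^bsub>V\<^esub>) = \<zero>\<^bsub>V\<^esub>"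
      by (rule M.add.finprod_one_eqI) simp
    with sum0 have sums: "(\<Oplus>\<^bsub>V\<^esub>i\<in>{..<s}. P (int i) (u i)) = (\<Oplus>\<^bsub>V\<^esub>i\<in>{..<s}. P (int i) \<zero>\<^bsub>V\<^esub>)"
      by (simp only:)
    have u0: "u i = \<zero>\<^bsub>V\<^esub>" if "i < s" for i
      by (rule orbit_directD[OF assms(3) _ _ sums that]) (use uN S(4) in \<open>simp_all add: Pi_iff\<close>)
    show "\<forall>v\<in>B. a v = \<zero>\<^bsub>F\<^esub>"
    proof
      fix v assume "v \<in> B"
      then obtain i x where ix: "i < s" "x \<in> A" "v = P (int i) x" unfolding B_def by auto
      have "\<sigma> (- int i) (a (P (int i) x)) = \<zero>\<^bsub>F\<^esub>"
        using not_lindepD[OF A(3,1) subset_refl coef[OF ix(1)] u0[OF ix(1), unfolded u_def]] ix(2) by auto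
      then have "\<sigma> (int i) \<zero>\<^bsub>F\<^esub> = a v"
        using sigma_neg[OF aF[OF ix(1,2)], of "int i"] ix(3) by simp
      then show "a v = \<zero>\<^bsub>F\<^esub>"
        using ring_hom_zero[OF sigma_hom R.ring_axioms R.ring_axioms] by simp
    qed
  qed
  moreover have "span B = carrier V"
  proof
    show "span B \<subseteq> carrier V" using span_is_subset2 BV by blast
    have sB: "subspace F (span B) V" using span_is_subspace BV by blast
    note SB = subspaceD[OF sB]
    have "N \<subseteq> {x \<in> carrier V. P (int i) x \<in> span B}" if i: "i < s" for i
      unfolding A(4)[symmetric]
    proof (intro span_subset_subspace subspaceI)
      show "A \<subseteq> {x \<in> carrier V. P (int i) x \<in> span B}"
        using in_own_span[OF BV] i AV unfolding B_def by blast
    qed (use SB in \<open>auto simp: P_add P_smult\<close>)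
    then have PN: "P (int i) x \<in> span B" if "i < s" "x \<in> N" for i x using that by blast
    show "carrier V \<subseteq> span B"
    proof
      fix v assume "v \<in> carrier V"
      then have "v \<in> orbit_sum s N" using assms(3) by (simp add: orbit_direct_def)
      then obtain u where u: "u \<in> {..<s} \<rightarrow> N" "v = (\<Oplus>\<^bsub>V\<^esub>i\<in>{..<s}. P (int i) (u i))" by (rule orbit_sumE)
      show "v \<in> span B" unfolding u(2)
        by (rule finsum_in_subspace[OF sB]) (use u(1) PN in auto)
    qed
  qed
  ultimately have "basis B" unfolding basis_def using BV by blast
  then have "dim = s * card A" using dim_basis[OF finB] cardB by simp
  then show ?thesis by simp
qed

lemma orbit_direct_of_eigenvectors:
  fixes s :: nat
  assumes "stable s N" "orbit_sum s N = carrier V" "linear_operator F V e" "inj_on lam {..<s}"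
    and "\<And>i. i < s \<Longrightarrow> lam i \<in> carrier F"
    and "\<And>i x. i < s \<Longrightarrow> x \<in> N \<Longrightarrow> e (P (int i) x) = lam i \<odot>\<^bsub>V\<^esub> P (int i) x"
  shows "orbit_direct s N"
  unfolding orbit_direct_def
proof (intro conjI assms(2) ballI impI allI)
  interpret e: linear_operator F V e by fact
  note S = stableD[OF assms(1)]
  fix u u' i
  assume u: "u \<in> {..<s} \<rightarrow> N" and u': "u' \<in> {..<s} \<rightarrow> N" and i: "i < s"
    and eq: "(\<Oplus>\<^bsub>V\<^esub>i\<in>{..<s}. P (int i) (u i)) = (\<Oplus>\<^bsub>V\<^esub>i\<in>{..<s}. P (int i) (u' i))"
  define d where "d i = u i \<oplus>\<^bsub>V\<^esub> (\<ominus>\<^bsub>V\<^esub> u' i)" for i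
  have uN: "u j \<in> N" "u' j \<in> N" if "j < s" for j using u u' that by auto
  have dN: "d j \<in> N" if "j < s" for j unfolding d_def using uN[OF that] S(5,7) by blast
  have uV: "u j \<in> carrier V" "u' j \<in> carrier V" "d j \<in> carrier V" if "j < s" for j
    using uN[OF that] dN[OF that] S(3) by auto
  have "(\<Oplus>\<^bsub>V\<^esub>i\<in>{..<s}. P (int i) (d i)) \<oplus>\<^bsub>V\<^esub> (\<Oplus>\<^bsub>V\<^esub>i\<in>{..<s}. P (int i) (u' i)) =
      (\<Oplus>\<^bsub>V\<^esub>i\<in>{..<s}. P (int i) (d i) \<oplus>\<^bsub>V\<^esub> P (int i) (u' i))"
    using uV by (intro M.finsum_addf[symmetric]) auto
  also have "\<dots> = (\<Oplus>\<^bsub>V\<^esub>i\<in>{..<s}. P (int i) (u i))"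
    using uV by (intro M.finsum_cong') (auto simp: P_add[symmetric] d_def M.a_assoc M.l_neg)
  also have "\<dots> = (\<Oplus>\<^bsub>V\<^esub>i\<in>{..<s}. P (int i) (u' i))" by (rule eq)
  finally have "(\<Oplus>\<^bsub>V\<^esub>i\<in>{..<s}. P (int i) (d i)) = \<zero>\<^bsub>V\<^esub>"
    using uV by (subst (asm) M.add.r_cancel_one) (auto intro!: M.finsum_closed)
  then have "P (int i) (d i) = \<zero>\<^bsub>V\<^esub>"
    using uV dN assms(4-6) i by (intro e.eigenvectors_independent[of s "\<lambda>i. P (int i) (d i)" lam]) auto
  then have "d i = \<zero>\<^bsub>V\<^esub>" using P_eq_zero uV(3)[OF i] by blast
  then show "u i = u' i" using minus_eq_zero_iff[OF uV(1,2)[OF i]] by (simp add: d_def M.minus_eq)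
qed

end

text \<open>With \<open>e\<close> and \<open>c\<close> as in \<open>twisted_endo\<close>, \<open>N\<close> is the eigenspace of \<open>e\<close> for an eigenvalue \<open>a\<close> in the constants, and \<open>s\<close> is the order of \<open>c\<close>. The
  translates of \<open>N\<close> belong to the distinct eigenvalues \<open>c\<^sup>i a\<close>. A nonzero stable \<open>U\<close> inside \<open>N\<close> also has
  the whole space as the sum of its translates; comparing the components of index \<open>0\<close> gives \<open>U = N\<close>.\<close>

lemma (in irreducible_action) cyclic_decomposition:
  assumes "algebraically_closed constants" "characteristic_zero constants"
    and "stable t U0" "U0 \<noteq> {\<zero>\<^bsub>V\<^esub>}" "U0 \<noteq> carrier V" "0 < t"
  obtains s N where "1 < s" "s dvd t" "s dvd dim" "stable s N" "N \<noteq> {\<zero>\<^bsub>V\<^esub>}" "orbit_direct s N"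
    "\<forall>U. stable s U \<longrightarrow> U \<subseteq> N \<longrightarrow> U = {\<zero>\<^bsub>V\<^esub>} \<or> U = N"
proof -
  interpret C: algebraically_closed constants by fact
  obtain e c where lin: "linear_operator F V e" and c: "c \<in> carrier constants" "c \<noteq> \<one>\<^bsub>F\<^esub>" "c [^]\<^bsub>F\<^esub> t = \<one>\<^bsub>F\<^esub>"
    and nz: "\<exists>x\<in>carrier V. e x \<noteq> \<zero>\<^bsub>V\<^esub>"
    and "\<forall>x\<in>carrier V. e (P 1 x) = c \<odot>\<^bsub>V\<^esub> P 1 (e x)"
    using twisted_endo[OF assms] by blast
  then have tw: "e (P 1 x) = c \<odot>\<^bsub>V\<^esub> P 1 (e x)" if "x \<in> carrier V" for x using that by blast
  interpret e: linear_operator F V e by (rule lin)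
  have cF: "c \<in> carrier F" using c by simp
  have c0: "c \<noteq> \<zero>\<^bsub>F\<^esub>"
    using c(3) assms(6) R.nat_pow_zero[of t] one_not_zero by auto
  have pw: "e (P (int n) x) = (c [^]\<^bsub>F\<^esub> n) \<odot>\<^bsub>V\<^esub> P (int n) (e x)" if x: "x \<in> carrier V" for n x
    by (intro twist_power C.field_axioms c(1) e.T_closed tw x)
  have ker: "x = \<zero>\<^bsub>V\<^esub>" if x: "x \<in> carrier V" "e x = \<zero>\<^bsub>V\<^esub>" for x
  proof -
    have "stable 1 {x \<in> carrier V. e x = \<zero>\<^bsub>V\<^esub>}"
    proof (intro stableI subspaceI)
      fix y assume y: "y \<in> {x \<in> carrier V. e x = \<zero>\<^bsub>V\<^esub>}"
      show "P (int 1) y \<in> {x \<in> carrier V. e x = \<zero>\<^bsub>V\<^esub>}" using y tw cF by simp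
      have "c \<odot>\<^bsub>V\<^esub> P 1 (e (P (- 1) y)) = \<zero>\<^bsub>V\<^esub>" using tw[of "P (- 1) y"] y P_neg(1)[of y 1] by simp
      then have "P 1 (e (P (- 1) y)) = \<zero>\<^bsub>V\<^esub>" using e.smult_left_cancel_zero[OF cF c0] y by simp
      then show "P (- int 1) y \<in> {x \<in> carrier V. e x = \<zero>\<^bsub>V\<^esub>}" using P_eq_zero[of "e (P (- 1) y)" 1] y by simp
    qed (auto simp: e.T_add e.T_smult)
    then have "{x \<in> carrier V. e x = \<zero>\<^bsub>V\<^esub>} = {\<zero>\<^bsub>V\<^esub>}" using irreducible nz by blast
    then show ?thesis using x by blast
  qed
  have "carrier V \<noteq> {\<zero>\<^bsub>V\<^esub>}" using nz by auto
  then obtain a w where a: "a \<in> carrier constants" and w: "w \<in> carrier V" "w \<noteq> \<zero>\<^bsub>V\<^esub>" "e w = a \<odot>\<^bsub>V\<^esub> w"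
    using twisted_eigenvector[OF assms(1) fin_dim _ lin c(1,3) assms(6) tw] by blast
  have aF: "a \<in> carrier F" using a by simp
  have a0: "a \<noteq> \<zero>\<^bsub>F\<^esub>" using ker w by auto
  define s where "s = (LEAST n::nat. 0 < n \<and> c [^]\<^bsub>F\<^esub> n = \<one>\<^bsub>F\<^esub>)"
  have s: "0 < s" "c [^]\<^bsub>F\<^esub> s = \<one>\<^bsub>F\<^esub>" 
    using LeastI[of "\<lambda>n::nat. 0 < n \<and> c [^]\<^bsub>F\<^esub> n = \<one>\<^bsub>F\<^esub>" t] assms(6) c(3) unfolding s_def by auto
  have s_min: "n = 0" if "n < s" "c [^]\<^bsub>F\<^esub> n = \<one>\<^bsub>F\<^esub>" for n :: nat
    using not_less_Least[of n "\<lambda>n::nat. 0 < n \<and> c [^]\<^bsub>F\<^esub> n = \<one>\<^bsub>F\<^esub>"] that unfolding s_def by auto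
  have s1: "1 < s" 
  proof (rule ccontr)
    assume "\<not> 1 < s"
    then have "s = 1" using s(1) by simp
    then show False using s(2) c(2) cF by simp
  qed
  have st: "s dvd t"
  proof -
    have "c [^]\<^bsub>F\<^esub> (s * (t div s)) = (c [^]\<^bsub>F\<^esub> s) [^]\<^bsub>F\<^esub> (t div s)"
      by (rule R.nat_pow_pow[OF cF, symmetric])
    then have quot: "c [^]\<^bsub>F\<^esub> (s * (t div s)) = \<one>\<^bsub>F\<^esub>" unfolding s(2) by simp
    have "c [^]\<^bsub>F\<^esub> (t mod s) = c [^]\<^bsub>F\<^esub> (s * (t div s)) \<otimes>\<^bsub>F\<^esub> c [^]\<^bsub>F\<^esub> (t mod s)"
      unfolding quot by (rule R.l_one[OF R.nat_pow_closed[OF cF], symmetric])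
    also have "\<dots> = c [^]\<^bsub>F\<^esub> (s * (t div s) + t mod s)"
      by (rule R.nat_pow_mult[OF cF])
    also have "\<dots> = c [^]\<^bsub>F\<^esub> t" by (simp only: mult_div_mod_eq)
    also have "\<dots> = \<one>\<^bsub>F\<^esub>" by (rule c(3))
    finally have "c [^]\<^bsub>F\<^esub> (t mod s) = \<one>\<^bsub>F\<^esub>" .
    then have "t mod s = 0" using s_min[of "t mod s"] s(1) by simp
    then show ?thesis by (rule mod_0_imp_dvd)
  qed
  define N where "N = {x \<in> carrier V. e x = a \<odot>\<^bsub>V\<^esub> x}"
  define lam where "lam i = c [^]\<^bsub>F\<^esub> (i::nat) \<otimes>\<^bsub>F\<^esub> a" for i
  have lamF: "lam i \<in> carrier F" for i unfolding lam_def using cF aF by simp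
  have eig: "e (P (int i) x) = lam i \<odot>\<^bsub>V\<^esub> P (int i) x" if "x \<in> N" for i x
    using pw[of x i] that constants_smult_P[OF a] cF aF by (simp add: N_def lam_def smult_assoc1)
  have N: "stable s N"
  proof (intro stableI subspaceI)
    show "v \<oplus>\<^bsub>V\<^esub> w \<in> N" if "v \<in> N" "w \<in> N" for v w
      using that aF by (simp add: N_def e.T_add smult_r_distr)
    show "b \<odot>\<^bsub>V\<^esub> v \<in> N" if "b \<in> carrier F" "v \<in> N" for b v
      using that aF by (simp add: N_def e.T_smult smult_assoc1[symmetric] R.m_comm)
    show "P (int s) x \<in> N" if "x \<in> N" for x
      using eig[OF that, of s] s(2) that aF by (simp add: lam_def N_def)
    show "P (- int s) x \<in> N" if "x \<in> N" for x
    proof -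
      have x: "x \<in> carrier V" "e x = a \<odot>\<^bsub>V\<^esub> x" using that by (auto simp: N_def)
      have "a \<odot>\<^bsub>V\<^esub> x = P (int s) (e (P (- int s) x))"
        using pw[of "P (- int s) x" s] s(2) x by simp
      then have "P (- int s) (a \<odot>\<^bsub>V\<^esub> x) = e (P (- int s) x)" using x(1) by simp
      then show ?thesis using x(1) constants_smult_P[OF a x(1)] by (simp add: N_def)
    qed
  qed (use aF in \<open>auto simp: N_def\<close>)
  note SN = stableD[OF N]
  have N0: "N \<noteq> {\<zero>\<^bsub>V\<^esub>}" using w by (auto simp: N_def)
  have inj: "inj_on lam {..<s}"
  proof -
    have "i = j" if ij: "i \<le> j" "j < s" "lam i = lam j" for i j
    proof -
      have "c [^]\<^bsub>F\<^esub> i = c [^]\<^bsub>F\<^esub> j" using ij(3) a0 aF cF by (simp add: lam_def m_rcancel)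
      also have "c [^]\<^bsub>F\<^esub> j = c [^]\<^bsub>F\<^esub> i \<otimes>\<^bsub>F\<^esub> c [^]\<^bsub>F\<^esub> (j - i)"
        using cF ij(1) by (simp add: R.nat_pow_mult)
      finally have "c [^]\<^bsub>F\<^esub> (j - i) = \<one>\<^bsub>F\<^esub>"
      proof -
        assume h: "c [^]\<^bsub>F\<^esub> i = c [^]\<^bsub>F\<^esub> i \<otimes>\<^bsub>F\<^esub> c [^]\<^bsub>F\<^esub> (j - i)"
        have "c [^]\<^bsub>F\<^esub> i \<noteq> \<zero>\<^bsub>F\<^esub>" using c0 cF by (induction i) (auto simp: integral_iff)
        then show ?thesis
          using h cF m_lcancel[of "c [^]\<^bsub>F\<^esub> i" "\<one>\<^bsub>F\<^esub>" "c [^]\<^bsub>F\<^esub> (j - i)"] by simp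
      qed
      then have "j - i = 0" using s_min[of "j - i"] ij by simp
      then show ?thesis using ij(1) by simp
    qed
    then show ?thesis unfolding inj_on_def by (metis lessThan_iff nle_le)
  qed
  have dir: "orbit_direct s N"
    using orbit_direct_of_eigenvectors[OF N orbit_sum_eq_carrier[OF N s(1) N0] lin inj lamF eig] .
  have simple: "U = {\<zero>\<^bsub>V\<^esub>} \<or> U = N" if U: "stable s U" "U \<subseteq> N" for U
  proof (cases "U = {\<zero>\<^bsub>V\<^esub>}")
    case False
    have "N \<subseteq> U"
    proof
      fix x assume x: "x \<in> N"
      then have xV: "x \<in> carrier V" using SN(3) by blast
      then have "x \<in> orbit_sum s U" using orbit_sum_eq_carrier[OF U(1) s(1) False] by simp
      then obtain u where u: "u \<in> {..<s} \<rightarrow> U" "x = (\<Oplus>\<^bsub>V\<^esub>i\<in>{..<s}. P (int i) (u i))" by (rule orbit_sumE)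
      have "u 0 = (if 0 = (0::nat) then x else \<zero>\<^bsub>V\<^esub>)"
      proof (rule orbit_directD[OF dir, of u "\<lambda>i. if 0 = i then x else \<zero>\<^bsub>V\<^esub>" 0])
        show "(\<Oplus>\<^bsub>V\<^esub>i\<in>{..<s}. P (int i) (u i)) = (\<Oplus>\<^bsub>V\<^esub>i\<in>{..<s}. P (int i) (if 0 = i then x else \<zero>\<^bsub>V\<^esub>))"
          using P_as_orbit_sum[OF s(1) xV] u(2) xV by (simp add: P_0)
      qed (use u(1) U(2) x SN(4) s(1) in auto)
      then show "x \<in> U" using u(1) s(1) by auto
    qed
    then show ?thesis using U(2) by blast
  qed simp
  show ?thesis
    using that[OF s1 st orbit_direct_dim[OF fin_dim N dir] N N0 dir] simple by blast
qed

section \<open>Difference modules as semilinear actions\<close>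

definition monomial :: "('a, 'b) ring_scheme \<Rightarrow> 'a \<Rightarrow> int \<Rightarrow> int \<Rightarrow> 'a" where
  "monomial F f i = (\<lambda>k. if k = i then f else \<zero>\<^bsub>F\<^esub>)"

context difference_field
begin

lemma aut_power_iso: "aut_power F \<phi> i \<in> ring_iso F F"
proof -
  have funpow: "h ^^ n \<in> ring_iso F F" if h: "h \<in> ring_iso F F" for h and n :: nat
  proof (induction n)
    case 0
    show ?case by (auto simp: ring_iso_def ring_hom_def bij_betw_def)
  next
    case (Suc n)
    show ?case unfolding funpow.simps(2) by (rule ring_iso_set_trans[OF Suc h])
  qed
  show ?thesis
    unfolding aut_power_def using funpow[OF automorphism] funpow[OF ring_iso_set_sym[OF ring_axioms automorphism]]
    by simp
qed

lemma aut_power_hom: "aut_power F \<phi> i \<in> ring_hom F F"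
  using aut_power_iso by (simp add: ring_iso_def)

lemma aut_power_closed [simp, intro]: "a \<in> carrier F \<Longrightarrow> aut_power F \<phi> i a \<in> carrier F"
  using ring_hom_closed[OF aut_power_hom] .

lemma aut_power_one [simp]: "aut_power F \<phi> i \<one> = \<one>"
  using ring_hom_one[OF aut_power_hom] .

lemma aut_power_zero [simp]: "aut_power F \<phi> i \<zero> = \<zero>"
  using ring_hom_zero[OF aut_power_hom ring_axioms ring_axioms] .

lemma aut_power_0 [simp]: "aut_power F \<phi> 0 a = a"
  by (simp add: aut_power_def)

lemma aut_power_1 [simp]: "aut_power F \<phi> 1 = \<phi>"
  by (auto simp: aut_power_def)

lemma monomial_closed [simp, intro]: "f \<in> carrier F \<Longrightarrow> monomial F f i \<in> carrier (skew_laurent F \<phi>)"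
  by (auto simp: skew_laurent_def monomial_def intro: finite_subset[of _ "{i}"])

lemma skew_laurent_simps:
  "p \<oplus>\<^bsub>skew_laurent F \<phi>\<^esub> q = (\<lambda>i. p i \<oplus> q i)"
  "\<zero>\<^bsub>skew_laurent F \<phi>\<^esub> = (\<lambda>i. \<zero>)"
  "\<one>\<^bsub>skew_laurent F \<phi>\<^esub> = monomial F \<one> 0"
  by (simp_all add: skew_laurent_def monomial_def)

lemma laurent_const_eq: "laurent_const F f = monomial F f 0"
  by (simp add: laurent_const_def monomial_def)

lemma skew_laurentD: "p \<in> carrier (skew_laurent F \<phi>) \<Longrightarrow> p i \<in> carrier F"
  "p \<in> carrier (skew_laurent F \<phi>) \<Longrightarrow> finite {i. p i \<noteq> \<zero>}"
  by (auto simp: skew_laurent_def)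

lemma monomial_mult:
  assumes "f \<in> carrier F" "g \<in> carrier F"
  shows "monomial F f i \<otimes>\<^bsub>skew_laurent F \<phi>\<^esub> monomial F g j = monomial F (f \<otimes> aut_power F \<phi> i g) (i + j)"
proof
  fix k
  show "(monomial F f i \<otimes>\<^bsub>skew_laurent F \<phi>\<^esub> monomial F g j) k = monomial F (f \<otimes> aut_power F \<phi> i g) (i + j) k"
  proof (cases "f = \<zero>")
    case True
    then show ?thesis using assms by (simp add: skew_laurent_def monomial_def)
  next
    case False
    then have "{l. monomial F f i l \<noteq> \<zero>} = {i}" by (auto simp: monomial_def)
    then have "(monomial F f i \<otimes>\<^bsub>skew_laurent F \<phi>\<^esub> monomial F g j) k =
        (\<Oplus>l\<in>{i}. monomial F f i l \<otimes> aut_power F \<phi> l (monomial F g j (k - l)))"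
      by (simp add: skew_laurent_def)
    also have "\<dots> = monomial F f i i \<otimes> aut_power F \<phi> i (monomial F g j (k - i))"
      using assms by (subst add.finprod_insert) (auto simp: monomial_def)
    also have "\<dots> = monomial F (f \<otimes> aut_power F \<phi> i g) (i + j) k"
      using assms by (auto simp: monomial_def)
    finally show ?thesis .
  qed
qed

text \<open>The monomials split off are those that occur in \<open>p\<close>, so that a condition on the support of \<open>p\<close> can be
  used in the induction step.\<close>

lemma skew_laurent_induct:
  assumes p: "p \<in> carrier (skew_laurent F \<phi>)"
    and zero: "Q (\<lambda>i. \<zero>)"
    and step: "\<And>i q. p i \<noteq> \<zero> \<Longrightarrow> q \<in> carrier (skew_laurent F \<phi>) \<Longrightarrow> Q q \<Longrightarrow>
        Q (monomial F (p i) i \<oplus>\<^bsub>skew_laurent F \<phi>\<^esub> q)"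
  shows "Q p"
proof -
  define r where "r S = (\<lambda>i. if i \<in> S then p i else \<zero>)" for S
  note pD = skew_laurentD[OF p]
  have "Q (r S)" if "finite S" "S \<subseteq> {i. p i \<noteq> \<zero>}" for S
    using that
  proof (induction S rule: finite_induct)
    case empty
    then show ?case using zero by (simp add: r_def)
  next
    case (insert i S)
    have "r (insert i S) = monomial F (p i) i \<oplus>\<^bsub>skew_laurent F \<phi>\<^esub> r S"
      using insert(2) pD(1) by (auto simp: r_def skew_laurent_simps monomial_def fun_eq_iff)
    moreover have "r S \<in> carrier (skew_laurent F \<phi>)"
      using pD finite_subset[of "{i. r S i \<noteq> \<zero>}" S] insert(1) by (auto simp: r_def skew_laurent_def)
    ultimately show ?case using step[of i "r S"] insert by auto
  qed
  moreover have "r {i. p i \<noteq> \<zero>} = p" by (auto simp: r_def)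
  ultimately show ?thesis using pD(2) by (metis subset_refl)
qed

lemma skew_laurent_mult_support:
  assumes "p \<in> carrier (skew_laurent F \<phi>)" "q \<in> carrier (skew_laurent F \<phi>)"
    "(p \<otimes>\<^bsub>skew_laurent F \<phi>\<^esub> q) k \<noteq> \<zero>"
  obtains i where "p i \<noteq> \<zero>" "q (k - i) \<noteq> \<zero>"
proof -
  have "\<exists>i. p i \<noteq> \<zero> \<and> q (k - i) \<noteq> \<zero>"
  proof (rule ccontr)
    assume n: "\<nexists>i. p i \<noteq> \<zero> \<and> q (k - i) \<noteq> \<zero>"
    have "(\<Oplus>i\<in>{i. p i \<noteq> \<zero>}. p i \<otimes> aut_power F \<phi> i (q (k - i))) = \<zero>"
    proof (rule add.finprod_one_eqI)
      fix i assume "i \<in> {i. p i \<noteq> \<zero>}"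
      then have "q (k - i) = \<zero>" using n by blast
      then show "p i \<otimes> aut_power F \<phi> i (q (k - i)) = \<zero>" using skew_laurentD(1)[OF assms(1)] by simp
    qed
    then show False using assms(3) by (simp add: skew_laurent_def)
  qed
  then show ?thesis using that by blast
qed

lemma skew_laurent_minus:
  assumes "ring (skew_laurent F \<phi>)" "p \<in> carrier (skew_laurent F \<phi>)"
  shows "\<ominus>\<^bsub>skew_laurent F \<phi>\<^esub> p = (\<lambda>i. \<ominus> p i)"
proof -
  interpret D: ring "skew_laurent F \<phi>" by fact
  note pD = skew_laurentD[OF assms(2)]
  have "{i. \<ominus> p i \<noteq> \<zero>} \<subseteq> {i. p i \<noteq> \<zero>}" by auto
  then have "(\<lambda>i. \<ominus> p i) \<in> carrier (skew_laurent F \<phi>)"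
    using pD finite_subset by (fastforce simp: skew_laurent_def)
  then show ?thesis
    using assms(2) pD(1) by (intro D.minus_equality) (auto simp: skew_laurent_simps l_neg)
qed

lemma skew_laurent_sub_ring:
  assumes "ring (skew_laurent F \<phi>)"
  shows "ring (skew_laurent_sub F \<phi> t)"
proof -
  interpret D: ring "skew_laurent F \<phi>" by fact
  let ?H = "{p \<in> carrier (skew_laurent F \<phi>). \<forall>i. p i \<noteq> \<zero> \<longrightarrow> int t dvd i}"
  have "subring ?H (skew_laurent F \<phi>)"
  proof (rule D.subringI)
    show "\<one>\<^bsub>skew_laurent F \<phi>\<^esub> \<in> ?H" using D.one_closed by (auto simp: skew_laurent_simps monomial_def)
    show "\<ominus>\<^bsub>skew_laurent F \<phi>\<^esub> p \<in> ?H" if "p \<in> ?H" for p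
    proof -
      have p: "p \<in> carrier (skew_laurent F \<phi>)" using that by simp
      have "p i \<noteq> \<zero>" if "\<ominus> p i \<noteq> \<zero>" for i using that by auto
      then show ?thesis using that D.a_inv_closed[OF p] skew_laurent_minus[OF assms p] by auto
    qed
    show "p \<otimes>\<^bsub>skew_laurent F \<phi>\<^esub> q \<in> ?H" if "p \<in> ?H" "q \<in> ?H" for p q
    proof -
      have pq: "p \<in> carrier (skew_laurent F \<phi>)" "q \<in> carrier (skew_laurent F \<phi>)" using that by auto
      have "int t dvd k" if nz: "(p \<otimes>\<^bsub>skew_laurent F \<phi>\<^esub> q) k \<noteq> \<zero>" for k
      proof -
        obtain i where "p i \<noteq> \<zero>" "q (k - i) \<noteq> \<zero>" using skew_laurent_mult_support[OF pq nz] .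
        then have "int t dvd i" "int t dvd k - i" using \<open>p \<in> ?H\<close> \<open>q \<in> ?H\<close> by auto
        then have "int t dvd i + (k - i)" by (rule dvd_add)
        then show ?thesis by simp
      qed
      then show ?thesis using D.m_closed[OF pq] by blast
    qed
    show "p \<oplus>\<^bsub>skew_laurent F \<phi>\<^esub> q \<in> ?H" if "p \<in> ?H" "q \<in> ?H" for p q
    proof -
      have pq: "p \<in> carrier (skew_laurent F \<phi>)" "q \<in> carrier (skew_laurent F \<phi>)" using that by auto
      have "int t dvd k" if nz: "p k \<oplus> q k \<noteq> \<zero>" for k
      proof -
        have "p k \<noteq> \<zero> \<or> q k \<noteq> \<zero>" using nz by auto
        then show ?thesis using \<open>p \<in> ?H\<close> \<open>q \<in> ?H\<close> by auto
      qed
      then show ?thesis using D.a_closed[OF pq] by (auto simp: skew_laurent_simps)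
    qed
  qed auto
  then show ?thesis unfolding skew_laurent_sub_def by (rule D.subring_is_ring)
qed

end

lemma underlying_space_simps [simp]:
  "carrier (underlying_space F M) = carrier M" "\<zero>\<^bsub>underlying_space F M\<^esub> = \<zero>\<^bsub>M\<^esub>"
  "x \<oplus>\<^bsub>underlying_space F M\<^esub> y = x \<oplus>\<^bsub>M\<^esub> y"
  "f \<odot>\<^bsub>underlying_space F M\<^esub> x = laurent_const F f \<odot>\<^bsub>M\<^esub> x"
  by (simp_all add: underlying_space_def)

locale laurent_module = difference_field F \<phi> + L: left_module "skew_laurent F \<phi>" M
  for F (structure) and \<phi> and M (structure)
begin

abbreviation "D \<equiv> skew_laurent F \<phi>"
abbreviation "V \<equiv> underlying_space F M"
definition act :: "int \<Rightarrow> 'c \<Rightarrow> 'c" where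
  "act i x = monomial F \<one>\<^bsub>F\<^esub> i \<odot>\<^bsub>M\<^esub> x"

lemma a_inv_V: "\<ominus>\<^bsub>V\<^esub> x = \<ominus>\<^bsub>M\<^esub> x"
  by (simp add: a_inv_def m_inv_def underlying_space_def)

lemma abelian_group_V: "abelian_group V"
proof (rule abelian_groupI)
  show "\<exists>y\<in>carrier V. y \<oplus>\<^bsub>V\<^esub> x = \<zero>\<^bsub>V\<^esub>" if "x \<in> carrier V" for x
    using that L.M.l_neg L.M.a_inv_closed by auto
qed (auto simp: L.M.a_ac)

lemma const_mult: "f \<in> carrier F \<Longrightarrow> monomial F f 0 \<otimes>\<^bsub>D\<^esub> monomial F \<one>\<^bsub>F\<^esub> i = monomial F f i"
  by (simp add: monomial_mult)

lemma vectorspace_V: "vectorspace F V"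
proof -
  have "module F V"
  proof (rule moduleI)
    show "cring F" by (rule is_cring)
    show "abelian_group V" by (rule abelian_group_V)
    fix a b x y
    show "a \<odot>\<^bsub>V\<^esub> x \<in> carrier V" if "a \<in> carrier F" "x \<in> carrier V"
      using that by (simp add: laurent_const_eq L.smult_closed)
    show "(a \<oplus>\<^bsub>F\<^esub> b) \<odot>\<^bsub>V\<^esub> x = a \<odot>\<^bsub>V\<^esub> x \<oplus>\<^bsub>V\<^esub> b \<odot>\<^bsub>V\<^esub> x" if "a \<in> carrier F" "b \<in> carrier F" "x \<in> carrier V"
    proof -
      have "monomial F (a \<oplus>\<^bsub>F\<^esub> b) 0 = monomial F a 0 \<oplus>\<^bsub>D\<^esub> monomial F b 0"
        by (auto simp: skew_laurent_simps monomial_def)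
      then show ?thesis using that L.smult_l_distr[of "monomial F a 0" "monomial F b 0" x]
        by (simp add: laurent_const_eq)
    qed
    show "a \<odot>\<^bsub>V\<^esub> (x \<oplus>\<^bsub>V\<^esub> y) = a \<odot>\<^bsub>V\<^esub> x \<oplus>\<^bsub>V\<^esub> a \<odot>\<^bsub>V\<^esub> y" if "a \<in> carrier F" "x \<in> carrier V" "y \<in> carrier V"
      using that by (simp add: laurent_const_eq L.smult_r_distr)
    show "(a \<otimes>\<^bsub>F\<^esub> b) \<odot>\<^bsub>V\<^esub> x = a \<odot>\<^bsub>V\<^esub> (b \<odot>\<^bsub>V\<^esub> x)" if "a \<in> carrier F" "b \<in> carrier F" "x \<in> carrier V"
      using that L.smult_assoc[of "monomial F a 0" "monomial F b 0" x]
      by (simp add: laurent_const_eq monomial_mult)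
    show "\<one>\<^bsub>F\<^esub> \<odot>\<^bsub>V\<^esub> x = x" if "x \<in> carrier V"
      using that L.smult_one[of x] by (simp add: laurent_const_eq skew_laurent_simps)
  qed
  then show ?thesis using field_axioms by (simp add: vectorspace_def)
qed

lemma monomial_smult:
  "f \<in> carrier F \<Longrightarrow> x \<in> carrier M \<Longrightarrow> monomial F f i \<odot>\<^bsub>M\<^esub> x = f \<odot>\<^bsub>V\<^esub> act i x"
  using L.smult_assoc[of "monomial F f 0" "monomial F \<one>\<^bsub>F\<^esub> i" x]
  by (simp add: act_def laurent_const_eq const_mult)

text \<open>Both sides are coefficients of the same product of three monomials in \<open>D\<close>, bracketed in two ways, so
  associativity of \<open>D\<close> spares a case distinction on the signs of the exponents.\<close>

lemma aut_power_add:
  assumes "a \<in> carrier F"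
  shows "aut_power F \<phi> i (aut_power F \<phi> j a) = aut_power F \<phi> (i + j) a"
proof -
  have "(monomial F \<one>\<^bsub>F\<^esub> i \<otimes>\<^bsub>D\<^esub> monomial F \<one>\<^bsub>F\<^esub> j) \<otimes>\<^bsub>D\<^esub> monomial F a 0 =
      monomial F \<one>\<^bsub>F\<^esub> i \<otimes>\<^bsub>D\<^esub> (monomial F \<one>\<^bsub>F\<^esub> j \<otimes>\<^bsub>D\<^esub> monomial F a 0)"
    using assms by (intro L.R.m_assoc) auto
  then have "monomial F (aut_power F \<phi> (i + j) a) (i + j) = monomial F (aut_power F \<phi> i (aut_power F \<phi> j a)) (i + j)"
    using assms by (simp add: monomial_mult)
  then have "monomial F (aut_power F \<phi> (i + j) a) (i + j) (i + j) =
      monomial F (aut_power F \<phi> i (aut_power F \<phi> j a)) (i + j) (i + j)" by simp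
  then show ?thesis by (simp add: monomial_def)
qed

sublocale A: semilinear_action F V "aut_power F \<phi>" act
proof -
  interpret W: vectorspace F V by (rule vectorspace_V)
  show "semilinear_action F V (aut_power F \<phi>) act"
  proof unfold_locales
    fix i j a x y
    show "aut_power F \<phi> i \<in> ring_hom F F" by (rule aut_power_hom)
    show "aut_power F \<phi> 0 a = a" by simp
    show "aut_power F \<phi> i (aut_power F \<phi> j a) = aut_power F \<phi> (i + j) a" if "a \<in> carrier F"
      using aut_power_add that .
    show "act i x \<in> carrier V" if "x \<in> carrier V"
      using that by (simp add: act_def L.smult_closed)
    show "act i (x \<oplus>\<^bsub>V\<^esub> y) = act i x \<oplus>\<^bsub>V\<^esub> act i y" if "x \<in> carrier V" "y \<in> carrier V"
      using that by (simp add: act_def L.smult_r_distr)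
    show "act i (a \<odot>\<^bsub>V\<^esub> x) = aut_power F \<phi> i a \<odot>\<^bsub>V\<^esub> act i x" if "a \<in> carrier F" "x \<in> carrier V"
      using that L.smult_assoc[of "monomial F \<one>\<^bsub>F\<^esub> i" "monomial F a 0" x] monomial_smult[of "aut_power F \<phi> i a" x i]
      by (simp add: monomial_mult laurent_const_eq act_def)
    show "act 0 x = x" if "x \<in> carrier V"
      using that L.smult_one[of x] by (simp add: act_def skew_laurent_simps)
    show "act i (act j x) = act (i + j) x" if "x \<in> carrier V"
      using that L.smult_assoc[of "monomial F \<one>\<^bsub>F\<^esub> i" "monomial F \<one>\<^bsub>F\<^esub> j" x]
      by (simp add: monomial_mult act_def)
  qed
qed

lemma smult_in_stable:
  assumes "A.stable t U" "p \<in> carrier (skew_laurent_sub F \<phi> t)" "x \<in> U"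
  shows "p \<odot>\<^bsub>M\<^esub> x \<in> U"
proof -
  note S = A.stableD[OF assms(1)]
  have xM: "x \<in> carrier M" using S(3) assms(3) by auto
  have p: "p \<in> carrier D" "p i \<noteq> \<zero>\<^bsub>F\<^esub> \<Longrightarrow> int t dvd i" for i
    using assms(2) by (auto simp: skew_laurent_sub_def)
  show ?thesis
  proof (rule skew_laurent_induct[OF p(1)])
    have "(\<lambda>i. \<zero>\<^bsub>F\<^esub>) = monomial F \<zero>\<^bsub>F\<^esub> 0" by (auto simp: monomial_def)
    then have "(\<lambda>i. \<zero>\<^bsub>F\<^esub>) \<odot>\<^bsub>M\<^esub> x = \<zero>\<^bsub>F\<^esub> \<odot>\<^bsub>V\<^esub> act 0 x"
      using monomial_smult[OF zero_closed xM, of 0] by (simp only:)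
    also have "\<dots> = \<zero>\<^bsub>V\<^esub>" using xM by (intro A.smult_l_null A.P_closed) simp
    finally show "(\<lambda>i. \<zero>\<^bsub>F\<^esub>) \<odot>\<^bsub>M\<^esub> x \<in> U" using S(4) by (simp only:)
    fix i q assume q: "p i \<noteq> \<zero>\<^bsub>F\<^esub>" "q \<in> carrier D" "q \<odot>\<^bsub>M\<^esub> x \<in> U"
    obtain k where k: "i = int t * k" using p(2)[OF q(1)] by (rule dvdE)
    have pi: "p i \<in> carrier F" using skew_laurentD(1)[OF p(1)] .
    have "act i x \<in> U" unfolding k by (rule S(2)[OF assms(3)])
    then have m: "monomial F (p i) i \<odot>\<^bsub>M\<^esub> x \<in> U"
      unfolding monomial_smult[OF pi xM] by (rule S(6)[OF pi])
    have "(monomial F (p i) i \<oplus>\<^bsub>D\<^esub> q) \<odot>\<^bsub>M\<^esub> x = monomial F (p i) i \<odot>\<^bsub>M\<^esub> x \<oplus>\<^bsub>V\<^esub> q \<odot>\<^bsub>M\<^esub> x"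
      using L.smult_l_distr[OF monomial_closed[OF pi] q(2) xM] by simp
    then show "(monomial F (p i) i \<oplus>\<^bsub>D\<^esub> q) \<odot>\<^bsub>M\<^esub> x \<in> U"
      using S(5)[OF m q(3)] by (simp only:)
  qed
qed

lemma submodule_iff_stable:
  "Module.submodule U (skew_laurent_sub F \<phi> t) M \<longleftrightarrow> A.stable t U"
proof
  assume "Module.submodule U (skew_laurent_sub F \<phi> t) M"
  then interpret U: Module.submodule U "skew_laurent_sub F \<phi> t" M .
  have mono: "monomial F f (int t * k) \<odot>\<^bsub>M\<^esub> x \<in> U" if "f \<in> carrier F" "x \<in> U" for f k x
    using that by (intro U.smult_closed) (auto simp: skew_laurent_sub_def, simp add: monomial_def split: if_splits)
  have UM: "x \<in> carrier M" if "x \<in> U" for x using U.subset that by auto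
  show "A.stable t U"
    unfolding A.stable_def
  proof (intro conjI A.subspaceI allI ballI)
    show "U \<subseteq> carrier V" using UM by auto
    show "\<zero>\<^bsub>V\<^esub> \<in> U" using U.one_closed by simp
    show "v \<oplus>\<^bsub>V\<^esub> w \<in> U" if "v \<in> U" "w \<in> U" for v w using U.m_closed that by simp
    show "a \<odot>\<^bsub>V\<^esub> v \<in> U" if "a \<in> carrier F" "v \<in> U" for a v
      using mono[OF that, of 0] by (simp add: laurent_const_eq)
    show "act (int t * k) x \<in> U" if "x \<in> U" for k x
      using mono[of "\<one>\<^bsub>F\<^esub>" x k] that by (simp add: act_def)
  qed
next
  assume st: "A.stable t U"
  note S = A.stableD[OF st]
  have "subgroup U (add_monoid M)"
  proof (rule L.M.add.subgroupI)
    show "\<ominus>\<^bsub>M\<^esub> a \<in> U" if "a \<in> U" for a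
      using S(7)[OF that] unfolding a_inv_V .
  qed (use S(3-5) in auto)
  then show "Module.submodule U (skew_laurent_sub F \<phi> t) M"
    using smult_in_stable[OF st] by (simp add: Module.submodule_def submodule_axioms_def)
qed

lemma skew_laurent_sub_1: "carrier (skew_laurent_sub F \<phi> 1) = carrier D"
  by (auto simp: skew_laurent_sub_def)

lemma submodule_iff_stable_1: "Module.submodule U D M \<longleftrightarrow> A.stable 1 U"
  using submodule_iff_stable[of U 1]
  unfolding Module.submodule_def submodule_axioms_def skew_laurent_sub_1 .

text \<open>Only the carrier of the record is changed, since the module records contain no ring of scalars.\<close>

lemma left_module_stable:
  assumes "A.stable s N"
  shows "left_module (skew_laurent_sub F \<phi> s) (M\<lparr>carrier := N\<rparr>)"
proof -
  note S = A.stableD[OF assms]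
  have NM: "x \<in> carrier M" if "x \<in> N" for x using S(3) that by auto
  have sub: "p \<in> carrier D" if "p \<in> carrier (skew_laurent_sub F \<phi> s)" for p
    using that by (simp add: skew_laurent_sub_def)
  interpret R: ring "skew_laurent_sub F \<phi> s"
    by (rule skew_laurent_sub_ring[OF L.R.ring_axioms])
  have "abelian_group (M\<lparr>carrier := N\<rparr>)"
  proof (rule abelian_groupI)
    show "\<exists>y\<in>carrier (M\<lparr>carrier := N\<rparr>). y \<oplus>\<^bsub>M\<lparr>carrier := N\<rparr>\<^esub> x = \<zero>\<^bsub>M\<lparr>carrier := N\<rparr>\<^esub>"
      if "x \<in> carrier (M\<lparr>carrier := N\<rparr>)" for x
      using that S(7)[of x] NM L.M.l_neg by (auto simp: a_inv_V)
  qed (use S(4,5) NM in \<open>auto simp: L.M.a_ac\<close>)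
  then show ?thesis
  proof (intro left_module.intro left_module_axioms.intro R.ring_axioms)
    let ?N = "M\<lparr>carrier := N\<rparr>" and ?R = "skew_laurent_sub F \<phi> s"
    have ops: "p \<oplus>\<^bsub>?R\<^esub> q = p \<oplus>\<^bsub>D\<^esub> q" "p \<otimes>\<^bsub>?R\<^esub> q = p \<otimes>\<^bsub>D\<^esub> q" "\<one>\<^bsub>?R\<^esub> = \<one>\<^bsub>D\<^esub>" for p q
      by (simp_all add: skew_laurent_sub_def)
    fix a b x y
    show "a \<odot>\<^bsub>?N\<^esub> x \<in> carrier ?N" if "a \<in> carrier ?R" "x \<in> carrier ?N"
      using smult_in_stable[OF assms that(1)] that(2) by simp
    show "(a \<oplus>\<^bsub>?R\<^esub> b) \<odot>\<^bsub>?N\<^esub> x = a \<odot>\<^bsub>?N\<^esub> x \<oplus>\<^bsub>?N\<^esub> b \<odot>\<^bsub>?N\<^esub> x"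
      if "a \<in> carrier ?R" "b \<in> carrier ?R" "x \<in> carrier ?N"
      unfolding ops using L.smult_l_distr[OF sub sub NM] that by simp
    show "a \<odot>\<^bsub>?N\<^esub> (x \<oplus>\<^bsub>?N\<^esub> y) = a \<odot>\<^bsub>?N\<^esub> x \<oplus>\<^bsub>?N\<^esub> a \<odot>\<^bsub>?N\<^esub> y"
      if "a \<in> carrier ?R" "x \<in> carrier ?N" "y \<in> carrier ?N"
      using L.smult_r_distr[OF sub NM NM] that by simp
    show "(a \<otimes>\<^bsub>?R\<^esub> b) \<odot>\<^bsub>?N\<^esub> x = a \<odot>\<^bsub>?N\<^esub> (b \<odot>\<^bsub>?N\<^esub> x)"
      if "a \<in> carrier ?R" "b \<in> carrier ?R" "x \<in> carrier ?N"
      unfolding ops using L.smult_assoc[OF sub sub NM] that by simp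
    show "\<one>\<^bsub>?R\<^esub> \<odot>\<^bsub>?N\<^esub> x = x" if "x \<in> carrier ?N"
      unfolding ops using L.smult_one[OF NM] that by simp
  qed
qed

end

section \<open>The induced module\<close>

lemma free_Abelian_group_diff:
  "x \<in> carrier (free_Abelian_group S) \<Longrightarrow> y \<in> carrier (free_Abelian_group S) \<Longrightarrow> x - y \<in> carrier (free_Abelian_group S)"
  using keys_diff[of x y] by auto

text \<open>The tensor product is the free abelian group \<open>FG\<close> modulo \<open>K\<close>. Evaluation \<open>(r, x) \<mapsto> r x\<close> maps \<open>FG\<close> onto \<open>M\<close>; the
  task is to show that its kernel is \<open>K\<close>.\<close>

locale direct_laurent_module = laurent_module F \<phi> M for F (structure) and \<phi> and M (structure) +
  fixes s :: nat and N :: "'c set"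
  assumes s_pos: "0 < s" and stable_N: "A.stable s N" and direct_N: "A.orbit_direct s N"
begin

abbreviation "R \<equiv> skew_laurent_sub F \<phi> s"
abbreviation "N_mod \<equiv> M\<lparr>carrier := N\<rparr>"
abbreviation "FG \<equiv> free_Abelian_group (carrier D \<times> N)"
abbreviation "K \<equiv> generate FG (tensor_relations D R N_mod)"

lemmas N_rules = A.stableD[OF stable_N]

lemma N_carrier: "x \<in> N \<Longrightarrow> x \<in> carrier M"
  using N_rules(3) by auto

lemma R_carrier: "a \<in> carrier R \<Longrightarrow> a \<in> carrier D"
  by (simp add: skew_laurent_sub_def)

lemma N_add: "x \<in> N \<Longrightarrow> y \<in> N \<Longrightarrow> x \<oplus>\<^bsub>M\<^esub> y \<in> N"
  using N_rules(5) by simp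

lemma N_neg: "x \<in> N \<Longrightarrow> \<ominus>\<^bsub>M\<^esub> x \<in> N"
  using N_rules(7) by (simp add: a_inv_V)

lemma N_zero: "\<zero>\<^bsub>M\<^esub> \<in> N"
  using N_rules(4) by simp

lemma relations_closed: "tensor_relations D R N_mod \<subseteq> carrier FG"
proof -
  have "frag_of (r, x) \<in> carrier FG" if "r \<in> carrier D" "x \<in> N" for r x
    using that by simp
  note mem = this free_Abelian_group_diff
  have "frag_of (r \<oplus>\<^bsub>D\<^esub> r', x) - frag_of (r, x) - frag_of (r', x) \<in> carrier FG"
    if "r \<in> carrier D" "r' \<in> carrier D" "x \<in> N" for r r' x
    using that by (intro mem L.R.a_closed)
  moreover have "frag_of (r, x \<oplus>\<^bsub>M\<^esub> x') - frag_of (r, x) - frag_of (r, x') \<in> carrier FG"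
    if "r \<in> carrier D" "x \<in> N" "x' \<in> N" for r x x'
    using that by (intro mem N_add)
  moreover have "frag_of (r \<otimes>\<^bsub>D\<^esub> a, x) - frag_of (r, a \<odot>\<^bsub>M\<^esub> x) \<in> carrier FG"
    if "r \<in> carrier D" "a \<in> carrier R" "x \<in> N" for r a x
    using that by (intro mem) (auto intro: L.R.m_closed R_carrier smult_in_stable[OF stable_N])
  ultimately show ?thesis unfolding tensor_relations_def by auto
qed

lemma K_subgroup: "subgroup K FG"
  using group.generate_is_subgroup[OF group_free_Abelian_group relations_closed] .

lemma K_closed: "k \<in> K \<Longrightarrow> k \<in> carrier FG"
  using subgroup.subset[OF K_subgroup] by blast

lemma K_zero: "0 \<in> K"
  using subgroup.one_closed[OF K_subgroup] by simp

lemma K_add: "k \<in> K \<Longrightarrow> l \<in> K \<Longrightarrow> k + l \<in> K"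
  using subgroup.m_closed[OF K_subgroup] by simp

lemma K_minus: "k \<in> K \<Longrightarrow> - k \<in> K"
  using subgroup.m_inv_closed[OF K_subgroup, of k] K_closed[of k] inv_free_Abelian_group[of k "carrier D \<times> N"]
  by simp

lemma K_diff: "k \<in> K \<Longrightarrow> l \<in> K \<Longrightarrow> k - l \<in> K"
  using K_add[OF _ K_minus, of k l] by simp

lemma K_sum: "(\<And>i. i \<in> I \<Longrightarrow> f i \<in> K) \<Longrightarrow> sum f I \<in> K"
  by (induction I rule: infinite_finite_induct) (auto simp: K_zero K_add)

lemma K_add_left:
  "r \<in> carrier D \<Longrightarrow> r' \<in> carrier D \<Longrightarrow> x \<in> N \<Longrightarrow>
    frag_of (r \<oplus>\<^bsub>D\<^esub> r', x) - frag_of (r, x) - frag_of (r', x) \<in> K"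
  by (rule generate.incl) (auto simp: tensor_relations_def)

lemma K_add_right:
  assumes "r \<in> carrier D" "x \<in> N" "x' \<in> N"
  shows "frag_of (r, x \<oplus>\<^bsub>M\<^esub> x') - frag_of (r, x) - frag_of (r, x') \<in> K"
proof (rule generate.incl)
  have "frag_of (r, x \<oplus>\<^bsub>N_mod\<^esub> x') - frag_of (r, x) - frag_of (r, x') \<in> tensor_relations D R N_mod"
    unfolding tensor_relations_def using assms by auto
  then show "frag_of (r, x \<oplus>\<^bsub>M\<^esub> x') - frag_of (r, x) - frag_of (r, x') \<in> tensor_relations D R N_mod" by simp
qed

lemma K_balanced:
  assumes "r \<in> carrier D" "a \<in> carrier R" "x \<in> N"
  shows "frag_of (r \<otimes>\<^bsub>D\<^esub> a, x) - frag_of (r, a \<odot>\<^bsub>M\<^esub> x) \<in> K"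
proof (rule generate.incl)
  have "frag_of (r \<otimes>\<^bsub>D\<^esub> a, x) - frag_of (r, a \<odot>\<^bsub>N_mod\<^esub> x) \<in> tensor_relations D R N_mod"
    unfolding tensor_relations_def using assms by auto
  then show "frag_of (r \<otimes>\<^bsub>D\<^esub> a, x) - frag_of (r, a \<odot>\<^bsub>M\<^esub> x) \<in> tensor_relations D R N_mod" by simp
qed

lemma K_zero_right: "r \<in> carrier D \<Longrightarrow> frag_of (r, \<zero>\<^bsub>M\<^esub>) \<in> K"
  using K_minus[OF K_add_right[OF _ N_zero N_zero, of r]] by simp

lemma K_zero_left: "x \<in> N \<Longrightarrow> frag_of (\<zero>\<^bsub>D\<^esub>, x) \<in> K"
  using K_minus[OF K_add_left[OF L.R.zero_closed L.R.zero_closed, of x]] by simp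

lemma K_diff_right:
  assumes "r \<in> carrier D" "x \<in> N" "x' \<in> N"
  shows "frag_of (r, x) - frag_of (r, x') - frag_of (r, x \<oplus>\<^bsub>M\<^esub> \<ominus>\<^bsub>M\<^esub> x') \<in> K"
proof -
  have "(x \<oplus>\<^bsub>M\<^esub> \<ominus>\<^bsub>M\<^esub> x') \<oplus>\<^bsub>M\<^esub> x' = x"
    using assms N_carrier by (simp add: L.M.a_assoc L.M.l_neg)
  then have "frag_of (r, x) - frag_of (r, x \<oplus>\<^bsub>M\<^esub> \<ominus>\<^bsub>M\<^esub> x') - frag_of (r, x') \<in> K"
    using K_add_right[OF assms(1) N_add[OF assms(2) N_neg[OF assms(3)]] assms(3)] by simp
  then show ?thesis by (simp add: algebra_simps)
qed

abbreviation shift :: "nat \<Rightarrow> int \<Rightarrow> 'a" where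
  "shift i \<equiv> monomial F \<one>\<^bsub>F\<^esub> (int i)"

text \<open>Modulo \<open>K\<close>, \<open>c\<close> is a sum of tensors \<open>\<Phi>\<^sup>i \<otimes> u\<^sub>i\<close> with one summand for each \<open>i < s\<close>.\<close>

definition normal_form :: "((int \<Rightarrow> 'a) \<times> 'c \<Rightarrow>\<^sub>0 int) \<Rightarrow> bool" where
  "normal_form c \<longleftrightarrow> (\<exists>u\<in>{..<s} \<rightarrow> N. c - (\<Sum>i<s. frag_of (shift i, u i)) \<in> K)"

lemma normal_formI: "u \<in> {..<s} \<rightarrow> N \<Longrightarrow> c - (\<Sum>i<s. frag_of (shift i, u i)) \<in> K \<Longrightarrow> normal_form c"
  unfolding normal_form_def by blast

lemma normal_form_cong: "normal_form c \<Longrightarrow> c' - c \<in> K \<Longrightarrow> normal_form c'"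
proof -
  assume c: "normal_form c" and cc: "c' - c \<in> K"
  obtain u where u: "u \<in> {..<s} \<rightarrow> N" "c - (\<Sum>i<s. frag_of (shift i, u i)) \<in> K"
    using c unfolding normal_form_def by blast
  show ?thesis using K_add[OF cc u(2)] u(1) by (intro normal_formI[of u]) simp_all
qed

lemma normal_form_zero: "normal_form 0"
proof (rule normal_formI[of "\<lambda>_. \<zero>\<^bsub>M\<^esub>"])
  have "(\<Sum>i<s. frag_of (shift i, \<zero>\<^bsub>M\<^esub>)) \<in> K"
    by (rule K_sum) (simp add: K_zero_right)
  then show "0 - (\<Sum>i<s. frag_of (shift i, \<zero>\<^bsub>M\<^esub>)) \<in> K" using K_minus by simp
qed (simp add: N_zero)

lemma normal_form_diff:
  assumes "normal_form c" "normal_form d"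
  shows "normal_form (c - d)"
proof -
  obtain u where u: "u \<in> {..<s} \<rightarrow> N" "c - (\<Sum>i<s. frag_of (shift i, u i)) \<in> K"
    using assms(1) unfolding normal_form_def by blast
  obtain v where v: "v \<in> {..<s} \<rightarrow> N" "d - (\<Sum>i<s. frag_of (shift i, v i)) \<in> K"
    using assms(2) unfolding normal_form_def by blast
  let ?w = "\<lambda>i. u i \<oplus>\<^bsub>M\<^esub> \<ominus>\<^bsub>M\<^esub> v i"
  show ?thesis
  proof (rule normal_formI[of ?w])
    show "?w \<in> {..<s} \<rightarrow> N" using u(1) v(1) N_add N_neg by (simp add: Pi_iff)
    have "(\<Sum>i<s. frag_of (shift i, u i) - frag_of (shift i, v i) - frag_of (shift i, ?w i)) \<in> K"
      using u(1) v(1) by (intro K_sum K_diff_right) auto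
    then have "(c - (\<Sum>i<s. frag_of (shift i, u i))) - (d - (\<Sum>i<s. frag_of (shift i, v i))) +
      (\<Sum>i<s. frag_of (shift i, u i) - frag_of (shift i, v i) - frag_of (shift i, ?w i)) \<in> K"
      using K_add K_diff u(2) v(2) by blast
    then show "c - d - (\<Sum>i<s. frag_of (shift i, ?w i)) \<in> K"
      by (simp add: sum_subtractf sum.distrib algebra_simps)
  qed
qed

lemma normal_form_add: "normal_form c \<Longrightarrow> normal_form d \<Longrightarrow> normal_form (c + d)"
  using normal_form_diff[OF _ normal_form_diff[OF normal_form_zero], of c d] by simp

lemma normal_form_shift:
  assumes "i < s" "x \<in> N"
  shows "normal_form (frag_of (shift i, x))"
proof (rule normal_formI[of "\<lambda>j. if i = j then x else \<zero>\<^bsub>M\<^esub>"])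
  show "(\<lambda>j. if i = j then x else \<zero>\<^bsub>M\<^esub>) \<in> {..<s} \<rightarrow> N" using assms N_zero by auto
  let ?g = "\<lambda>j. frag_of (shift j, if i = j then x else \<zero>\<^bsub>M\<^esub>)"
  have "(\<Sum>j\<in>{..<s} - {i}. ?g j) \<in> K"
    by (rule K_sum) (auto simp: K_zero_right)
  moreover have "sum ?g {..<s} = ?g i + (\<Sum>j\<in>{..<s} - {i}. ?g j)"
    using assms(1) by (intro sum.remove) auto
  then have "frag_of (shift i, x) - sum ?g {..<s} = - (\<Sum>j\<in>{..<s} - {i}. ?g j)" by simp
  ultimately show "frag_of (shift i, x) - sum ?g {..<s} \<in> K"
    using K_minus by (simp only:)
qed

text \<open>A monomial \<open>f \<Phi>\<^sup>k\<close> with \<open>k = i + s q\<close> factors as \<open>\<Phi>\<^sup>i a\<close> with \<open>a = \<phi>\<^sup>-\<^sup>i(f) \<Phi>\<^sup>s\<^sup>q\<close> in \<open>D\<^sub>s\<close>, and \<open>a\<close> passes through the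
  tensor sign.\<close>

lemma normal_form_generator:
  assumes "r \<in> carrier D" "x \<in> N"
  shows "normal_form (frag_of (r, x))"
proof (rule skew_laurent_induct[OF assms(1), of "\<lambda>r. normal_form (frag_of (r, x))"])
  show "normal_form (frag_of (\<lambda>i. \<zero>\<^bsub>F\<^esub>, x))"
    using normal_form_cong[OF normal_form_zero] K_zero_left[OF assms(2)] by (simp add: skew_laurent_simps)
next
  fix k q assume q: "q \<in> carrier D" "normal_form (frag_of (q, x))"
  define f where "f = r k"
  have f: "f \<in> carrier F" unfolding f_def using skew_laurentD(1)[OF assms(1)] .
  define i where "i = nat (k mod int s)"
  have i: "i < s" "k = int i + int s * (k div int s)"
    using s_pos unfolding i_def by (auto simp: nat_less_iff)
  define a where "a = monomial F (aut_power F \<phi> (- int i) f) (int s * (k div int s))"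
  have aR: "a \<in> carrier R"
    unfolding a_def skew_laurent_sub_def
    using monomial_closed[OF aut_power_closed[OF f]] by (auto simp: monomial_def split: if_splits)
  have "shift i \<otimes>\<^bsub>D\<^esub> a = monomial F f k"
    unfolding a_def using f by (simp add: monomial_mult i(2)[symmetric])
  then have "frag_of (monomial F f k, x) - frag_of (shift i, a \<odot>\<^bsub>M\<^esub> x) \<in> K"
    using K_balanced[of "shift i" a x] aR assms(2) by simp
  moreover have "normal_form (frag_of (shift i, a \<odot>\<^bsub>M\<^esub> x))"
    using normal_form_shift[OF i(1) smult_in_stable[OF stable_N aR assms(2)]] .
  ultimately have "normal_form (frag_of (monomial F f k, x))" using normal_form_cong by blast
  then have "normal_form (frag_of (monomial F f k, x) + frag_of (q, x))" using normal_form_add q(2) by blast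
  moreover have "frag_of (monomial F f k \<oplus>\<^bsub>D\<^esub> q, x) - (frag_of (monomial F f k, x) + frag_of (q, x)) \<in> K"
    using K_add_left[OF monomial_closed[OF f] q(1) assms(2)] by (simp add: algebra_simps)
  ultimately show "normal_form (frag_of (monomial F (r k) k \<oplus>\<^bsub>D\<^esub> q, x))"
    unfolding f_def[symmetric] using normal_form_cong by blast
qed

lemma normal_form_exists: "c \<in> carrier FG \<Longrightarrow> normal_form c"
proof -
  assume "c \<in> carrier FG"
  then have "Poly_Mapping.keys c \<subseteq> carrier D \<times> N" by simp
  then show ?thesis
    by (rule free_Abelian_group_induct)
      (auto simp: normal_form_zero normal_form_diff normal_form_generator)
qed

text \<open>The homomorphism \<open>(r, x) \<mapsto> r x\<close> given by the universal property of the free abelian group.\<close>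

definition eval_tensor :: "((int \<Rightarrow> 'a) \<times> 'c \<Rightarrow>\<^sub>0 int) \<Rightarrow> 'c" where
  "eval_tensor = (SOME h. h \<in> hom FG (add_monoid M) \<and> (\<forall>z\<in>carrier D \<times> N. h (frag_of z) = fst z \<odot>\<^bsub>M\<^esub> snd z))"

lemma eval_tensor:
  "eval_tensor \<in> hom FG (add_monoid M)"
  "r \<in> carrier D \<Longrightarrow> x \<in> N \<Longrightarrow> eval_tensor (frag_of (r, x)) = r \<odot>\<^bsub>M\<^esub> x"
proof -
  have im: "(\<lambda>z. fst z \<odot>\<^bsub>M\<^esub> snd z) ` (carrier D \<times> N) \<subseteq> carrier (add_monoid M)"
    using L.smult_closed N_carrier by auto
  obtain h where "h \<in> hom FG (add_monoid M)" "\<And>z. z \<in> carrier D \<times> N \<Longrightarrow> h (frag_of z) = fst z \<odot>\<^bsub>M\<^esub> snd z"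
    using comm_group.free_Abelian_group_universal[OF L.M.a_comm_group im] by blast
  then have "\<exists>h. h \<in> hom FG (add_monoid M) \<and> (\<forall>z\<in>carrier D \<times> N. h (frag_of z) = fst z \<odot>\<^bsub>M\<^esub> snd z)" by blast
  from someI_ex[OF this, folded eval_tensor_def]
  show "eval_tensor \<in> hom FG (add_monoid M)"
    "r \<in> carrier D \<Longrightarrow> x \<in> N \<Longrightarrow> eval_tensor (frag_of (r, x)) = r \<odot>\<^bsub>M\<^esub> x" by auto
qed

lemma eval_closed: "c \<in> carrier FG \<Longrightarrow> eval_tensor c \<in> carrier M"
  using hom_in_carrier[OF eval_tensor(1)] by simp

lemma eval_add: "c \<in> carrier FG \<Longrightarrow> d \<in> carrier FG \<Longrightarrow> eval_tensor (c + d) = eval_tensor c \<oplus>\<^bsub>M\<^esub> eval_tensor d"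
  using hom_mult[OF eval_tensor(1)] by simp

lemma FG_add: "c \<in> carrier FG \<Longrightarrow> d \<in> carrier FG \<Longrightarrow> c + d \<in> carrier FG"
  using Poly_Mapping.keys_add[of c d] by auto

lemma eval_diff:
  assumes "c \<in> carrier FG" "d \<in> carrier FG"
  shows "eval_tensor (c - d) = eval_tensor c \<ominus>\<^bsub>M\<^esub> eval_tensor d"
proof -
  have cd: "c - d \<in> carrier FG" using free_Abelian_group_diff assms .
  have "eval_tensor c = eval_tensor (c - d) \<oplus>\<^bsub>M\<^esub> eval_tensor d" using eval_add[OF cd assms(2)] by simp
  then show ?thesis
    using eval_closed assms cd by (simp add: L.M.minus_eq L.M.a_assoc L.M.r_neg)
qed

lemma eval_zero: "eval_tensor 0 = \<zero>\<^bsub>M\<^esub>"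
  using eval_diff[of 0 0] eval_closed[of 0] by (simp add: L.M.minus_eq L.M.r_neg)

lemma eval_normal_form:
  assumes "u \<in> {..<s} \<rightarrow> N"
  shows "(\<Sum>i<s. frag_of (shift i, u i)) \<in> carrier FG"
    "eval_tensor (\<Sum>i<s. frag_of (shift i, u i)) = (\<Oplus>\<^bsub>V\<^esub>i\<in>{..<s}. act (int i) (u i))"
proof -
  have mem: "frag_of (shift i, u i) \<in> carrier FG" if "i < s" for i
    using assms that by auto
  have part: "(\<Sum>i<n. frag_of (shift i, u i)) \<in> carrier FG \<and>
      eval_tensor (\<Sum>i<n. frag_of (shift i, u i)) = (\<Oplus>\<^bsub>V\<^esub>i\<in>{..<n}. act (int i) (u i))" if "n \<le> s" for n
    using that
  proof (induction n)
    case 0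
    then show ?case by (simp add: eval_zero)
  next
    case (Suc n)
    have un: "u n \<in> N" using assms Suc(2) by auto
    have cl: "act (int i) (u i) \<in> carrier V" if "i \<le> n" for i
      using Pi_mem[OF assms, of i] Suc(2) that N_carrier by (intro A.P_closed) simp
    have "(\<Oplus>\<^bsub>V\<^esub>i\<in>{..<Suc n}. act (int i) (u i)) = act (int n) (u n) \<oplus>\<^bsub>V\<^esub> (\<Oplus>\<^bsub>V\<^esub>i\<in>{..<n}. act (int i) (u i))"
      unfolding lessThan_Suc using cl by (intro A.M.finsum_insert) auto
    moreover have "eval_tensor (frag_of (shift n, u n)) = act (int n) (u n)"
      using eval_tensor(2)[OF monomial_closed un] by (simp add: act_def)
    ultimately show ?case
      using Suc eval_add[OF _ mem[of n]] FG_add[OF _ mem[of n]] eval_closed cl[of n] A.M.finsum_closed[of "\<lambda>i. act (int i) (u i)" "{..<n}"] cl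
      by (simp add: L.M.a_comm)
  qed
  then show "(\<Sum>i<s. frag_of (shift i, u i)) \<in> carrier FG"
    "eval_tensor (\<Sum>i<s. frag_of (shift i, u i)) = (\<Oplus>\<^bsub>V\<^esub>i\<in>{..<s}. act (int i) (u i))" by auto
qed

lemma K_subset_kernel: "k \<in> K \<Longrightarrow> eval_tensor k = \<zero>\<^bsub>M\<^esub>"
proof -
  assume k: "k \<in> K"
  interpret FG: group FG by simp
  let ?Z = "{c \<in> carrier FG. eval_tensor c = \<zero>\<^bsub>M\<^esub>}"
  have "subgroup ?Z FG"
  proof (rule FG.subgroupI)
    show "?Z \<noteq> {}" using eval_zero by (auto intro!: exI[of _ 0])
    show "inv\<^bsub>FG\<^esub> c \<in> ?Z" if "c \<in> ?Z" for c
      using that eval_diff[of 0 c] eval_zero by (simp add: L.M.minus_eq)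
    show "c \<otimes>\<^bsub>FG\<^esub> d \<in> ?Z" if "c \<in> ?Z" "d \<in> ?Z" for c d
      using that eval_add[of c d] FG_add[of c d] by simp
  qed auto
  moreover have "tensor_relations D R N_mod \<subseteq> ?Z"
  proof -
    have fr: "frag_of (r, x) \<in> carrier FG" if "r \<in> carrier D" "x \<in> N" for r x
      using that by simp
    have *: "eval_tensor (a - b - c) = \<zero>\<^bsub>M\<^esub>"
      if "a \<in> carrier FG" "b \<in> carrier FG" "c \<in> carrier FG" "eval_tensor a = eval_tensor b \<oplus>\<^bsub>M\<^esub> eval_tensor c" for a b c
    proof -
      have "eval_tensor (a - (b + c)) = eval_tensor (b + c) \<ominus>\<^bsub>M\<^esub> eval_tensor (b + c)"
        using eval_diff[OF that(1) FG_add[OF that(2,3)]] eval_add[OF that(2,3)] that(4) by simp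
      then show ?thesis
        using eval_closed[OF FG_add[OF that(2,3)]] by (simp add: L.M.minus_eq L.M.r_neg diff_diff_eq)
    qed
    have "eval_tensor (frag_of (r \<oplus>\<^bsub>D\<^esub> r', x) - frag_of (r, x) - frag_of (r', x)) = \<zero>\<^bsub>M\<^esub>"
      if "r \<in> carrier D" "r' \<in> carrier D" "x \<in> N" for r r' x
      using that L.smult_l_distr N_carrier by (intro * fr) (simp_all add: eval_tensor(2))
    moreover have "eval_tensor (frag_of (r, x \<oplus>\<^bsub>M\<^esub> x') - frag_of (r, x) - frag_of (r, x')) = \<zero>\<^bsub>M\<^esub>"
      if "r \<in> carrier D" "x \<in> N" "x' \<in> N" for r x x'
      using that L.smult_r_distr N_carrier N_add by (intro * fr) (simp_all add: eval_tensor(2))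
    moreover have "eval_tensor (frag_of (r \<otimes>\<^bsub>D\<^esub> a, x) - frag_of (r, a \<odot>\<^bsub>M\<^esub> x)) = \<zero>\<^bsub>M\<^esub>"
      if "r \<in> carrier D" "a \<in> carrier R" "x \<in> N" for r a x
    proof -
      have ax: "a \<odot>\<^bsub>M\<^esub> x \<in> N" using smult_in_stable[OF stable_N] that by blast
      have ra: "r \<otimes>\<^bsub>D\<^esub> a \<in> carrier D" using that R_carrier by blast
      show ?thesis
        using eval_diff[OF fr[OF ra that(3)] fr[OF that(1) ax]] eval_tensor(2)[OF ra that(3)] eval_tensor(2)[OF that(1) ax]
          L.smult_assoc[OF that(1) R_carrier[OF that(2)] N_carrier[OF that(3)]]
          L.smult_closed[OF that(1) N_carrier[OF ax]]
        by (simp add: L.M.minus_eq L.M.r_neg)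
    qed
    ultimately have "eval_tensor z = \<zero>\<^bsub>M\<^esub>" if "z \<in> tensor_relations D R N_mod" for z
      using that unfolding tensor_relations_def by auto
    then show ?thesis using relations_closed by blast
  qed
  ultimately have "K \<subseteq> ?Z" using FG.generate_subgroup_incl by blast
  then show ?thesis using k by blast
qed

text \<open>A normal form that evaluates to zero has all its components \<open>u\<^sub>i\<close> equal to zero, since \<open>M\<close> is the direct sum
  of the translates of \<open>N\<close>.\<close>

lemma kernel_subset_K:
  assumes "c \<in> carrier FG" "eval_tensor c = \<zero>\<^bsub>M\<^esub>"
  shows "c \<in> K"
proof -
  obtain u where u: "u \<in> {..<s} \<rightarrow> N" "c - (\<Sum>i<s. frag_of (shift i, u i)) \<in> K"
    using normal_form_exists[OF assms(1)] unfolding normal_form_def by blast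
  let ?w = "\<Sum>i<s. frag_of (shift i, u i)"
  note ev = eval_normal_form[OF u(1)]
  have "eval_tensor ?w = \<zero>\<^bsub>M\<^esub>"
    using K_subset_kernel[OF u(2)] eval_diff[OF assms(1) ev(1)] assms(2) eval_closed[OF ev(1)]
    by (simp add: L.M.minus_eq)
  then have "(\<Oplus>\<^bsub>V\<^esub>i\<in>{..<s}. act (int i) (u i)) = \<zero>\<^bsub>V\<^esub>" using ev(2) by simp
  also have "\<zero>\<^bsub>V\<^esub> = (\<Oplus>\<^bsub>V\<^esub>i\<in>{..<s}. act (int i) \<zero>\<^bsub>V\<^esub>)"
    by (rule A.M.add.finprod_one_eqI[symmetric]) (rule A.P_zero)
  finally have sums: "(\<Oplus>\<^bsub>V\<^esub>i\<in>{..<s}. act (int i) (u i)) = (\<Oplus>\<^bsub>V\<^esub>i\<in>{..<s}. act (int i) \<zero>\<^bsub>V\<^esub>)" .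
  have "u i = \<zero>\<^bsub>V\<^esub>" if "i < s" for i
    by (rule A.orbit_directD[OF direct_N u(1) _ sums that]) (simp add: N_zero)
  then have "?w \<in> K" by (intro K_sum) (simp add: K_zero_right)
  then show ?thesis using K_add[OF u(2), of ?w] by simp
qed

lemma coset_eq_fibre:
  assumes "c \<in> carrier FG"
  shows "K #>\<^bsub>FG\<^esub> c = {d \<in> carrier FG. eval_tensor d = eval_tensor c}"
proof
  show "K #>\<^bsub>FG\<^esub> c \<subseteq> {d \<in> carrier FG. eval_tensor d = eval_tensor c}"
  proof
    fix d assume "d \<in> K #>\<^bsub>FG\<^esub> c"
    then obtain k where k: "k \<in> K" "d = k + c" by (auto simp: r_coset_def)
    then show "d \<in> {d \<in> carrier FG. eval_tensor d = eval_tensor c}"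
      using FG_add[OF K_closed[OF k(1)] assms] eval_add[OF K_closed[OF k(1)] assms] K_subset_kernel[OF k(1)]
        eval_closed[OF assms] by simp
  qed
  show "{d \<in> carrier FG. eval_tensor d = eval_tensor c} \<subseteq> K #>\<^bsub>FG\<^esub> c"
  proof
    fix d assume "d \<in> {d \<in> carrier FG. eval_tensor d = eval_tensor c}"
    then have d: "d \<in> carrier FG" "eval_tensor d = eval_tensor c" by auto
    then have "d - c \<in> K"
      using free_Abelian_group_diff[OF d(1) assms] eval_diff[OF d(1) assms] eval_closed[OF assms]
      by (intro kernel_subset_K) (auto simp: L.M.minus_eq L.M.r_neg)
    then show "d \<in> K #>\<^bsub>FG\<^esub> c" unfolding r_coset_def by (auto intro!: bexI[of _ "d - c"])
  qed
qed

lemma eval_surj: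
  assumes "m \<in> carrier M"
  obtains c where "c \<in> carrier FG" "eval_tensor c = m"
proof -
  have "m \<in> A.orbit_sum s N" using assms direct_N by (simp add: A.orbit_direct_def)
  then obtain u where u: "u \<in> {..<s} \<rightarrow> N" "m = (\<Oplus>\<^bsub>V\<^esub>i\<in>{..<s}. act (int i) (u i))" by (rule A.orbit_sumE)
  show ?thesis
    by (rule that[OF eval_normal_form(1)[OF u(1)]]) (unfold u(2), rule eval_normal_form(2)[OF u(1)])
qed

definition left_mult :: "(int \<Rightarrow> 'a) \<Rightarrow> ((int \<Rightarrow> 'a) \<times> 'c \<Rightarrow>\<^sub>0 int) \<Rightarrow> ((int \<Rightarrow> 'a) \<times> 'c \<Rightarrow>\<^sub>0 int)" where
  "left_mult r = frag_extend (\<lambda>(d, x). frag_of (r \<otimes>\<^bsub>D\<^esub> d, x))"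

lemma eval_left_mult:
  assumes "r \<in> carrier D" "c \<in> carrier FG"
  shows "left_mult r c \<in> carrier FG" "eval_tensor (left_mult r c) = r \<odot>\<^bsub>M\<^esub> eval_tensor c"
proof -
  have r0: "r \<odot>\<^bsub>M\<^esub> \<zero>\<^bsub>M\<^esub> = \<zero>\<^bsub>M\<^esub>"
    using L.smult_r_distr[OF assms(1) L.M.zero_closed L.M.zero_closed]
      L.smult_closed[OF assms(1) L.M.zero_closed] by (simp add: L.M.add.r_cancel_one')
  have rd: "r \<odot>\<^bsub>M\<^esub> (x \<ominus>\<^bsub>M\<^esub> y) = r \<odot>\<^bsub>M\<^esub> x \<ominus>\<^bsub>M\<^esub> r \<odot>\<^bsub>M\<^esub> y" if "x \<in> carrier M" "y \<in> carrier M" for x y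
  proof -
    have "x = (x \<ominus>\<^bsub>M\<^esub> y) \<oplus>\<^bsub>M\<^esub> y" using that by (simp add: L.M.minus_eq L.M.a_assoc L.M.l_neg)
    then have "r \<odot>\<^bsub>M\<^esub> x = r \<odot>\<^bsub>M\<^esub> (x \<ominus>\<^bsub>M\<^esub> y) \<oplus>\<^bsub>M\<^esub> r \<odot>\<^bsub>M\<^esub> y"
      using L.smult_r_distr[OF assms(1) _ that(2), of "x \<ominus>\<^bsub>M\<^esub> y"] that by simp
    then show ?thesis using L.smult_closed[OF assms(1)] that
      by (simp add: L.M.minus_eq L.M.a_assoc L.M.r_neg)
  qed
  let ?Q = "\<lambda>c. left_mult r c \<in> carrier FG \<and> eval_tensor (left_mult r c) = r \<odot>\<^bsub>M\<^esub> eval_tensor c"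
  have "?Q c"
  proof (rule free_Abelian_group_induct[of c "carrier D \<times> N" ?Q])
    show "Poly_Mapping.keys c \<subseteq> carrier D \<times> N" using assms(2) by simp
    show "?Q 0" by (simp add: left_mult_def eval_zero r0)
  next
    fix x y
    assume xy: "Poly_Mapping.keys x \<subseteq> carrier D \<times> N" "Poly_Mapping.keys y \<subseteq> carrier D \<times> N" "?Q x" "?Q y"
    then have mem: "x \<in> carrier FG" "y \<in> carrier FG" "left_mult r x \<in> carrier FG" "left_mult r y \<in> carrier FG" by auto
    have "left_mult r (x - y) = left_mult r x - left_mult r y" by (simp add: left_mult_def frag_extend_diff)
    moreover have "eval_tensor (left_mult r x - left_mult r y) = r \<odot>\<^bsub>M\<^esub> eval_tensor (x - y)"
      unfolding eval_diff[OF mem(3,4)] eval_diff[OF mem(1,2)] rd[OF eval_closed[OF mem(1)] eval_closed[OF mem(2)]]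
      using xy(3,4) by simp
    ultimately show "?Q (x - y)" using free_Abelian_group_diff[OF mem(3,4)] by (simp only:)
  next
    fix z assume "z \<in> carrier D \<times> N"
    then obtain d x where z: "z = (d, x)" "d \<in> carrier D" "x \<in> N" by auto
    then have "r \<otimes>\<^bsub>D\<^esub> d \<in> carrier D" using assms(1) by blast
    then show "?Q (frag_of z)"
      using z assms(1) L.smult_assoc[OF assms(1) z(2) N_carrier[OF z(3)]]
      by (simp add: left_mult_def eval_tensor(2))
  qed
  then show "left_mult r c \<in> carrier FG" "eval_tensor (left_mult r c) = r \<odot>\<^bsub>M\<^esub> eval_tensor c" by auto
qed

text \<open>As \<open>K\<close> is the kernel of the evaluation, its cosets are the fibres of the evaluation. So the map from \<open>M\<close> can
  be given directly, by sending a vector to the fibre over it.\<close>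

lemma isomorphic_induced: "isomorphic_modules D M (induced_module D R N_mod)"
proof -
  interpret FG: comm_group FG by (rule abelian_free_Abelian_group)
  have nK: "normal K FG" using FG.normal_iff_subgroup K_subgroup by blast
  let ?I = "induced_module D R N_mod"
  have ind: "carrier ?I = carrier (FG Mod K)" "x \<oplus>\<^bsub>?I\<^esub> y = x \<otimes>\<^bsub>FG Mod K\<^esub> y"
    "r \<odot>\<^bsub>?I\<^esub> B = (\<Union>c\<in>B. K #>\<^bsub>FG\<^esub> left_mult r c)" for x y r B
    by (simp_all add: induced_module_def Let_def left_mult_def)
  define h where "h m = {c \<in> carrier FG. eval_tensor c = m}" for m
  have h_coset: "h (eval_tensor c) = K #>\<^bsub>FG\<^esub> c" if "c \<in> carrier FG" for c
    using coset_eq_fibre[OF that] by (simp add: h_def)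
  have car: "h m \<in> carrier ?I" if m: "m \<in> carrier M" for m
  proof -
    obtain c where c: "c \<in> carrier FG" "eval_tensor c = m" using eval_surj[OF m] .
    then have "h m = K #>\<^bsub>FG\<^esub> c" using h_coset by blast
    then show ?thesis using c(1) unfolding ind(1) FactGroup_def RCOSETS_def by auto
  qed
  have add: "h (m \<oplus>\<^bsub>M\<^esub> n) = h m \<oplus>\<^bsub>?I\<^esub> h n" if m: "m \<in> carrier M" and n: "n \<in> carrier M" for m n
  proof -
    obtain c where c: "c \<in> carrier FG" "eval_tensor c = m" using eval_surj[OF m] .
    obtain d where d: "d \<in> carrier FG" "eval_tensor d = n" using eval_surj[OF n] .
    have "h m \<oplus>\<^bsub>?I\<^esub> h n = (K #>\<^bsub>FG\<^esub> c) <#>\<^bsub>FG\<^esub> (K #>\<^bsub>FG\<^esub> d)"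
      unfolding ind(2) c(2)[symmetric] d(2)[symmetric] h_coset[OF c(1)] h_coset[OF d(1)]
      by (simp add: FactGroup_def)
    also have "\<dots> = K #>\<^bsub>FG\<^esub> (c \<otimes>\<^bsub>FG\<^esub> d)" by (rule normal.rcos_sum[OF nK c(1) d(1)])
    also have "\<dots> = h (eval_tensor (c + d))" using h_coset[OF FG_add[OF c(1) d(1)]] by simp
    finally show ?thesis using eval_add[OF c(1) d(1)] c(2) d(2) by simp
  qed
  have smult: "h (r \<odot>\<^bsub>M\<^esub> m) = r \<odot>\<^bsub>?I\<^esub> h m" if r: "r \<in> carrier D" and m: "m \<in> carrier M" for r m
  proof -
    have coset: "K #>\<^bsub>FG\<^esub> left_mult r c = h (r \<odot>\<^bsub>M\<^esub> m)" if "c \<in> h m" for c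
    proof -
      have c: "c \<in> carrier FG" "eval_tensor c = m" using that by (simp_all add: h_def)
      note e = eval_left_mult[OF r c(1)]
      have "K #>\<^bsub>FG\<^esub> left_mult r c = h (eval_tensor (left_mult r c))" by (rule h_coset[OF e(1), symmetric])
      then show ?thesis unfolding e(2) c(2) .
    qed
    obtain c0 where "c0 \<in> carrier FG" "eval_tensor c0 = m" using eval_surj[OF m] .
    then have "c0 \<in> h m" by (simp add: h_def)
    then show ?thesis unfolding ind(3) using coset by auto
  qed
  have "bij_betw h (carrier M) (carrier ?I)"
    unfolding bij_betw_def
  proof
    show "inj_on h (carrier M)"
    proof (rule inj_onI)
      fix m n assume mn: "m \<in> carrier M" "n \<in> carrier M" "h m = h n"
      obtain c where c: "c \<in> carrier FG" "eval_tensor c = m" using eval_surj[OF mn(1)] .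
      then have "c \<in> h n" using mn(3) unfolding h_def by blast
      then show "m = n" using c(2) unfolding h_def by blast
    qed
    show "h ` carrier M = carrier ?I"
    proof
      show "h ` carrier M \<subseteq> carrier ?I" using car by blast
      show "carrier ?I \<subseteq> h ` carrier M"
      proof
        fix B assume "B \<in> carrier ?I"
        then obtain c where c: "c \<in> carrier FG" "B = K #>\<^bsub>FG\<^esub> c"
          unfolding ind(1) FactGroup_def RCOSETS_def by auto
        then have "B = h (eval_tensor c)" using h_coset by blast
        then show "B \<in> h ` carrier M" using eval_closed[OF c(1)] by blast
      qed
    qed
  qed
  moreover have "h \<in> module_hom D M ?I"
    unfolding module_hom_def using car add smult by auto
  ultimately show ?thesis unfolding isomorphic_modules_def by blast
qed

end

section \<open>Reducible restrictions come from induction\<close>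

theorem theorem6p4:
  fixes F :: "('a, 'b) ring_scheme" and \<phi> :: "'a \<Rightarrow> 'a"
    and M :: "(int \<Rightarrow> 'a, 'm) module" and t :: nat
  assumes "difference_field F \<phi>"
    and "algebraically_closed (constant_field F \<phi>)"
    and "characteristic_zero (constant_field F \<phi>)"
    and "difference_module F (skew_laurent F \<phi>) M"
    and "irreducible_module (skew_laurent F \<phi>) M"
    and "t \<ge> 1"
    and "reducible_module (skew_laurent_sub F \<phi> t) M"
  shows "\<exists>(s::nat) (N :: (int \<Rightarrow> 'a, 'm) module).
    s > 1 \<and> s dvd gcd t (vectorspace.dim F (underlying_space F M)) \<and>
    difference_module F (skew_laurent_sub F \<phi> s) N \<and>
    irreducible_module (skew_laurent_sub F \<phi> s) N \<and>
    isomorphic_modules (skew_laurent F \<phi>) M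
      (induced_module (skew_laurent F \<phi>) (skew_laurent_sub F \<phi> s) N)"
proof -
  interpret laurent_module F \<phi> M
    using assms(1,4) by (simp add: laurent_module_def difference_module_def)
  have constants_eq: "A.constants = constant_field F \<phi>" by (simp add: constant_field_def)
  interpret I: irreducible_action F V "aut_power F \<phi>" act
  proof unfold_locales
    show "A.fin_dim" using assms(4) by (simp add: difference_module_def)
    show "U = {\<zero>\<^bsub>V\<^esub>} \<or> U = carrier V" if "A.stable 1 U" for U
      using assms(5) that submodule_iff_stable_1 unfolding irreducible_module_def by simp
  qed
  obtain U where U: "A.stable t U" "U \<noteq> {\<zero>\<^bsub>V\<^esub>}" "U \<noteq> carrier V"
    using assms(7) submodule_iff_stable unfolding reducible_module_def by auto
  obtain s N where s: "1 < s" "s dvd t" "s dvd A.dim" and N: "A.stable s N" "N \<noteq> {\<zero>\<^bsub>V\<^esub>}" "A.orbit_direct s N"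
      and simple: "\<forall>U. A.stable s U \<longrightarrow> U \<subseteq> N \<longrightarrow> U = {\<zero>\<^bsub>V\<^esub>} \<or> U = N"
    using I.cyclic_decomposition[of t U] assms(2,3,6) U unfolding constants_eq by auto
  interpret N: direct_laurent_module F \<phi> M s N
    by unfold_locales (use s(1) N in auto)
  let ?N = "M\<lparr>carrier := N\<rparr>"
  have left: "left_module (skew_laurent_sub F \<phi> s) ?N" using left_module_stable[OF N(1)] .
  have "underlying_space F ?N = V\<lparr>carrier := N\<rparr>" by (simp add: underlying_space_def)
  then have "vectorspace.fin_dim F (underlying_space F ?N)"
    using A.subspace_fin_dim[OF I.fin_dim A.stableD(1)[OF N(1)]] by simp
  then have dm: "difference_module F (skew_laurent_sub F \<phi> s) ?N"
    using left by (simp add: difference_module_def)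
  have "U' = {\<zero>\<^bsub>V\<^esub>} \<or> U' = N" if sub: "Module.submodule U' (skew_laurent_sub F \<phi> s) ?N" for U'
  proof -
    interpret U': Module.submodule U' "skew_laurent_sub F \<phi> s" ?N by (rule sub)
    have XN: "U' \<subseteq> N" using U'.subset by simp
    have "Module.submodule U' (skew_laurent_sub F \<phi> s) M"
    proof -
      have sgN: "subgroup N (add_monoid M)"
        using N(1) submodule_iff_stable[of N s] by (simp add: Module.submodule_def)
      have "add_monoid ?N = add_monoid M\<lparr>carrier := N\<rparr>" by simp
      then have "subgroup U' (add_monoid M\<lparr>carrier := N\<rparr>)" using U'.subgroup_axioms by simp
      then have "subgroup U' (add_monoid M)"
        using group.incl_subgroup[OF L.M.a_group sgN] by simp
      then show ?thesis
        using U'.smult_closed by (simp add: Module.submodule_def submodule_axioms_def)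
    qed
    then show ?thesis using submodule_iff_stable simple XN by blast
  qed
  then have "irreducible_module (skew_laurent_sub F \<phi> s) ?N"
    unfolding irreducible_module_def using left N(2) by simp
  then show ?thesis using s dm N.isomorphic_induced by (intro exI[of _ s] exI[of _ ?N]) simp
qed

end
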